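(* Let $\kappa\in\mathbb C$ with $\operatorname{Im}\kappa<0$ and $\operatorname{Re}\kappa\neq0$, and let $n_1\le n_\infty\le n_2$. Then the following four sets of minimizers are nonempty: $$\operatorname*{arg\,min}_{\varepsilon\in\mathbb F,\ \kappa\in\Sigma(\varepsilon)}L(\varepsilon),\qquad \operatorname*{arg\,min}_{\varepsilon\in\mathbb F^{\mathrm{sym}},\ \kappa\in\Sigma(\varepsilon)}L(\varepsilon),\qquad \operatorname*{arg\,min}_{\varepsilon\in\mathbb F^{\mathrm{sym}},\ \kappa\in\Sigma^{\mathrm{odd}}(\varepsilon)}L(\varepsilon),\qquad \operatorname*{arg\,min}_{\varepsilon\in\mathbb F^{\mathrm{sym}},\ \kappa\in\Sigma^{\mathrm{even}}(\varepsilon)}L(\varepsilon).$$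
   Context: Fix constants $0<n_1<n_2$ and $n_\infty>0$. $\mathbb F$ is the family of positive $\varepsilon\in L^\infty(\mathbb R;\mathbb R)$ for which there exist real $s_-\le s_+$ with $\varepsilon(s)=n_\infty^2$ for a.a. $s\in\mathbb R\setminus[s_-,s_+]$ and $n_1^2\le\varepsilon(s)\le n_2^2$ for a.a. $s\in(s_-,s_+)$. $\mathbb F^{\mathrm{sym}}=\{\varepsilon\in\mathbb F:\varepsilon(s)=\varepsilon(-s)\text{ a.e.}\}$. If $\varepsilon$ is not the constant $n_\infty^2$, $[s_-^\varepsilon,s_+^\varepsilon]$ is the shortest interval outside of which $\varepsilon=n_\infty^2$ a.e., and $L(\varepsilon)=s_+^\varepsilon-s_-^\varepsilon$; if $\varepsilon\equiv n_\infty^2$, then $L(\varepsilon)=0$. $\Sigma(\varepsilon)$ (the set of resonances of $\varepsilon$) is the set of $\kappa\in\mathbb C\setminus\{0\}$ for which there is a nontrivial $y\in W^{2,\infty}_{\mathrm{loc}}(\mathbb R)$ (a mode) with $y''=-\kappa^2\varepsilon y$ a.e. on $\mathbb R$ and $y'(s_\pm)/\kappa=\pm\mathrm i n_\infty y(s_\pm)$, where $\varepsilon=n_\infty^2$ a.e. outside $[s_-,s_+]$. For $\varepsilon\in\mathbb F^{\mathrm{sym}}$, $\Sigma^{\mathrm{odd}}(\varepsilon)$ (resp. $\Sigma^{\mathrm{even}}(\varepsilon)$) is the set of $\kappa\in\Sigma(\varepsilon)$ whose mode is an odd (resp. even) function. *)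

theory Defs
  imports "HOL-Analysis.Analysis"
begin

text \<open>Elements of Lebesgue and Sobolev spaces are represented by functions; every notion below that
  depends on the coefficient \<open>\<epsilon>\<close> is invariant under changing \<open>\<epsilon>\<close> on a null set.\<close>

subsection \<open>Local Sobolev spaces on the real line\<close>

definition Linf :: "(real \<Rightarrow> real) set" where
  "Linf = {f. f \<in> borel_measurable lebesgue \<and> (\<exists>C. AE s in lebesgue. \<bar>f s\<bar> \<le> C)}"

definition Linf_loc :: "(real \<Rightarrow> complex) set" where
  "Linf_loc = {f. f \<in> borel_measurable lebesgue \<and>
     (\<forall>a b. \<exists>C. AE s in lebesgue. s \<in> {a..b} \<longrightarrow> norm (f s) \<le> C)}"

definition locally_integrable :: "(real \<Rightarrow> complex) \<Rightarrow> bool" where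
  "locally_integrable f \<longleftrightarrow> (\<forall>a b. set_integrable lebesgue {a..b} f)"

text \<open>Weak derivatives are tested against compactly supported \<open>C\<^sup>1\<close> functions, as is customary in
  dimension one; real-valued test functions suffice by linearity.\<close>

definition weak_deriv :: "(real \<Rightarrow> complex) \<Rightarrow> (real \<Rightarrow> complex) \<Rightarrow> bool" where
  "weak_deriv u v \<longleftrightarrow> locally_integrable u \<and> locally_integrable v \<and>
     (\<forall>\<phi> \<phi>' :: real \<Rightarrow> real.
        (\<forall>s. (\<phi> has_real_derivative \<phi>' s) (at s)) \<and> continuous_on UNIV \<phi>' \<and>
        (\<exists>a b. \<forall>s. s \<notin> {a..b} \<longrightarrow> \<phi> s = 0) \<longrightarrow>
        (LINT s|lebesgue. \<phi>' s *\<^sub>R u s) = - (LINT s|lebesgue. \<phi> s *\<^sub>R v s))"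

definition W2inf_loc :: "(real \<Rightarrow> complex) set" where
  "W2inf_loc = {u. u \<in> Linf_loc \<and>
     (\<exists>u' \<in> Linf_loc. \<exists>u'' \<in> Linf_loc. weak_deriv u u' \<and> weak_deriv u' u'')}"

subsection \<open>Admissible coefficients\<close>

definition const_outside :: "real \<Rightarrow> (real \<Rightarrow> real) \<Rightarrow> real \<Rightarrow> real \<Rightarrow> bool" where
  "const_outside n_inf \<epsilon> a b \<longleftrightarrow> a \<le> b \<and> (AE s in lebesgue. s \<notin> {a..b} \<longrightarrow> \<epsilon> s = n_inf\<^sup>2)"

definition FF :: "real \<Rightarrow> real \<Rightarrow> real \<Rightarrow> (real \<Rightarrow> real) set" where
  "FF n\<^sub>1 n\<^sub>2 n_inf = {\<epsilon>. \<epsilon> \<in> Linf \<and> (AE s in lebesgue. 0 < \<epsilon> s) \<and>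
     (\<exists>a b. const_outside n_inf \<epsilon> a b \<and>
        (AE s in lebesgue. s \<in> {a<..<b} \<longrightarrow> n\<^sub>1\<^sup>2 \<le> \<epsilon> s \<and> \<epsilon> s \<le> n\<^sub>2\<^sup>2))}"

definition FF_sym :: "real \<Rightarrow> real \<Rightarrow> real \<Rightarrow> (real \<Rightarrow> real) set" where
  "FF_sym n\<^sub>1 n\<^sub>2 n_inf = {\<epsilon> \<in> FF n\<^sub>1 n\<^sub>2 n_inf. AE s in lebesgue. \<epsilon> s = \<epsilon> (- s)}"

definition shortest_interval :: "real \<Rightarrow> (real \<Rightarrow> real) \<Rightarrow> real \<times> real \<Rightarrow> bool" where
  "shortest_interval n_inf \<epsilon> = is_arg_min (\<lambda>(a, b). b - a) (\<lambda>(a, b). const_outside n_inf \<epsilon> a b)"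

text \<open>For \<open>\<epsilon> \<in> FF n\<^sub>1 n\<^sub>2 n_inf\<close> that is not a.e. equal to \<open>n_inf\<^sup>2\<close>, the shortest
  interval exists and is unique. In the constant case every singleton is a shortest interval,
  whence the case distinction.\<close>

definition LL :: "real \<Rightarrow> (real \<Rightarrow> real) \<Rightarrow> real" where
  "LL n_inf \<epsilon> = (if AE s in lebesgue. \<epsilon> s = n_inf\<^sup>2 then 0
     else (let (a, b) = (THE I. shortest_interval n_inf \<epsilon> I) in b - a))"

subsection \<open>Modes and resonances\<close>

text \<open>Pointwise values of a mode \<open>y\<close> and of \<open>y'\<close> are those of the continuous representatives,
  so both are required to be continuous.  The boundary condition does not depend on the choice
  of \<open>a\<close>, \<open>b\<close>: if it holds for one pair with \<open>const_outside n_inf \<epsilon> a b\<close> then it holds for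
  all of them.\<close>

definition is_mode :: "real \<Rightarrow> (real \<Rightarrow> real) \<Rightarrow> complex \<Rightarrow> (real \<Rightarrow> complex) \<Rightarrow> bool" where
  "is_mode n_inf \<epsilon> \<kappa> y \<longleftrightarrow> y \<in> W2inf_loc \<and> continuous_on UNIV y \<and> (\<exists>s. y s \<noteq> 0) \<and>
     (\<exists>y' y''. weak_deriv y y' \<and> continuous_on UNIV y' \<and> weak_deriv y' y'' \<and>
        (AE s in lebesgue. y'' s = - \<kappa>\<^sup>2 * complex_of_real (\<epsilon> s) * y s) \<and>
        (\<exists>a b. const_outside n_inf \<epsilon> a b \<and>
           y' a / \<kappa> = - \<i> * complex_of_real n_inf * y a \<and>
           y' b / \<kappa> = \<i> * complex_of_real n_inf * y b))"

definition resonances :: "real \<Rightarrow> (real \<Rightarrow> real) \<Rightarrow> complex set" where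
  "resonances n_inf \<epsilon> = {\<kappa>. \<kappa> \<noteq> 0 \<and> (\<exists>y. is_mode n_inf \<epsilon> \<kappa> y)}"

definition odd_resonances :: "real \<Rightarrow> (real \<Rightarrow> real) \<Rightarrow> complex set" where
  "odd_resonances n_inf \<epsilon> =
     {\<kappa> \<in> resonances n_inf \<epsilon>. \<exists>y. is_mode n_inf \<epsilon> \<kappa> y \<and> (\<forall>s. y (- s) = - y s)}"

definition even_resonances :: "real \<Rightarrow> (real \<Rightarrow> real) \<Rightarrow> complex set" where
  "even_resonances n_inf \<epsilon> =
     {\<kappa> \<in> resonances n_inf \<epsilon>. \<exists>y. is_mode n_inf \<epsilon> \<kappa> y \<and> (\<forall>s. y (- s) = y s)}"

end

theory Submission
  imports Defs "HOL-Complex_Analysis.Great_Picard"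
begin

text \<open>
  A minimizer exists because admissible structures exist and because resonance is preserved under
  limits of minimizing sequences.

  Existence of admissible structures.  Look for a solution of prescribed parity in three layers: index
  \<open>n_inf\<close> in the centre, a second index \<open>n'\<close> in two outer layers, \<open>n_inf\<close> outside.  The outgoing
  condition becomes \<open>exp (\<mu> s) = G t\<close>, where \<open>s\<close> is the half-width of the centre, \<open>t\<close> the width of
  the outer layers, and \<open>\<mu> = - 2 \<i> \<kappa> n_inf\<close>.  Because \<open>Im \<kappa> < 0\<close> and \<open>Re \<kappa> \<noteq> 0\<close>, the left-hand
  side is a spiral into the origin, while \<open>G\<close> leaves the origin in a definite direction; the two
  curves meet (\<open>spiral_meets_curve\<close>, \<open>symmetric_resonator_exists\<close>).  Since \<open>n_inf\<close> lies between
  \<open>n\<^sub>1\<close> and \<open>n\<^sub>2\<close>, the central layer is allowed.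

  Compactness.  Translate the structures of a minimizing sequence so that their shortest intervals are
  centred at 0, and normalize the modes to 1 at a fixed point \<open>- R\<close>.  The mode and its derivative are
  then uniformly bounded by a Gronwall argument and converge uniformly along a subsequence.  The
  coefficients only converge weakly, but weak limits can be avoided: for a known limit \<open>(y, y')\<close> the
  equation \<open>y'' = - \<kappa>\<^sup>2 \<epsilon> y\<close> is a linear condition on \<open>\<epsilon>\<close>, the coefficients satisfying it
  approximately form convex sets, and elements of nearly minimal \<open>L\<^sup>2\<close> norm in a decreasing sequence of
  convex sets converge strongly (\<open>nested_midpoint_convex_AE_Cauchy\<close>).  Bounds on \<open>\<epsilon>\<close>, its value outside
  a symmetric interval and its symmetry are convex conditions too, and parity of the modes passes to
  the uniform limit, so the limit is admissible in each of the four problems and its length is the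
  infimum (\<open>outgoing_limit\<close>, \<open>minimizer_exists\<close>).  Here \<open>n\<^sub>1 \<le> n_inf \<le> n\<^sub>2\<close> is used once more: the bounds
  \<open>n\<^sub>1\<^sup>2 \<le> \<epsilon> \<le> n\<^sub>2\<^sup>2\<close> then hold on the whole line, so that intervals may be enlarged freely.

  The definition of a mode by weak derivatives is first translated into integral equations
  (\<open>weak_deriv_imp_primitive\<close>, \<open>primitive_imp_weak_deriv\<close>), in which pieces of solutions can be glued,
  reflected and passed to the limit.
\<close>

section \<open>Functions with a locally integrable derivative\<close>

text \<open>A substitute for "\<open>u\<close> is absolutely continuous with derivative \<open>v\<close>" that never mentions
  differentiability almost everywhere: it is additive over adjacent intervals and passes to limits,
  and it is the form in which differential equations are used below.\<close>

definition primitive_on :: "real set \<Rightarrow> (real \<Rightarrow> complex) \<Rightarrow> (real \<Rightarrow> complex) \<Rightarrow> bool" where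
  "primitive_on I u v \<longleftrightarrow> (\<forall>a\<in>I. \<forall>b\<in>I. a \<le> b \<longrightarrow> (v has_integral (u b - u a)) {a..b})"

lemma primitive_onD: "primitive_on I u v \<Longrightarrow> a \<in> I \<Longrightarrow> b \<in> I \<Longrightarrow> a \<le> b \<Longrightarrow> (v has_integral (u b - u a)) {a..b}"
  by (simp add: primitive_on_def)

lemma primitive_on_subset: "primitive_on I u v \<Longrightarrow> J \<subseteq> I \<Longrightarrow> primitive_on J u v"
  by (auto simp: primitive_on_def)

lemma primitive_on_Icc_continuous:
  assumes "primitive_on {a..b} u v"
  shows "continuous_on {a..b} u"
proof (cases "a \<le> b")
  case True
  have v: "v integrable_on {a..b}" using primitive_onD[OF assms, of a b] True by auto
  have "continuous_on {a..b} (\<lambda>x. u a + integral {a..x} v)"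
    by (intro continuous_intros indefinite_integral_continuous_1 v)
  moreover have "u a + integral {a..x} v = u x" if "x \<in> {a..b}" for x
    using primitive_onD[OF assms, of a x] that by (auto simp: integral_unique)
  ultimately show ?thesis by (rule continuous_on_eq)
qed simp

lemma primitive_on_UNIV_continuous:
  assumes "primitive_on UNIV u v"
  shows "continuous_on UNIV u"
proof (rule continuous_at_imp_continuous_on, intro ballI)
  fix x :: real
  have "continuous_on {x-1..x+1} u"
    by (rule primitive_on_Icc_continuous, rule primitive_on_subset[OF assms]) simp
  then show "isCont u x"
    by (rule continuous_on_interior) simp
qed

text \<open>Solutions on adjacent intervals are put together with this rule; no smoothness at the
  junction is needed beyond a common value of \<open>u\<close>.\<close>

lemma primitive_on_glue:
  assumes "primitive_on (I \<inter> {..c}) u v" "primitive_on (I \<inter> {c..}) u v" "c \<in> I"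
  shows "primitive_on I u v"
  unfolding primitive_on_def
proof (intro ballI impI)
  fix a b assume ab: "a \<in> I" "b \<in> I" "a \<le> b"
  consider "b \<le> c" | "c \<le> a" | "a < c" "c < b" by linarith
  then show "(v has_integral (u b - u a)) {a..b}"
  proof cases
    case 3
    have "(v has_integral (u c - u a)) {a..c}" "(v has_integral (u b - u c)) {c..b}"
      by (rule primitive_onD[OF assms(1)] primitive_onD[OF assms(2)]; use 3 ab assms(3) in simp)+
    from has_integral_combine[OF _ _ this] 3 show ?thesis by simp
  next
    case 1
    show ?thesis by (rule primitive_onD[OF assms(1)]) (use 1 ab in auto)
  next
    case 2
    show ?thesis by (rule primitive_onD[OF assms(2)]) (use 2 ab in auto)
  qed
qed

lemma primitive_on_reflect:
  assumes "primitive_on I u v"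
  shows "primitive_on (uminus ` I) (\<lambda>x. u (- x)) (\<lambda>x. - v (- x))"
  unfolding primitive_on_def
proof (intro ballI impI)
  fix a b assume ab: "a \<in> uminus ` I" "b \<in> uminus ` I" "a \<le> b"
  then have *: "(v has_integral (u (- a) - u (- b))) {-b..-a}"
    by (intro primitive_onD[OF assms]) auto
  have "((\<lambda>x. v (- x)) has_integral (u (- a) - u (- b))) {- (- a)..- (- b)}"
    by (rule has_integral_reflect_real[THEN iffD2]) (rule *)
  then have "((\<lambda>x. v (- x)) has_integral (u (- a) - u (- b))) {a..b}"
    unfolding minus_minus .
  from has_integral_neg[OF this] show "((\<lambda>x. - v (- x)) has_integral (u (- b) - u (- a))) {a..b}"
    by simp
qed

lemma primitive_on_UNIV_translate:
  assumes "primitive_on UNIV u v"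
  shows "primitive_on UNIV (\<lambda>x. u (x + c)) (\<lambda>x. v (x + c))"
  unfolding primitive_on_def
proof (intro ballI impI)
  fix a b :: real assume ab: "a \<le> b"
  have "(v has_integral (u (b + c) - u (a + c))) (cbox (a + c) (b + c))"
    using primitive_onD[OF assms, of "a+c" "b+c"] ab by simp
  from has_integral_affinity'[OF this, of 1 c]
  show "((\<lambda>x. v (x + c)) has_integral (u (b + c) - u (a + c))) {a..b}"
    by simp
qed

lemma primitive_on_cong_AE:
  assumes I: "is_interval I" and uv: "primitive_on I u v"
    and u: "\<And>x. x \<in> I \<Longrightarrow> u x = u' x" and v: "AE s in lebesgue. s \<in> I \<longrightarrow> v s = v' s"
  shows "primitive_on I u' v'"
  unfolding primitive_on_def
proof (intro ballI impI)
  fix a b assume ab: "a \<in> I" "b \<in> I" "a \<le> b"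
  then have *: "(v has_integral (u' b - u' a)) {a..b}"
    using primitive_onD[OF uv ab] u[OF ab(1)] u[OF ab(2)] by simp
  have sub: "{a..b} \<subseteq> I" using interval_subset_is_interval[OF I, of a b] ab by simp
  have "AE s in lborel. s \<in> {a..b} \<longrightarrow> v s = v' s"
    using v[unfolded AE_completion_iff] by eventually_elim (use sub in blast)
  from has_integral_AE[OF this] * show "(v' has_integral (u' b - u' a)) {a..b}" by (simp only:)
qed

lemma primitive_on_scale:
  assumes "primitive_on I u v"
  shows "primitive_on I (\<lambda>x. c * u x) (\<lambda>x. c * v x)"
  unfolding primitive_on_def right_diff_distrib[symmetric]
  by (intro ballI impI has_integral_mult_right primitive_onD[OF assms])

lemma primitive_on_add:
  assumes "primitive_on I u v" "primitive_on I u' v'"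
  shows "primitive_on I (\<lambda>x. u x + u' x) (\<lambda>x. v x + v' x)"
  unfolding primitive_on_def add_diff_add
  by (intro ballI impI has_integral_add primitive_onD[OF assms(1)] primitive_onD[OF assms(2)])

lemma primitive_on_derivative:
  assumes "\<And>x. x \<in> I \<Longrightarrow> (u has_vector_derivative v x) (at x within I)" "is_interval I"
  shows "primitive_on I u v"
  unfolding primitive_on_def
proof (intro ballI impI)
  fix a b assume ab: "a \<in> I" "b \<in> I" "a \<le> b"
  then have sub: "{a..b} \<subseteq> I" using interval_subset_is_interval[OF assms(2), of a b] by simp
  show "(v has_integral (u b - u a)) {a..b}"
  proof (rule fundamental_theorem_of_calculus[OF ab(3)])
    fix x assume "x \<in> {a..b}"
    then show "(u has_vector_derivative v x) (at x within {a..b})"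
      by (intro has_vector_derivative_within_subset[OF assms(1) sub]) (use sub in auto)
  qed
qed

lemma bounded_measurable_absolutely_integrable_Icc:
  fixes v :: "real \<Rightarrow> 'a::euclidean_space"
  assumes "v \<in> borel_measurable lebesgue" "\<And>x. x \<in> {a..b} \<Longrightarrow> norm (v x) \<le> V"
  shows "v absolutely_integrable_on {a..b}"
proof (rule measurable_bounded_by_integrable_imp_absolutely_integrable[where g="\<lambda>_. V"])
  show "v \<in> borel_measurable (lebesgue_on {a..b})" using assms(1) by (rule measurable_restrict_space1)
  show "(\<lambda>_. V) integrable_on {a..b}" by (rule integrable_const_ivl)
  show "{a..b} \<in> sets lebesgue" by simp
  show "norm (v x) \<le> V" if "x \<in> {a..b}" for x using that by (rule assms(2))
qed

section \<open>Weak derivatives\<close>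

text \<open>Such a function has derivative zero everywhere.  This replaces an integration by parts for
  absolutely continuous functions.\<close>

lemma eq_if_quadratic_increments:
  fixes F :: "real \<Rightarrow> complex"
  assumes "a \<le> b"
    and F: "\<And>x y. a \<le> x \<Longrightarrow> x \<le> y \<Longrightarrow> y \<le> b \<Longrightarrow> norm (F y - F x) \<le> K * (y - x)\<^sup>2"
  shows "F b = F a"
proof -
  define C where "C = \<bar>K\<bar> + 1"
  have C: "C > 0" "K \<le> C" by (auto simp: C_def)
  have sq: "norm (F y - F x) \<le> C * (norm (y - x))\<^sup>2" if "x \<in> {a..b}" "y \<in> {a..b}" for x y
  proof (cases "x \<le> y")
    case True
    then have "norm (F y - F x) \<le> K * (y - x)\<^sup>2" using F[of x y] that by auto
    also have "\<dots> \<le> C * (y - x)\<^sup>2" by (intro mult_right_mono C) simp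
    finally show ?thesis by simp
  next
    case False
    then have "norm (F x - F y) \<le> K * (x - y)\<^sup>2" using F[of y x] that by auto
    also have "\<dots> \<le> C * (x - y)\<^sup>2" by (intro mult_right_mono C) simp
    finally show ?thesis by (simp add: norm_minus_commute power2_commute)
  qed
  have "(F has_derivative (\<lambda>_. 0)) (at x within {a..b})" if x: "x \<in> {a..b}" for x
    unfolding has_derivative_within_alt
  proof (intro conjI allI impI)
    fix e :: real assume e: "e > 0"
    show "\<exists>d>0. \<forall>y\<in>{a..b}. norm (y - x) < d \<longrightarrow> norm (F y - F x - 0) \<le> e * norm (y - x)"
    proof (intro exI[of _ "e / C"] conjI ballI impI)
      fix y assume y: "y \<in> {a..b}" "norm (y - x) < e / C"
      have "norm (F y - F x - 0) \<le> (C * norm (y - x)) * norm (y - x)"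
        using sq[OF x y(1)] by (simp add: power2_eq_square mult.assoc)
      also have "\<dots> \<le> e * norm (y - x)"
        using y(2) C by (intro mult_right_mono) (simp_all add: field_simps)
      finally show "norm (F y - F x - 0) \<le> e * norm (y - x)" .
    qed (use e C in simp)
  qed (rule bounded_linear_zero)
  then obtain c where "\<And>x. x \<in> {a..b} \<Longrightarrow> F x = c"
    using has_derivative_zero_constant[of "{a..b}" F] by (auto simp: convex_real_interval)
  then show ?thesis using assms(1) by simp
qed

lemma continuous_imp_lebesgue_measurable:
  fixes f :: "real \<Rightarrow> 'a::euclidean_space"
  assumes "continuous_on UNIV f"
  shows "f \<in> borel_measurable lebesgue"
  by (rule measurable_completion) (simp add: borel_measurable_continuous_onI[OF assms])

lemma continuous_bounded_Icc:
  fixes f :: "real \<Rightarrow> 'a::real_normed_vector"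
  assumes "continuous_on UNIV f"
  shows "\<exists>B\<ge>0. \<forall>x\<in>{a..b}. norm (f x) \<le> B"
proof -
  have "bounded (f ` {a..b})"
    by (intro compact_imp_bounded compact_continuous_image continuous_on_subset[OF assms]) auto
  then obtain B where "B > 0" "\<forall>x\<in>f ` {a..b}. norm x \<le> B" unfolding bounded_pos by blast
  then show ?thesis by (intro exI[of _ B]) simp
qed

text \<open>The product rule for a \<open>C\<^sup>1\<close> factor \<open>\<phi>\<close> and a primitive \<open>u\<close> of a bounded function.  On \<open>{x..y}\<close>
  the increment of \<open>\<phi> u\<close> is exactly the integral of \<open>\<phi>'(t) u(y) + \<phi>(x) v(t)\<close>; replacing \<open>u(y)\<close> by
  \<open>u(t)\<close> and \<open>\<phi>(x)\<close> by \<open>\<phi>(t)\<close> costs \<open>O((y - x)\<^sup>2)\<close>, since both factors are Lipschitz.\<close>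

lemma primitive_on_scaleR:
  fixes \<phi> \<phi>' :: "real \<Rightarrow> real"
  assumes \<phi>: "\<And>s. (\<phi> has_real_derivative \<phi>' s) (at s)" "continuous_on UNIV \<phi>'"
    and u: "primitive_on UNIV u v"
    and v: "v \<in> borel_measurable lebesgue" "\<And>x. x \<in> {a..b} \<Longrightarrow> norm (v x) \<le> V"
    and ab: "a \<le> b"
  shows "((\<lambda>x. \<phi>' x *\<^sub>R u x + \<phi> x *\<^sub>R v x) has_integral (\<phi> b *\<^sub>R u b - \<phi> a *\<^sub>R u a)) {a..b}"
proof -
  define w where "w = (\<lambda>x. \<phi>' x *\<^sub>R u x + \<phi> x *\<^sub>R v x)"
  have c\<phi>: "continuous_on UNIV \<phi>"
    using \<phi>(1) by (auto intro!: continuous_at_imp_continuous_on DERIV_isCont)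
  have cu: "continuous_on UNIV u" by (rule primitive_on_UNIV_continuous[OF u])
  obtain C1 where C1: "C1 \<ge> 0" "\<forall>x\<in>{a..b}. norm (\<phi>' x) \<le> C1"
    using continuous_bounded_Icc[OF \<phi>(2)] by blast
  obtain C0 where C0: "C0 \<ge> 0" "\<forall>x\<in>{a..b}. norm (\<phi> x) \<le> C0"
    using continuous_bounded_Icc[OF c\<phi>] by blast
  obtain U where U: "U \<ge> 0" "\<forall>x\<in>{a..b}. norm (u x) \<le> U"
    using continuous_bounded_Icc[OF cu] by blast
  have V: "V \<ge> 0" using v(2)[of a] ab norm_ge_zero[of "v a"] by (simp del: norm_ge_zero)
  have wm: "w \<in> borel_measurable lebesgue" unfolding w_def
    by (intro borel_measurable_add borel_measurable_scaleR continuous_imp_lebesgue_measurable \<phi>(2) c\<phi> cu v(1))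
  have wb: "norm (w x) \<le> C1 * U + C0 * V" if "x \<in> {a..b}" for x
  proof -
    have "norm (w x) \<le> norm (\<phi>' x *\<^sub>R u x) + norm (\<phi> x *\<^sub>R v x)" unfolding w_def by (rule norm_triangle_ineq)
    also have "\<dots> \<le> C1 * U + C0 * V" unfolding norm_scaleR
      using that C1 C0 U V v(2)[OF that] by (intro add_mono mult_mono) auto
    finally show ?thesis .
  qed
  have wi: "w integrable_on {a..b}"
    using bounded_measurable_absolutely_integrable_Icc[OF wm wb] by (rule set_lebesgue_integral_eq_integral(1))
  have ulip: "norm (u y - u x) \<le> V * (y - x)" if "a \<le> x" "x \<le> y" "y \<le> b" for x y
  proof -
    have "norm (u y - u x) \<le> V * measure lborel (cbox x y)"
    proof (rule has_integral_bound[OF V])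
      show "(v has_integral u y - u x) (cbox x y)" using primitive_onD[OF u, of x y] that by simp
      show "norm (v t) \<le> V" if "t \<in> cbox x y" for t using that \<open>a \<le> x\<close> \<open>y \<le> b\<close> by (intro v(2)) auto
    qed
    then show ?thesis using that by simp
  qed
  have \<phi>int: "(\<phi>' has_integral (\<phi> y - \<phi> x)) {x..y}" if "x \<le> y" for x y
  proof (rule fundamental_theorem_of_calculus[OF that])
    show "(\<phi> has_vector_derivative \<phi>' t) (at t within {x..y})" for t
      using \<phi>(1)[of t] unfolding has_real_derivative_iff_has_vector_derivative
      by (rule has_vector_derivative_at_within)
  qed
  have \<phi>lip: "norm (\<phi> y - \<phi> x) \<le> C1 * (y - x)" if "a \<le> x" "x \<le> y" "y \<le> b" for x y
  proof -
    have "norm (\<phi> y - \<phi> x) \<le> C1 * measure lborel (cbox x y)"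
    proof (rule has_integral_bound[OF C1(1)])
      show "(\<phi>' has_integral \<phi> y - \<phi> x) (cbox x y)" using \<phi>int[of x y] that by simp
      show "norm (\<phi>' t) \<le> C1" if "t \<in> cbox x y" for t
        using that \<open>a \<le> x\<close> \<open>y \<le> b\<close> C1(2) by auto
    qed
    then show ?thesis using that by simp
  qed
  \<comment> \<open>The product rule says that \<open>F\<close> is constant.\<close>
  define F where "F = (\<lambda>x. \<phi> x *\<^sub>R u x - integral {a..x} w)"
  have "F b = F a"
  proof (rule eq_if_quadratic_increments[OF ab])
    fix x y assume xy: "a \<le> x" "x \<le> y" "y \<le> b"
    have sub: "{a..y} \<subseteq> {a..b}" "{x..y} \<subseteq> {a..b}" using xy by auto
    have "integral {a..x} w + integral {x..y} w = integral {a..y} w"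
      using xy by (intro Henstock_Kurzweil_Integration.integral_combine integrable_on_subinterval[OF wi sub(1)])
    then have 1: "F y - F x = (\<phi> y *\<^sub>R u y - \<phi> x *\<^sub>R u x) - integral {x..y} w"
      by (simp add: F_def algebra_simps)
    \<comment> \<open>The exact increment of the product, to be compared with the integral of \<open>w\<close>.\<close>
    have "((\<lambda>t. \<phi>' t *\<^sub>R u y + \<phi> x *\<^sub>R v t) has_integral (\<phi> y - \<phi> x) *\<^sub>R u y + \<phi> x *\<^sub>R (u y - u x)) {x..y}"
      by (intro has_integral_add has_integral_scaleR_left has_integral_cmul \<phi>int primitive_onD[OF u]) (use xy in auto)
    moreover have "(w has_integral integral {x..y} w) {x..y}"
      by (intro integrable_integral integrable_on_subinterval[OF wi sub(2)])
    ultimately have "((\<lambda>t. (\<phi>' t *\<^sub>R u y + \<phi> x *\<^sub>R v t) - w t) has_integral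
        ((\<phi> y - \<phi> x) *\<^sub>R u y + \<phi> x *\<^sub>R (u y - u x)) - integral {x..y} w) {x..y}"
      by (rule has_integral_diff)
    also have "((\<phi> y - \<phi> x) *\<^sub>R u y + \<phi> x *\<^sub>R (u y - u x)) - integral {x..y} w = F y - F x"
      unfolding 1 by (simp add: algebra_simps)
    finally have I: "((\<lambda>t. (\<phi>' t *\<^sub>R u y + \<phi> x *\<^sub>R v t) - w t) has_integral F y - F x) (cbox x y)" by simp
    have "norm (F y - F x) \<le> (C1 * (V * (y - x)) + C1 * (y - x) * V) * measure lborel (cbox x y)"
    proof (rule has_integral_bound[OF _ I])
      show "0 \<le> C1 * (V * (y - x)) + C1 * (y - x) * V" using C1 V xy by simp
      fix t assume t: "t \<in> cbox x y"
      have "norm ((\<phi>' t *\<^sub>R u y + \<phi> x *\<^sub>R v t) - w t) = norm (\<phi>' t *\<^sub>R (u y - u t) - (\<phi> t - \<phi> x) *\<^sub>R v t)"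
        by (simp add: w_def algebra_simps)
      also have "\<dots> \<le> \<bar>\<phi>' t\<bar> * norm (u y - u t) + \<bar>\<phi> t - \<phi> x\<bar> * norm (v t)"
        by (rule norm_triangle_ineq4[THEN order_trans]) simp
      also have "\<dots> \<le> C1 * (V * (y - x)) + C1 * (y - x) * V"
      proof (intro add_mono mult_mono)
        show "\<bar>\<phi>' t\<bar> \<le> C1" using C1(2) t xy by auto
        have "V * (y - t) \<le> V * (y - x)" using t V by (intro mult_left_mono) auto
        then show "norm (u y - u t) \<le> V * (y - x)" using ulip[of t y] t xy by auto
        have "C1 * (t - x) \<le> C1 * (y - x)" using t C1 by (intro mult_left_mono) auto
        then show "\<bar>\<phi> t - \<phi> x\<bar> \<le> C1 * (y - x)" using \<phi>lip[of x t] t xy by auto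
        show "norm (v t) \<le> V" using t xy by (intro v(2)) auto
      qed (use C1 V xy in auto)
      finally show "norm ((\<phi>' t *\<^sub>R u y + \<phi> x *\<^sub>R v t) - w t) \<le> C1 * (V * (y - x)) + C1 * (y - x) * V" .
    qed
    also have "\<dots> = 2 * C1 * V * (y - x)\<^sup>2" using xy by (simp add: power2_eq_square algebra_simps)
    finally show "norm (F y - F x) \<le> 2 * C1 * V * (y - x)\<^sup>2" .
  qed
  then have "integral {a..b} w = \<phi> b *\<^sub>R u b - \<phi> a *\<^sub>R u a" by (simp add: F_def algebra_simps)
  with integrable_integral[OF wi] show ?thesis unfolding w_def by metis
qed

text \<open>Integrating the product rule over an interval that contains the support of the test function
  in its interior leaves no boundary terms.\<close>

lemma primitive_imp_weak_deriv:
  assumes u: "primitive_on UNIV u v"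
    and v: "v \<in> borel_measurable lebesgue" "\<And>a b. \<exists>V. \<forall>x\<in>{a..b}. norm (v x) \<le> V"
  shows "weak_deriv u v"
  unfolding weak_deriv_def locally_integrable_def
proof (intro conjI allI impI)
  have cu: "continuous_on UNIV u" by (rule primitive_on_UNIV_continuous[OF u])
  fix a b :: real
  show "u absolutely_integrable_on {a..b}"
    by (intro absolutely_integrable_continuous_real continuous_on_subset[OF cu]) simp
  obtain V where "\<forall>x\<in>{a..b}. norm (v x) \<le> V" using v(2) by blast
  then show "v absolutely_integrable_on {a..b}"
    by (intro bounded_measurable_absolutely_integrable_Icc[OF v(1), of a b V]) blast
next
  fix \<phi> \<phi>' :: "real \<Rightarrow> real"
  assume "(\<forall>s. (\<phi> has_real_derivative \<phi>' s) (at s)) \<and> continuous_on UNIV \<phi>' \<and>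
    (\<exists>a b. \<forall>s. s \<notin> {a..b} \<longrightarrow> \<phi> s = 0)"
  then obtain a0 b0 where \<phi>: "\<And>s. (\<phi> has_real_derivative \<phi>' s) (at s)" "continuous_on UNIV \<phi>'"
    and out: "\<And>s. s \<notin> {a0..b0} \<Longrightarrow> \<phi> s = 0" by blast
  have cu: "continuous_on UNIV u" by (rule primitive_on_UNIV_continuous[OF u])
  have c\<phi>: "continuous_on UNIV \<phi>"
    using \<phi>(1) by (auto intro!: continuous_at_imp_continuous_on DERIV_isCont)
  \<comment> \<open>The margin of 1 makes \<open>\<phi>\<close> vanish at both end points of \<open>{a..b}\<close>.\<close>
  define a where "a = min a0 b0 - 1"
  define b where "b = max a0 b0 + 1"
  have ab: "a \<le> b" by (simp add: a_def b_def)
  have out': "\<phi>' s = 0" if "s \<notin> {a0..b0}" for s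
  proof -
    have "(\<phi> has_real_derivative 0) (at s)"
    proof (rule has_field_derivative_transform_within_open[of "\<lambda>_. 0" 0 s "- {a0..b0}"])
      show "open (- {a0..b0})" by (intro open_Compl closed_real_atLeastAtMost)
      show "\<And>x. x \<in> - {a0..b0} \<Longrightarrow> 0 = \<phi> x" using out by simp
    qed (use that in simp_all)
    then show ?thesis using \<phi>(1) DERIV_unique by blast
  qed
  have supp: "s \<notin> {a0..b0}" if "s \<notin> {a..b}" for s using that by (auto simp: a_def b_def)
  obtain V where V: "\<forall>x\<in>{a..b}. norm (v x) \<le> V" using v(2) by blast
  have i1: "(\<lambda>s. \<phi>' s *\<^sub>R u s) absolutely_integrable_on {a..b}"
    by (rule absolutely_integrable_continuous_real, rule continuous_on_subset[of UNIV])
       (auto intro: continuous_on_scaleR \<phi>(2) cu)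
  obtain C where C: "C \<ge> 0" "\<forall>x\<in>{a..b}. norm (\<phi> x) \<le> C" using continuous_bounded_Icc[OF c\<phi>] by blast
  have i2: "(\<lambda>s. \<phi> s *\<^sub>R v s) absolutely_integrable_on {a..b}"
  proof (rule bounded_measurable_absolutely_integrable_Icc)
    show "(\<lambda>s. \<phi> s *\<^sub>R v s) \<in> borel_measurable lebesgue"
      by (intro borel_measurable_scaleR continuous_imp_lebesgue_measurable c\<phi> v(1))
    show "norm (\<phi> x *\<^sub>R v x) \<le> C * V" if "x \<in> {a..b}" for x
      unfolding norm_scaleR using that C V by (intro mult_mono) auto
  qed
  have "((\<lambda>x. \<phi>' x *\<^sub>R u x + \<phi> x *\<^sub>R v x) has_integral (\<phi> b *\<^sub>R u b - \<phi> a *\<^sub>R u a)) {a..b}"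
    by (rule primitive_on_scaleR[OF \<phi> u v(1) V[rule_format] ab])
  moreover have "\<phi> a = 0" "\<phi> b = 0" by (auto intro!: out simp: a_def b_def)
  ultimately have "integral {a..b} (\<lambda>x. \<phi>' x *\<^sub>R u x + \<phi> x *\<^sub>R v x) = 0"
    by (simp add: integral_unique)
  then have 0: "integral {a..b} (\<lambda>x. \<phi>' x *\<^sub>R u x) + integral {a..b} (\<lambda>x. \<phi> x *\<^sub>R v x) = 0"
    using Henstock_Kurzweil_Integration.integral_add[OF set_lebesgue_integral_eq_integral(1)[OF i1] set_lebesgue_integral_eq_integral(1)[OF i2]]
    by simp
  have L: "(LINT s|lebesgue. f s) = integral {a..b} f"
    if "f absolutely_integrable_on {a..b}" "\<And>s. s \<notin> {a..b} \<Longrightarrow> f s = 0" for f :: "real \<Rightarrow> complex"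
  proof -
    have "(LINT s|lebesgue. f s) = (LINT s:{a..b}|lebesgue. f s)"
      unfolding set_lebesgue_integral_def
      by (intro Bochner_Integration.integral_cong refl) (use that(2) in \<open>auto simp: indicator_def\<close>)
    also have "\<dots> = integral {a..b} f" by (rule set_lebesgue_integral_eq_integral(2)[OF that(1)])
    finally show ?thesis .
  qed
  have "(LINT s|lebesgue. \<phi>' s *\<^sub>R u s) = integral {a..b} (\<lambda>x. \<phi>' x *\<^sub>R u x)"
    by (rule L[OF i1]) (simp add: out'[OF supp])
  moreover have "(LINT s|lebesgue. \<phi> s *\<^sub>R v s) = integral {a..b} (\<lambda>x. \<phi> x *\<^sub>R v x)"
    by (rule L[OF i2]) (simp add: out[OF supp])
  ultimately show "(LINT s|lebesgue. \<phi>' s *\<^sub>R u s) = - (LINT s|lebesgue. \<phi> s *\<^sub>R v s)"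
    using 0 by (simp add: eq_neg_iff_add_eq_0)
qed

definition ramp_sq :: "real \<Rightarrow> real" where "ramp_sq x = (max 0 x)\<^sup>2"

lemma ramp_sq_deriv: "(ramp_sq has_real_derivative 2 * max 0 x) (at x)"
proof -
  consider "x > 0" | "x < 0" | "x = 0" by linarith
  then show ?thesis
  proof cases
    case 1
    have "((\<lambda>x. x\<^sup>2) has_real_derivative 2 * max 0 x) (at x)"
      using 1 by (auto intro!: derivative_eq_intros)
    then show ?thesis
      by (rule has_field_derivative_transform_within_open[of _ _ _ "{0<..}"]) (use 1 in \<open>auto simp: ramp_sq_def\<close>)
  next
    case 2
    have "((\<lambda>x. 0) has_real_derivative 2 * max 0 x) (at x)" using 2 by simp
    then show ?thesis
      by (rule has_field_derivative_transform_within_open[of _ _ _ "{..<0}"]) (use 2 in \<open>auto simp: ramp_sq_def\<close>)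
  next
    case 3
    have "((\<lambda>h::real. max 0 h) \<longlongrightarrow> 0) (at 0)"
      using tendsto_max[OF tendsto_const tendsto_ident_at, of 0 "0::real" UNIV] by simp
    then have "((\<lambda>h. (ramp_sq (0 + h) - ramp_sq 0) / h) \<longlongrightarrow> 0) (at 0)"
      by (rule Lim_transform_eventually)
         (auto simp: eventually_at_filter ramp_sq_def max_def power2_eq_square)
    then show ?thesis using 3 by (simp add: DERIV_def)
  qed
qed

text \<open>A quadratic spline that rises from 0 to 1 on \<open>[0, h]\<close>; its derivative is the tent function of
  mass 1.  Differences of two translates are \<open>C\<^sup>1\<close> test functions which approximate the indicator of
  an interval.\<close>

definition smooth_step :: "real \<Rightarrow> real \<Rightarrow> real" where
  "smooth_step h x = 2 / h\<^sup>2 * (ramp_sq x - 2 * ramp_sq (x - h / 2) + ramp_sq (x - h))"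

definition tent :: "real \<Rightarrow> real \<Rightarrow> real" where
  "tent h x = 2 / h\<^sup>2 * (2 * max 0 x - 2 * (2 * max 0 (x - h / 2)) + 2 * max 0 (x - h))"

lemma smooth_step_deriv: "(smooth_step h has_real_derivative tent h x) (at x)"
proof -
  have "((\<lambda>x. ramp_sq (x - c)) has_real_derivative 2 * max 0 (x - c)) (at x)" for c
    using DERIV_shift[of ramp_sq "2 * max 0 (x - c)" x "- c"] ramp_sq_deriv[of "x - c"] by simp
  from this[of "h/2"] this[of h] show ?thesis
    unfolding smooth_step_def tent_def
    by (intro DERIV_cmult DERIV_add DERIV_diff ramp_sq_deriv)
qed

lemma tent_continuous: "continuous_on UNIV (tent h)"
  unfolding tent_def by (intro continuous_intros)

lemma
  assumes h: "h > 0"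
  shows smooth_step_left: "x \<le> 0 \<Longrightarrow> smooth_step h x = 0"
    and smooth_step_right: "x \<ge> h \<Longrightarrow> smooth_step h x = 1"
    and tent_nonneg: "0 \<le> tent h x"
    and tent_outside: "x \<notin> {0..h} \<Longrightarrow> tent h x = 0"
proof -
  show "smooth_step h x = 0" if "x \<le> 0" using that h by (simp add: smooth_step_def ramp_sq_def)
  show "smooth_step h x = 1" if "x \<ge> h"
  proof -
    have "ramp_sq x - 2 * ramp_sq (x - h / 2) + ramp_sq (x - h) = h\<^sup>2 / 2"
      using that h by (simp add: ramp_sq_def power2_eq_square field_simps)
    then show ?thesis using h by (simp add: smooth_step_def)
  qed
  have "2 * max 0 x - 2 * (2 * max 0 (x - h / 2)) + 2 * max 0 (x - h) \<ge> 0"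
    using h by (simp add: max_def field_simps)
  then show "0 \<le> tent h x" unfolding tent_def by (intro mult_nonneg_nonneg) auto
  show "tent h x = 0" if "x \<notin> {0..h}" 
    using that h by (auto simp: tent_def max_def field_simps)
qed

lemma smooth_step_bounds:
  assumes h: "h > 0"
  shows "0 \<le> smooth_step h x" "smooth_step h x \<le> 1"
proof -
  have mono: "smooth_step h x \<le> smooth_step h y" if "x \<le> y" for x y
    using smooth_step_deriv tent_nonneg[OF h]
    by (intro DERIV_nonneg_imp_nondecreasing[OF that]) blast
  show "0 \<le> smooth_step h x"
    using mono[of "min x 0" x] smooth_step_left[OF h, of "min x 0"] by simp
  show "smooth_step h x \<le> 1"
    using mono[of x "max x h"] smooth_step_right[OF h, of "max x h"] by simp
qed

text \<open>Since the tent has mass 1, the weighted average of \<open>u\<close> deviates from \<open>u c\<close> by no more than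
  \<open>u\<close> itself does on the support of the tent.\<close>

lemma tent_average:
  fixes u :: "real \<Rightarrow> complex"
  assumes h: "h > 0" and u: "continuous_on UNIV u"
    and near: "\<And>s. s \<in> {c..c+h} \<Longrightarrow> norm (u s - u c) \<le> e"
  shows "integrable lebesgue (\<lambda>s. tent h (s - c) *\<^sub>R u s)"
    and "norm ((LINT s|lebesgue. tent h (s - c) *\<^sub>R u s) - u c) \<le> e"
proof -
  have ct: "continuous_on UNIV (\<lambda>s. tent h (s - c))"
    by (rule continuous_on_compose2[OF tent_continuous]) (auto intro: continuous_intros)
  have abs: "(\<lambda>s. tent h (s - c) *\<^sub>R u s) absolutely_integrable_on {c..c+h}"
    by (rule absolutely_integrable_continuous_real, rule continuous_on_subset[of UNIV])
       (auto intro: continuous_on_scaleR ct u)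
  have out: "tent h (s - c) = 0" if "s \<notin> {c..c+h}" for s
    using that by (intro tent_outside[OF h]) auto
  have eq: "indicat_real {c..c+h} s *\<^sub>R (tent h (s - c) *\<^sub>R u s) = tent h (s - c) *\<^sub>R u s" for s
    using out[of s] by (auto simp: indicator_def)
  show "integrable lebesgue (\<lambda>s. tent h (s - c) *\<^sub>R u s)"
    using abs unfolding set_integrable_def eq .
  have "(LINT s|lebesgue. tent h (s - c) *\<^sub>R u s) = (LINT s:{c..c+h}|lebesgue. tent h (s - c) *\<^sub>R u s)"
    unfolding set_lebesgue_integral_def eq ..
  also have "\<dots> = integral {c..c+h} (\<lambda>s. tent h (s - c) *\<^sub>R u s)"
    by (rule set_lebesgue_integral_eq_integral(2)[OF abs])
  finally have 1: "(LINT s|lebesgue. tent h (s - c) *\<^sub>R u s) = integral {c..c+h} (\<lambda>s. tent h (s - c) *\<^sub>R u s)" .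
  have mass: "((\<lambda>s. tent h (s - c)) has_integral 1) {c..c+h}"
  proof -
    have "((\<lambda>s. tent h (s - c)) has_integral smooth_step h (c + h - c) - smooth_step h (c - c)) {c..c+h}"
    proof (rule fundamental_theorem_of_calculus)
      fix x
      have "((\<lambda>s. smooth_step h (s - c)) has_real_derivative tent h (x - c)) (at x)"
        using DERIV_shift[of "smooth_step h" "tent h (x - c)" x "- c"] smooth_step_deriv[of h "x - c"] by simp
      then show "((\<lambda>s. smooth_step h (s - c)) has_vector_derivative tent h (x - c)) (at x within {c..c+h})"
        unfolding has_real_derivative_iff_has_vector_derivative by (rule has_vector_derivative_at_within)
    qed (use h in simp)
    then show ?thesis using smooth_step_left[OF h, of 0] smooth_step_right[OF h, of h] by simp
  qed
  have "((\<lambda>s. tent h (s - c) *\<^sub>R u s) has_integral integral {c..c+h} (\<lambda>s. tent h (s - c) *\<^sub>R u s)) {c..c+h}"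
    by (rule integrable_integral, rule set_lebesgue_integral_eq_integral(1)[OF abs])
  from has_integral_diff[OF this has_integral_scaleR_left[OF mass, of "u c"]]
  have 2: "((\<lambda>s. tent h (s - c) *\<^sub>R (u s - u c)) has_integral
      integral {c..c+h} (\<lambda>s. tent h (s - c) *\<^sub>R u s) - u c) {c..c+h}"
    by (simp add: scaleR_diff_right)
  have 3: "((\<lambda>s. tent h (s - c) * e) has_integral e) {c..c+h}"
    using has_integral_mult_left[OF mass, of e] by simp
  have "norm (integral {c..c+h} (\<lambda>s. tent h (s - c) *\<^sub>R (u s - u c))) \<le> integral {c..c+h} (\<lambda>s. tent h (s - c) * e)"
  proof (rule integral_norm_bound_integral)
    show "(\<lambda>s. tent h (s - c) *\<^sub>R (u s - u c)) integrable_on {c..c+h}" using 2 by blast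
    show "(\<lambda>s. tent h (s - c) * e) integrable_on {c..c+h}" using 3 by blast
    show "norm (tent h (s - c) *\<^sub>R (u s - u c)) \<le> tent h (s - c) * e" if "s \<in> {c..c+h}" for s
      using tent_nonneg[OF h, of "s - c"] near[OF that] by (simp add: mult_left_mono)
  qed
  then show "norm ((LINT s|lebesgue. tent h (s - c) *\<^sub>R u s) - u c) \<le> e"
    unfolding 1 integral_unique[OF 2] integral_unique[OF 3] .
qed

lemma tent_average_tendsto:
  fixes u :: "real \<Rightarrow> complex"
  assumes u: "continuous_on UNIV u"
  shows "(\<lambda>k. LINT s|lebesgue. tent (1 / real (Suc k)) (s - c) *\<^sub>R u s) \<longlonglongrightarrow> u c"
proof (rule LIMSEQ_I)
  fix e :: real assume e: "e > 0"
  have "isCont u c" using u by (simp add: continuous_on_eq_continuous_at)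
  then obtain d where d: "d > 0" "\<And>s. norm (s - c) < d \<Longrightarrow> norm (u s - u c) < e / 2"
    unfolding continuous_at_eps_delta dist_norm using e by (metis half_gt_zero)
  obtain N where N: "1 / real (Suc N) < d" using nat_approx_posE[OF d(1)] .
  show "\<exists>N. \<forall>k\<ge>N. norm ((LINT s|lebesgue. tent (1 / real (Suc k)) (s - c) *\<^sub>R u s) - u c) < e"
  proof (intro exI[of _ N] allI impI)
    fix k assume "N \<le> k"
    then have "1 / real (Suc k) \<le> 1 / real (Suc N)" by (intro divide_left_mono) auto
    with N have k: "1 / real (Suc k) < d" by linarith
    have "norm ((LINT s|lebesgue. tent (1 / real (Suc k)) (s - c) *\<^sub>R u s) - u c) \<le> e / 2"
    proof (rule tent_average(2)[OF _ u])
      fix s assume "s \<in> {c..c + 1 / real (Suc k)}"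
      then have "norm (s - c) < d" using k by auto
      from d(2)[OF this] show "norm (u s - u c) \<le> e / 2" by simp
    qed simp
    then show "norm ((LINT s|lebesgue. tent (1 / real (Suc k)) (s - c) *\<^sub>R u s) - u c) < e"
      using e by linarith
  qed
qed

text \<open>Test with the difference of two smooth steps at \<open>a\<close> and \<open>b\<close> whose width tends to zero.  Its
  derivative is a difference of two tents, so one side of the definition tends to \<open>u a - u b\<close>; on the
  other side dominated convergence gives the integral of \<open>v\<close> over \<open>{a..b}\<close>.\<close>

lemma weak_deriv_imp_primitive:
  assumes w: "weak_deriv u v" and u: "continuous_on UNIV u"
  shows "primitive_on UNIV u v"
  unfolding primitive_on_def
proof (intro ballI impI)
  fix a b :: real assume ab: "a \<le> b"
  define h where "h k = 1 / real (Suc k)" for k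
  have h: "h k > 0" "h k \<le> 1" for k by (auto simp: h_def)
  define \<phi> where "\<phi> k s = smooth_step (h k) (s - a) - smooth_step (h k) (s - b)" for k s
  define \<phi>' where "\<phi>' k s = tent (h k) (s - a) - tent (h k) (s - b)" for k s
  have vi: "v absolutely_integrable_on {c..d}" for c d
    using w by (auto simp: weak_deriv_def locally_integrable_def)
  have out: "\<phi> k s = 0" if "s \<notin> {a..b+1}" for k s
  proof (cases "s < a")
    case True
    then show ?thesis using ab smooth_step_left[OF h(1)[of k]] by (simp add: \<phi>_def)
  next
    case False
    with that have "s - a \<ge> h k" "s - b \<ge> h k" using h[of k] ab by auto
    then show ?thesis using smooth_step_right[OF h(1)[of k]] by (simp add: \<phi>_def)
  qed
  have bound: "\<bar>\<phi> k s\<bar> \<le> 1" for k s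
    using smooth_step_bounds[OF h(1)[of k], of "s - a"] smooth_step_bounds[OF h(1)[of k], of "s - b"]
    by (simp add: \<phi>_def abs_le_iff)
  have deriv: "(\<phi> k has_real_derivative \<phi>' k s) (at s)" for k s
  proof -
    have "((\<lambda>s. smooth_step (h k) (s - c)) has_real_derivative tent (h k) (s - c)) (at s)" for c
      using DERIV_shift[of "smooth_step (h k)" "tent (h k) (s - c)" s "- c"] smooth_step_deriv[of "h k" "s - c"] by simp
    then show ?thesis unfolding \<phi>_def \<phi>'_def by (intro DERIV_diff)
  qed
  have ct: "continuous_on UNIV (\<lambda>s. tent (h k) (s - c))" for k c
    by (rule continuous_on_compose2[OF tent_continuous]) (auto intro: continuous_intros)
  have c': "continuous_on UNIV (\<phi>' k)" for k
    unfolding \<phi>'_def by (intro continuous_on_diff ct)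
  have test: "(LINT s|lebesgue. \<phi>' k s *\<^sub>R u s) = - (LINT s|lebesgue. \<phi> k s *\<^sub>R v s)" for k
    using w deriv[of k] c'[of k] out[of _ k] unfolding weak_deriv_def by blast
  have L: "(\<lambda>k. LINT s|lebesgue. \<phi>' k s *\<^sub>R u s) \<longlonglongrightarrow> u a - u b"
  proof -
    have int: "integrable lebesgue (\<lambda>s. tent (h k) (s - c) *\<^sub>R u s)" for k c
    proof -
      have "continuous_on UNIV (\<lambda>s. u s - u c)" by (intro continuous_on_diff u continuous_on_const)
      from continuous_bounded_Icc[OF this, of c "c + h k"]
      obtain B where "\<forall>s\<in>{c..c + h k}. norm (u s - u c) \<le> B" by blast
      then show ?thesis by (intro tent_average(1)[OF h(1) u, of c k B]) blast
    qed
    have "(LINT s|lebesgue. \<phi>' k s *\<^sub>R u s)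
        = (LINT s|lebesgue. tent (h k) (s - a) *\<^sub>R u s) - (LINT s|lebesgue. tent (h k) (s - b) *\<^sub>R u s)" for k
      unfolding \<phi>'_def scaleR_diff_left by (rule Bochner_Integration.integral_diff[OF int int])
    then show ?thesis
      using tendsto_diff[OF tent_average_tendsto[OF u, of a] tent_average_tendsto[OF u, of b]]
      unfolding h_def by simp
  qed
  have R: "(\<lambda>k. LINT s|lebesgue. \<phi> k s *\<^sub>R v s) \<longlonglongrightarrow> (LINT s|lebesgue. indicat_real {a..b} s *\<^sub>R v s)"
  proof (rule integral_dominated_convergence[where w="\<lambda>s. norm (indicat_real {a..b+1} s *\<^sub>R v s)"])
    show "(\<lambda>s. indicat_real {a..b} s *\<^sub>R v s) \<in> borel_measurable lebesgue"
      using vi[of a b] unfolding set_integrable_def by (rule borel_measurable_integrable)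
    have vm: "(\<lambda>s. indicat_real {a..b+1} s *\<^sub>R v s) \<in> borel_measurable lebesgue"
      using vi[of a "b+1"] unfolding set_integrable_def by (rule borel_measurable_integrable)
    show "(\<lambda>s. \<phi> k s *\<^sub>R v s) \<in> borel_measurable lebesgue" for k
    proof -
      have "continuous_on UNIV (\<phi> k)"
        using deriv by (auto intro!: continuous_at_imp_continuous_on DERIV_isCont)
      then have "(\<lambda>s. \<phi> k s *\<^sub>R (indicat_real {a..b+1} s *\<^sub>R v s)) \<in> borel_measurable lebesgue"
        by (intro borel_measurable_scaleR vm continuous_imp_lebesgue_measurable)
      moreover have "\<phi> k s *\<^sub>R (indicat_real {a..b+1} s *\<^sub>R v s) = \<phi> k s *\<^sub>R v s" for s
        using out[of s k] by (cases "s \<in> {a..b+1}") auto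
      ultimately show ?thesis by (simp only:)
    qed
    show "integrable lebesgue (\<lambda>s. norm (indicat_real {a..b+1} s *\<^sub>R v s))"
      using vi[of a "b+1"] unfolding set_integrable_def by (rule integrable_norm)
    show "AE s in lebesgue. norm (\<phi> k s *\<^sub>R v s) \<le> norm (indicat_real {a..b+1} s *\<^sub>R v s)" for k
    proof (rule AE_I2)
      fix s
      show "norm (\<phi> k s *\<^sub>R v s) \<le> norm (indicat_real {a..b+1} s *\<^sub>R v s)"
        using out[of s k] mult_right_mono[OF bound[of k s] norm_ge_zero[of "v s"]]
        by (cases "s \<in> {a..b+1}") auto
    qed
    have lim: "(\<lambda>k. \<phi> k s *\<^sub>R v s) \<longlonglongrightarrow> indicat_real {a..b} s *\<^sub>R v s" if "s \<noteq> a" for s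
    proof -
      have st: "eventually (\<lambda>k. smooth_step (h k) (s - c) = (if s \<le> c then 0 else 1)) sequentially" for c
      proof (cases "s \<le> c")
        case True
        then show ?thesis using smooth_step_left[OF h(1)] by simp
      next
        case False
        then obtain N where "1 / real (Suc N) < s - c" using nat_approx_posE[of "s - c"] by auto
        moreover have "h k \<le> 1 / real (Suc N)" if "k \<ge> N" for k
          unfolding h_def using that by (intro divide_left_mono) auto
        ultimately have "h k \<le> s - c" if "k \<ge> N" for k using that by fastforce
        then have "\<forall>k\<ge>N. smooth_step (h k) (s - c) = (if s \<le> c then 0 else 1)"
          using smooth_step_right[OF h(1)] False by simp
        then show ?thesis unfolding eventually_sequentially by blast
      qed
      have "eventually (\<lambda>k. \<phi> k s *\<^sub>R v s = indicat_real {a..b} s *\<^sub>R v s) sequentially"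
        using st[of a] st[of b]
      proof eventually_elim
        case (elim k)
        then show ?case using that ab by (auto simp: \<phi>_def indicator_def)
      qed
      then show ?thesis by (rule tendsto_eventually)
    qed
    have "AE s in lborel. s \<noteq> a" by (rule AE_lborel_singleton)
    then have "AE s in lebesgue. s \<noteq> a" by (rule AE_completion)
    then show "AE s in lebesgue. (\<lambda>k. \<phi> k s *\<^sub>R v s) \<longlonglongrightarrow> indicat_real {a..b} s *\<^sub>R v s"
      by eventually_elim (rule lim)
  qed
  have "(\<lambda>k. LINT s|lebesgue. \<phi>' k s *\<^sub>R u s) \<longlonglongrightarrow> - (LINT s|lebesgue. indicat_real {a..b} s *\<^sub>R v s)"
    unfolding test by (rule tendsto_minus[OF R])
  from LIMSEQ_unique[OF L this] have "u b - u a = (LINT s:{a..b}|lebesgue. v s)"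
    unfolding set_lebesgue_integral_def by (metis minus_diff_eq minus_minus)
  also have "\<dots> = integral {a..b} v" by (rule set_lebesgue_integral_eq_integral(2)[OF vi])
  finally show "(v has_integral u b - u a) {a..b}"
    using integrable_integral[OF set_lebesgue_integral_eq_integral(1)[OF vi[of a b]]] by simp
qed

section \<open>A priori bounds and convexity\<close>

text \<open>Let \<open>N\<close> be the maximum of \<open>f\<close> against the weight \<open>exp (- 2 D (x - a))\<close>.  With this weight the
  integral term contributes at most \<open>N / 2\<close> at the maximum point, whence \<open>N \<le> 2 A\<close>.\<close>

lemma gronwall:
  fixes f :: "real \<Rightarrow> real"
  assumes f: "continuous_on {a..b} f" "\<And>x. x \<in> {a..b} \<Longrightarrow> 0 \<le> f x"
    and A: "0 \<le> A" and D: "0 < D"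
    and le: "\<And>x. x \<in> {a..b} \<Longrightarrow> f x \<le> A + D * integral {a..x} f"
    and x: "x \<in> {a..b}"
  shows "f x \<le> 2 * A * exp (2 * D * (x - a))"
proof -
  define g where "g t = f t * exp (- (2 * D * (t - a)))" for t
  have "continuous_on {a..b} g" unfolding g_def by (intro continuous_intros f(1))
  then obtain x0 where x0: "x0 \<in> {a..b}" "\<And>t. t \<in> {a..b} \<Longrightarrow> g t \<le> g x0"
    using continuous_attains_sup[of "{a..b}" g] x by auto
  define N where "N = g x0"
  define E where "E = exp (2 * D * (x0 - a))"
  have E: "E \<ge> 1" using x0 D by (simp add: E_def)
  have f_eq: "f t = g t * exp (2 * D * (t - a))" for t
    by (simp add: g_def mult.assoc exp_add[symmetric])
  have f_le: "f t \<le> N * exp (2 * D * (t - a))" if "t \<in> {a..b}" for t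
    unfolding f_eq N_def using x0(2)[OF that] by (intro mult_right_mono) auto
  have "((\<lambda>t. N * exp (2 * D * (t - a))) has_integral
      N * exp (2 * D * (x0 - a)) / (2 * D) - N * exp (2 * D * (a - a)) / (2 * D)) {a..x0}"
    by (rule fundamental_theorem_of_calculus)
       (use x0 D in \<open>auto intro!: derivative_eq_intros simp: has_real_derivative_iff_has_vector_derivative[symmetric]\<close>)
  then have I: "((\<lambda>t. N * exp (2 * D * (t - a))) has_integral N * (E - 1) / (2 * D)) {a..x0}"
    by (simp add: E_def right_diff_distrib diff_divide_distrib)
  have "integral {a..x0} f \<le> integral {a..x0} (\<lambda>t. N * exp (2 * D * (t - a)))"
  proof (rule integral_le)
    show "f integrable_on {a..x0}"
      using x0 by (intro integrable_continuous_real continuous_on_subset[OF f(1)]) auto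
    show "(\<lambda>t. N * exp (2 * D * (t - a))) integrable_on {a..x0}" using I by blast
  qed (use f_le x0 in auto)
  also have "\<dots> = N * (E - 1) / (2 * D)" using I by (rule integral_unique)
  finally have "D * integral {a..x0} f \<le> D * (N * (E - 1) / (2 * D))"
    using D by (intro mult_left_mono) auto
  then have "D * integral {a..x0} f \<le> N * (E - 1) / 2" using D by simp
  moreover have "f x0 = N * E" unfolding f_eq[of x0] N_def E_def ..
  ultimately have 1: "N * E \<le> A + N * (E - 1) / 2" using le[OF x0(1)] by linarith
  have N: "N \<ge> 0" unfolding N_def g_def using f(2)[OF x0(1)] by simp
  have "N * (E - 1) / 2 = N * E / 2 - N / 2" by (simp add: right_diff_distrib diff_divide_distrib)
  with 1 N have "N * E \<le> 2 * A" by linarith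
  moreover have "N * 1 \<le> N * E" using N E by (intro mult_left_mono) auto
  ultimately have "N \<le> 2 * A" by linarith
  then have "N * exp (2 * D * (x - a)) \<le> 2 * A * exp (2 * D * (x - a))"
    by (intro mult_right_mono) auto
  with f_le[OF x] show ?thesis by linarith
qed

text \<open>A selection principle which takes the place of weak-star compactness: conditions on
  coefficients that are convex and become more restrictive with \<open>n\<close> can be met asymptotically by an
  almost everywhere convergent sequence.  Choose \<open>g n\<close> of nearly minimal \<open>L\<^sup>2\<close> norm in \<open>K n\<close>.  The
  minimal norms increase to a finite limit, and midpoints stay in the sets, so the parallelogram law
  makes \<open>g\<close> a Cauchy sequence in \<open>L\<^sup>2\<close>, hence in \<open>L\<^sup>1\<close>; a subsequence converges almost everywhere
  and still satisfies the nested conditions.\<close>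

lemma nested_midpoint_convex_AE_Cauchy:
  fixes K :: "nat \<Rightarrow> ('a \<Rightarrow> real) set"
  assumes "finite_measure M"
    and ne: "\<And>n. K n \<noteq> {}" and dec: "\<And>n. K (Suc n) \<subseteq> K n"
    and meas: "\<And>n f. f \<in> K n \<Longrightarrow> f \<in> borel_measurable M"
    and bnd: "\<And>n f x. f \<in> K n \<Longrightarrow> \<bar>f x\<bar> \<le> B"
    and mid: "\<And>n f g. f \<in> K n \<Longrightarrow> g \<in> K n \<Longrightarrow> (\<lambda>x. (f x + g x) / 2) \<in> K n"
  shows "\<exists>g. (\<forall>n. g n \<in> K n) \<and> (AE x in M. Cauchy (\<lambda>n. g n x))"
proof -
  interpret finite_measure M by fact
  have mono: "K j \<subseteq> K i" if "i \<le> j" for i j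
    using lift_Suc_antimono_le[of K, OF dec that] .
  have bnd2: "(f x)\<^sup>2 \<le> B\<^sup>2" if "f \<in> K n" for f n x
    using power_mono[OF bnd[OF that, of x] abs_ge_zero, of 2] by simp
  have int2: "integrable M (\<lambda>x. (f x)\<^sup>2)" if "f \<in> K n" for f n
  proof (rule integrable_const_bound[of _ "B\<^sup>2"])
    show "AE x in M. norm ((f x)\<^sup>2) \<le> B\<^sup>2" using bnd2[OF that] by (intro AE_I2) simp
    show "(\<lambda>x. (f x)\<^sup>2) \<in> borel_measurable M" using meas[OF that] by measurable
  qed
  have int1: "integrable M f" if "f \<in> K n" for f n
  proof (rule integrable_const_bound[of _ B])
    show "AE x in M. norm (f x) \<le> B" using bnd[OF that] by (intro AE_I2) simp
    show "f \<in> borel_measurable M" using meas[OF that] .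
  qed
  define sq where "sq f = (LINT x|M. (f x)\<^sup>2)" for f :: "'a \<Rightarrow> real"
  define m where "m = measure M (space M)"
  have m: "m \<ge> 0" by (simp add: m_def)
  have sq_le: "sq f \<le> B\<^sup>2 * m" if "f \<in> K n" for f n
  proof -
    have "sq f \<le> (LINT x|M. B\<^sup>2)" unfolding sq_def
      by (rule integral_mono[OF int2[OF that]]) (use bnd2[OF that] in auto)
    then show ?thesis by (simp add: m_def mult.commute)
  qed
  have sq_ge: "0 \<le> sq f" for f unfolding sq_def by simp
  define d where "d n = Inf (sq ` K n)" for n
  have bdd: "bdd_below (sq ` K n)" for n using sq_ge by (auto intro!: bdd_belowI[of _ 0])
  have d_le: "d n \<le> sq f" if "f \<in> K n" for f n
    unfolding d_def using that by (intro cInf_lower bdd) auto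
  have "incseq d"
    unfolding incseq_Suc_iff d_def using ne dec bdd by (auto intro!: cInf_superset_mono image_mono)
  moreover have "d n \<le> B\<^sup>2 * m" for n
  proof -
    obtain f where "f \<in> K n" using ne by blast
    then show ?thesis using d_le[of f n] sq_le[of f n] by linarith
  qed
  ultimately obtain l where l: "d \<longlonglongrightarrow> l" "\<And>n. d n \<le> l"
    using incseq_convergent[of d "B\<^sup>2 * m"] by blast
  have "\<exists>f\<in>K n. sq f < d n + 1 / real (Suc n)" for n
    using cInf_lessD[of "sq ` K n" "d n + 1 / real (Suc n)"] ne[of n] unfolding d_def[symmetric] by auto
  then obtain g where g: "\<And>n. g n \<in> K n" "\<And>n. sq (g n) < d n + 1 / real (Suc n)" by metis
  \<comment> \<open>The parallelogram law, with the midpoint bounded below by the minimal norm in \<open>K N\<close>.\<close>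
  have par: "(LINT x|M. (g i x - g j x)\<^sup>2) \<le> 4 * (l - d N + 1 / real (Suc N))" if "N \<le> i" "N \<le> j" for i j N
  proof -
    define h where "h x = (g i x + g j x) / 2" for x
    have gK: "g i \<in> K N" "g j \<in> K N" using g(1) mono that by auto
    then have hK: "h \<in> K N" unfolding h_def by (rule mid)
    have "(g i x - g j x)\<^sup>2 = 2 * (g i x)\<^sup>2 + 2 * (g j x)\<^sup>2 - 4 * (h x)\<^sup>2" for x
      by (simp add: h_def power2_eq_square field_simps)
    then have "(LINT x|M. (g i x - g j x)\<^sup>2) = 2 * sq (g i) + 2 * sq (g j) - 4 * sq h"
      unfolding sq_def using int2[OF gK(1)] int2[OF gK(2)] int2[OF hK] by simp
    also have "\<dots> \<le> 4 * (l - d N + 1 / real (Suc N))"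
    proof -
      have "1 / real (Suc i) \<le> 1 / real (Suc N)" "1 / real (Suc j) \<le> 1 / real (Suc N)"
        using that by (auto intro!: divide_left_mono)
      then show ?thesis using g(2)[of i] g(2)[of j] l(2)[of i] l(2)[of j] d_le[OF hK] by argo
    qed
    finally show ?thesis .
  qed
  have lim: "(\<lambda>N. 4 * (l - d N + 1 / real (Suc N))) \<longlonglongrightarrow> 0"
  proof -
    have "(\<lambda>N. 4 * (l - d N + 1 / real (Suc N))) \<longlonglongrightarrow> 4 * (l - l + 0)"
      by (intro tendsto_intros l(1) LIMSEQ_Suc lim_1_over_n)
    then show ?thesis by simp
  qed
  have cauchy: "\<exists>N. \<forall>i\<ge>N. \<forall>j\<ge>N. LINT x|M. norm (g i x - g j x) < e" if e: "e > 0" for e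
  proof -
    define \<eta> where "\<eta> = e / (2 * (m + 1))"
    have \<eta>: "\<eta> > 0" "\<eta> * m < e / 2" using e m by (auto simp: \<eta>_def field_simps)
    have "eventually (\<lambda>N. 4 * (l - d N + 1 / real (Suc N)) < \<eta> * e / 2) sequentially"
      using \<eta>(1) e by (intro order_tendstoD(2)[OF lim]) simp
    then obtain N where "4 * (l - d N + 1 / real (Suc N)) < \<eta> * e / 2"
      unfolding eventually_sequentially by blast
    then have N: "(LINT x|M. (g i x - g j x)\<^sup>2) < \<eta> * e / 2" if "N \<le> i" "N \<le> j" for i j
      using par[OF that] by linarith
    have "(LINT x|M. norm (g i x - g j x)) < e" if ij: "N \<le> i" "N \<le> j" for i j
    proof -
      \<comment> \<open>On a finite measure space \<open>L\<^sup>2\<close> bounds give \<open>L\<^sup>1\<close> bounds; \<open>\<eta>\<close> spends half of \<open>e\<close> on each summand.\<close>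
      have pt: "norm t \<le> \<eta> + t\<^sup>2 / \<eta>" for t :: real
      proof (cases "\<bar>t\<bar> \<le> \<eta>")
        case True
        then show ?thesis using \<eta> by (simp add: add_increasing2)
      next
        case False
        then have "\<bar>t\<bar> * \<eta> \<le> \<bar>t\<bar> * \<bar>t\<bar>" by (intro mult_left_mono) auto
        then have "\<bar>t\<bar> \<le> t\<^sup>2 / \<eta>" using \<eta> by (simp add: field_simps power2_eq_square)
        then show ?thesis using \<eta> by simp
      qed
      have i2: "integrable M (\<lambda>x. (g i x - g j x)\<^sup>2)"
      proof (rule integrable_const_bound[of _ "(2 * B)\<^sup>2"])
        have "\<bar>g i x - g j x\<bar> \<le> 2 * B" for x using bnd[OF g(1), of i x] bnd[OF g(1), of j x] by linarith
        then have "(g i x - g j x)\<^sup>2 \<le> (2 * B)\<^sup>2" for x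
          using power_mono[OF _ abs_ge_zero, of "g i x - g j x" "2 * B" 2] by simp
        then show "AE x in M. norm ((g i x - g j x)\<^sup>2) \<le> (2 * B)\<^sup>2" by (intro AE_I2) simp
        show "(\<lambda>x. (g i x - g j x)\<^sup>2) \<in> borel_measurable M"
          using meas[OF g(1)[of i]] meas[OF g(1)[of j]] by measurable
      qed
      have "(LINT x|M. norm (g i x - g j x)) \<le> (LINT x|M. \<eta> + (g i x - g j x)\<^sup>2 / \<eta>)"
        using int1[OF g(1)] i2 by (intro integral_mono pt) auto
      also have "\<dots> = \<eta> * m + (LINT x|M. (g i x - g j x)\<^sup>2) / \<eta>"
        using i2 by (simp add: m_def mult.commute)
      also have "\<dots> < e / 2 + (\<eta> * e / 2) / \<eta>"
        using \<eta> N[OF ij] by (intro add_strict_mono divide_strict_right_mono) auto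
      also have "\<dots> = e" using \<eta> by simp
      finally show ?thesis .
    qed
    then show ?thesis by blast
  qed
  obtain r where r: "strict_mono r" "AE x in M. Cauchy (\<lambda>i. g (r i) x)"
    using cauchy_L1_AE_cauchy_subseq[OF int1[OF g(1)] cauchy] by blast
  show ?thesis
  proof (intro exI[of _ "\<lambda>n. g (r n)"] conjI allI)
    show "g (r n) \<in> K n" for n using g(1)[of "r n"] mono[OF seq_suble[OF r(1), of n]] by blast
  qed (rule r(2))
qed

section \<open>Modes as solutions of a first-order system\<close>

lemma AE_lebesgue_neq: "AE s in lebesgue. s \<noteq> (a::real)"
  by (rule AE_completion[OF AE_lborel_singleton])

text \<open>The equation \<open>y'' = - \<kappa>\<^sup>2 \<epsilon> y\<close> as a system for \<open>y\<close> and \<open>z = y'\<close>.  Keeping \<open>z\<close> explicit makes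
  the boundary conditions pointwise statements about continuous functions.\<close>

definition helmholtz_on ::
  "real set \<Rightarrow> complex \<Rightarrow> (real \<Rightarrow> real) \<Rightarrow> (real \<Rightarrow> complex) \<Rightarrow> (real \<Rightarrow> complex) \<Rightarrow> bool" where
  "helmholtz_on I \<kappa> \<epsilon> y z \<longleftrightarrow>
     primitive_on I y z \<and> primitive_on I z (\<lambda>s. - \<kappa>\<^sup>2 * complex_of_real (\<epsilon> s) * y s)"

lemma helmholtz_on_subset: "helmholtz_on I \<kappa> \<epsilon> y z \<Longrightarrow> J \<subseteq> I \<Longrightarrow> helmholtz_on J \<kappa> \<epsilon> y z"
  by (auto simp: helmholtz_on_def intro: primitive_on_subset)

lemma helmholtz_on_cong_AE:
  assumes I: "is_interval I" and h: "helmholtz_on I \<kappa> \<epsilon> y z"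
    and \<epsilon>: "AE s in lebesgue. s \<in> I \<longrightarrow> \<epsilon> s = \<epsilon>' s"
    and yz: "\<And>s. s \<in> I \<Longrightarrow> y s = y' s" "\<And>s. s \<in> I \<Longrightarrow> z s = z' s"
  shows "helmholtz_on I \<kappa> \<epsilon>' y' z'"
proof -
  have 1: "AE s in lebesgue. s \<in> I \<longrightarrow> z s = z' s"
    by (rule AE_I2) (use yz in blast)
  have 2: "AE s in lebesgue. s \<in> I \<longrightarrow>
      - \<kappa>\<^sup>2 * complex_of_real (\<epsilon> s) * y s = - \<kappa>\<^sup>2 * complex_of_real (\<epsilon>' s) * y' s"
    using \<epsilon> by eventually_elim (simp add: yz)
  from h have p: "primitive_on I y z" "primitive_on I z (\<lambda>s. - \<kappa>\<^sup>2 * complex_of_real (\<epsilon> s) * y s)"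
    unfolding helmholtz_on_def by blast+
  show ?thesis
    using primitive_on_cong_AE[OF I p(1), of y', OF yz(1) 1] primitive_on_cong_AE[OF I p(2), of z', OF yz(2) 2]
    unfolding helmholtz_on_def by blast
qed

lemma helmholtz_on_glue:
  assumes "helmholtz_on (I \<inter> {..c}) \<kappa> \<epsilon> y z" "helmholtz_on (I \<inter> {c..}) \<kappa> \<epsilon> y z" "c \<in> I"
  shows "helmholtz_on I \<kappa> \<epsilon> y z"
  using assms unfolding helmholtz_on_def by (meson primitive_on_glue)

lemma helmholtz_on_scale:
  assumes "helmholtz_on I \<kappa> \<epsilon> y z"
  shows "helmholtz_on I \<kappa> \<epsilon> (\<lambda>s. c * y s) (\<lambda>s. c * z s)"
proof -
  have "(\<lambda>s. c * (- \<kappa>\<^sup>2 * complex_of_real (\<epsilon> s) * y s)) = (\<lambda>s. - \<kappa>\<^sup>2 * complex_of_real (\<epsilon> s) * (c * y s))"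
    by (simp add: fun_eq_iff)
  then show ?thesis
    using assms primitive_on_scale[of I y z c] primitive_on_scale[of I z "\<lambda>s. - \<kappa>\<^sup>2 * complex_of_real (\<epsilon> s) * y s" c]
    unfolding helmholtz_on_def by simp
qed

text \<open>Under \<open>s \<mapsto> - s\<close> the derivative changes its sign, which is why \<open>z\<close> is replaced by \<open>- z (- s)\<close>.\<close>

lemma helmholtz_on_reflect:
  assumes "helmholtz_on I \<kappa> \<epsilon> y z"
  shows "helmholtz_on (uminus ` I) \<kappa> (\<lambda>s. \<epsilon> (- s)) (\<lambda>s. y (- s)) (\<lambda>s. - z (- s))"
  using assms primitive_on_reflect[of I y z]
    primitive_on_scale[OF primitive_on_reflect[of I z "\<lambda>s. - \<kappa>\<^sup>2 * complex_of_real (\<epsilon> s) * y s"], of "-1"]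
  unfolding helmholtz_on_def by simp

lemma helmholtz_on_translate:
  assumes "helmholtz_on UNIV \<kappa> \<epsilon> y z"
  shows "helmholtz_on UNIV \<kappa> (\<lambda>s. \<epsilon> (s + c)) (\<lambda>s. y (s + c)) (\<lambda>s. z (s + c))"
  using assms primitive_on_UNIV_translate[of y z c]
    primitive_on_UNIV_translate[of z "\<lambda>s. - \<kappa>\<^sup>2 * complex_of_real (\<epsilon> s) * y s" c]
  unfolding helmholtz_on_def by simp

lemma helmholtz_on_growth:
  assumes h: "helmholtz_on {a..b} \<kappa> \<epsilon> y z"
    and \<epsilon>: "\<And>s. s \<in> {a..b} \<Longrightarrow> \<bar>\<epsilon> s\<bar> \<le> B" and B: "0 \<le> B"
    and x: "x \<in> {a..b}"
  shows "norm (y x) + norm (z x)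
    \<le> 2 * (norm (y a) + norm (z a)) * exp (2 * (1 + (norm \<kappa>)\<^sup>2 * B) * (x - a))"
proof -
  define C where "C = (norm \<kappa>)\<^sup>2 * B"
  have C: "C \<ge> 0" using B by (simp add: C_def)
  have py: "primitive_on {a..b} y z" and pz: "primitive_on {a..b} z (\<lambda>s. - \<kappa>\<^sup>2 * complex_of_real (\<epsilon> s) * y s)"
    using h by (auto simp: helmholtz_on_def)
  have cy: "continuous_on {a..b} y" and cz: "continuous_on {a..b} z"
    using primitive_on_Icc_continuous[OF py] primitive_on_Icc_continuous[OF pz] by auto
  define f where "f x = norm (y x) + norm (z x)" for x
  have cf: "continuous_on {a..b} f" unfolding f_def by (intro continuous_intros cy cz)
  have "f x \<le> 2 * f a * exp (2 * (1 + C) * (x - a))"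
  proof (rule gronwall[OF cf])
    fix x assume x: "x \<in> {a..b}"
    have sub: "{a..x} \<subseteq> {a..b}" using x by auto
    have iy: "(\<lambda>t. norm (y t)) integrable_on {a..x}" and iz: "(\<lambda>t. norm (z t)) integrable_on {a..x}"
      by (intro integrable_continuous_real continuous_on_norm continuous_on_subset[OF cy sub] continuous_on_subset[OF cz sub])+
    have ifx: "f integrable_on {a..x}"
      by (intro integrable_continuous_real continuous_on_subset[OF cf sub])
    have 1: "(z has_integral y x - y a) {a..x}" using primitive_onD[OF py, of a x] x by auto
    have 2: "((\<lambda>s. - \<kappa>\<^sup>2 * complex_of_real (\<epsilon> s) * y s) has_integral z x - z a) {a..x}"
      using primitive_onD[OF pz, of a x] x by auto
    have "norm (y x - y a) \<le> integral {a..x} (\<lambda>t. norm (z t))"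
      unfolding integral_unique[OF 1, symmetric]
      by (rule integral_norm_bound_integral) (use 1 iz in auto)
    also have "\<dots> \<le> integral {a..x} f"
      by (rule integral_le[OF iz ifx]) (simp add: f_def)
    finally have y1: "norm (y x - y a) \<le> integral {a..x} f" .
    have "norm (z x - z a) \<le> integral {a..x} (\<lambda>t. C * norm (y t))"
      unfolding integral_unique[OF 2, symmetric]
    proof (rule integral_norm_bound_integral)
      show "(\<lambda>s. - \<kappa>\<^sup>2 * complex_of_real (\<epsilon> s) * y s) integrable_on {a..x}" using 2 by blast
      show "(\<lambda>t. C * norm (y t)) integrable_on {a..x}" using integrable_on_mult_right[OF iy] .
      fix t assume "t \<in> {a..x}"
      then have "\<bar>\<epsilon> t\<bar> \<le> B" using sub by (intro \<epsilon>) auto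
      then have "(norm \<kappa>)\<^sup>2 * \<bar>\<epsilon> t\<bar> * norm (y t) \<le> (norm \<kappa>)\<^sup>2 * B * norm (y t)"
        by (intro mult_right_mono mult_left_mono) auto
      then show "norm (- \<kappa>\<^sup>2 * complex_of_real (\<epsilon> t) * y t) \<le> C * norm (y t)"
        by (simp add: norm_mult norm_power C_def)
    qed
    also have "\<dots> = C * integral {a..x} (\<lambda>t. norm (y t))" by simp
    also have "\<dots> \<le> C * integral {a..x} f"
      by (intro mult_left_mono C integral_le[OF iy ifx]) (simp add: f_def)
    finally have z1: "norm (z x - z a) \<le> C * integral {a..x} f" .
    have "norm (y x) \<le> norm (y a) + norm (y x - y a)" "norm (z x) \<le> norm (z a) + norm (z x - z a)"
      by (rule norm_triangle_sub)+
    then show "f x \<le> f a + (1 + C) * integral {a..x} f"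
      using y1 z1 unfolding f_def by (simp add: distrib_right f_def)
  qed (use C x in \<open>auto simp: f_def\<close>)
  then show ?thesis unfolding f_def C_def .
qed

text \<open>To the right of \<open>p\<close> this is the growth bound with zero initial data; the left side follows by
  reflection.\<close>

lemma helmholtz_on_unique:
  assumes h: "helmholtz_on UNIV \<kappa> \<epsilon> y z" and \<epsilon>: "\<And>s. \<bar>\<epsilon> s\<bar> \<le> B"
    and 0: "y p = 0" "z p = 0"
  shows "y x = 0"
proof -
  have B: "0 \<le> B" using \<epsilon>[of 0] by linarith
  consider "p \<le> x" | "x \<le> p" by linarith
  then show ?thesis
  proof cases
    case 1
    from helmholtz_on_growth[OF helmholtz_on_subset[OF h, of "{p..x}"] \<epsilon> B, of x] 0 1
    have "norm (y x) + norm (z x) \<le> 0" by simp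
    then show ?thesis using norm_ge_zero[of "y x"] norm_ge_zero[of "z x"] by (metis add_nonneg_eq_0_iff norm_eq_zero norm_ge_zero order_antisym add_nonneg_nonneg)
  next
    case 2
    have "helmholtz_on {-p..-x} \<kappa> (\<lambda>s. \<epsilon> (- s)) (\<lambda>s. y (- s)) (\<lambda>s. - z (- s))"
      by (rule helmholtz_on_subset[OF helmholtz_on_reflect[OF h]]) (auto simp: surj_def intro: exI[of _ "- _"])
    from helmholtz_on_growth[OF this \<epsilon> B, of "- x"] 0 2
    have "norm (y x) + norm (z x) \<le> 0" by simp
    then show ?thesis using norm_ge_zero[of "y x"] norm_ge_zero[of "z x"] by (metis add_nonneg_eq_0_iff norm_eq_zero norm_ge_zero order_antisym add_nonneg_nonneg)
  qed
qed

lemma primitive_on_imp_vector_derivative: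
  assumes p: "primitive_on {a..b} u v" and v: "continuous_on {a..b} v" and x: "x \<in> {a..b}"
  shows "(u has_vector_derivative v x) (at x within {a..b})"
proof -
  have "((\<lambda>t. u a + integral {a..t} v) has_vector_derivative 0 + v x) (at x within {a..b})"
    by (intro has_vector_derivative_add has_vector_derivative_const integral_has_vector_derivative v x)
  then have "((\<lambda>t. u a + integral {a..t} v) has_vector_derivative v x) (at x within {a..b})" by simp
  then show ?thesis
  proof (rule has_vector_derivative_transform[OF x, rotated])
    fix t assume "t \<in> {a..b}"
    then show "u t = u a + integral {a..t} v"
      using primitive_onD[OF p, of a t] by (auto simp: integral_unique)
  qed
qed

lemma primitive_on_linear_ode:
  assumes p: "primitive_on {a..b} w (\<lambda>x. c * w x)" and ab: "a \<le> b"
  shows "w b = w a * exp (c * of_real (b - a))"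
proof -
  have cw: "continuous_on {a..b} w" by (rule primitive_on_Icc_continuous[OF p])
  define f where "f x = w x * exp (- c * of_real (x - a))" for x
  have "(f has_vector_derivative 0) (at x within {a..b})" if "x \<in> {a..b}" for x
  proof -
    have "(w has_vector_derivative c * w x) (at x within {a..b})"
      by (rule primitive_on_imp_vector_derivative[OF p _ that]) (intro continuous_intros cw)
    moreover have "((\<lambda>x. exp (- c * of_real (x - a))) has_vector_derivative - c * exp (- c * of_real (x - a))) (at x within {a..b})"
    proof -
      have "((\<lambda>z. exp (- c * (z - of_real a))) has_field_derivative - c * exp (- c * (of_real x - of_real a))) (at (of_real x))"
        by (auto intro!: derivative_eq_intros)
      from has_vector_derivative_real_field[OF this] show ?thesis
        unfolding of_real_diff by (rule has_vector_derivative_at_within)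
    qed
    ultimately have "(f has_vector_derivative
        w x * (- c * exp (- c * of_real (x - a))) + c * w x * exp (- c * of_real (x - a))) (at x within {a..b})"
      unfolding f_def by (rule has_vector_derivative_mult)
    then show ?thesis by (simp add: algebra_simps)
  qed
  then obtain k where "\<And>x. x \<in> {a..b} \<Longrightarrow> f x = k"
    using has_vector_derivative_zero_constant[of "{a..b}" f] by (auto simp: convex_real_interval)
  then have "f b = f a" using ab by simp
  then have "w b * exp (- c * of_real (b - a)) = w a" by (simp add: f_def)
  moreover have "exp (- c * of_real (b - a)) = inverse (exp (c * of_real (b - a)))"
    by (simp only: exp_minus mult_minus_left)
  ultimately have "w b = w a * E" if "E = exp (c * of_real (b - a))" for E
    using that by (simp only:) (simp add: divide_simps flip: divide_inverse del: of_real_diff)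
  then show ?thesis by blast
qed

text \<open>Where \<open>\<epsilon> = n\<^sup>2\<close>, the defect \<open>z - c y\<close> solves the linear equation \<open>w' = - c w\<close>, so it vanishes
  at one point of the interval if and only if it vanishes at every other one.  For \<open>c = \<plusminus> \<i> \<kappa> n\<close> this
  makes the outgoing conditions independent of the chosen end points.\<close>

lemma outgoing_condition_shift:
  assumes h: "helmholtz_on UNIV \<kappa> \<epsilon> y z" and pq: "p \<le> q"
    and \<epsilon>: "AE s in lebesgue. s \<in> {p..q} \<longrightarrow> \<epsilon> s = n\<^sup>2"
    and c: "c\<^sup>2 = - (\<kappa> * of_real n)\<^sup>2"
  shows "z p = c * y p \<longleftrightarrow> z q = c * y q"
proof -
  have "helmholtz_on {p..q} \<kappa> (\<lambda>_. n\<^sup>2) y z"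
    by (rule helmholtz_on_cong_AE[OF _ helmholtz_on_subset[OF h] \<epsilon>]) (auto simp: is_interval_cc)
  then have py: "primitive_on {p..q} y z"
    and pz: "primitive_on {p..q} z (\<lambda>s. - \<kappa>\<^sup>2 * complex_of_real (n\<^sup>2) * y s)"
    by (auto simp: helmholtz_on_def)
  have "primitive_on {p..q} (\<lambda>s. z s + - c * y s) (\<lambda>s. - \<kappa>\<^sup>2 * complex_of_real (n\<^sup>2) * y s + - c * z s)"
    by (rule primitive_on_add[OF pz primitive_on_scale[OF py]])
  moreover have "- \<kappa>\<^sup>2 * complex_of_real (n\<^sup>2) * y s + - c * z s = - c * (z s + - c * y s)" for s
  proof -
    have "c * (c * y s) = - \<kappa>\<^sup>2 * complex_of_real (n\<^sup>2) * y s"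
      unfolding mult.assoc[symmetric] power2_eq_square[of c, symmetric] c by (simp add: power_mult_distrib)
    then show ?thesis by (simp add: right_diff_distrib)
  qed
  ultimately have "primitive_on {p..q} (\<lambda>s. z s + - c * y s) (\<lambda>s. - c * (z s + - c * y s))" by simp
  from primitive_on_linear_ode[OF this pq] show ?thesis by (auto simp: algebra_simps)
qed

lemma Linf_locI:
  assumes "f \<in> borel_measurable lebesgue" "\<And>a b. \<exists>C. \<forall>s\<in>{a..b}. norm (f s) \<le> C"
  shows "f \<in> Linf_loc"
  unfolding Linf_loc_def
proof (intro CollectI conjI allI assms(1))
  fix a b
  obtain C where "\<forall>s\<in>{a..b}. norm (f s) \<le> C" using assms(2) by blast
  then have "AE s in lebesgue. s \<in> {a..b} \<longrightarrow> norm (f s) \<le> C" by (intro AE_I2) blast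
  then show "\<exists>C. AE s in lebesgue. s \<in> {a..b} \<longrightarrow> norm (f s) \<le> C" by blast
qed

lemma is_mode_imp_helmholtz:
  assumes m: "is_mode n \<epsilon> \<kappa> y" and \<kappa>: "\<kappa> \<noteq> 0"
  obtains z a b where "helmholtz_on UNIV \<kappa> \<epsilon> y z" "const_outside n \<epsilon> a b"
    "z a = - (\<i> * \<kappa> * of_real n) * y a" "z b = (\<i> * \<kappa> * of_real n) * y b"
proof -
  from m obtain z w a b where 1: "weak_deriv y z" "continuous_on UNIV y" "continuous_on UNIV z" "weak_deriv z w"
    and w: "AE s in lebesgue. w s = - \<kappa>\<^sup>2 * complex_of_real (\<epsilon> s) * y s"
    and ab: "const_outside n \<epsilon> a b" "z a / \<kappa> = - \<i> * complex_of_real n * y a"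
      "z b / \<kappa> = \<i> * complex_of_real n * y b"
    unfolding is_mode_def by blast
  have "AE s in lebesgue. s \<in> UNIV \<longrightarrow> w s = - \<kappa>\<^sup>2 * complex_of_real (\<epsilon> s) * y s"
    using w by eventually_elim simp
  from primitive_on_cong_AE[OF is_interval_univ weak_deriv_imp_primitive[OF 1(4,3)] refl this]
  have "helmholtz_on UNIV \<kappa> \<epsilon> y z"
    unfolding helmholtz_on_def using weak_deriv_imp_primitive[OF 1(1,2)] by blast
  moreover have "z a = - (\<i> * \<kappa> * of_real n) * y a" "z b = (\<i> * \<kappa> * of_real n) * y b"
    using ab(2,3) \<kappa> by (simp_all add: field_simps)
  ultimately show thesis using ab(1) that by blast
qed

lemma helmholtz_imp_is_mode:
  assumes h: "helmholtz_on UNIV \<kappa> \<epsilon> y z" and \<kappa>: "\<kappa> \<noteq> 0"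
    and \<epsilon>: "\<epsilon> \<in> borel_measurable lebesgue" "\<And>s. \<bar>\<epsilon> s\<bar> \<le> B"
    and y: "y s0 \<noteq> 0"
    and ab: "const_outside n \<epsilon> a b"
      "z a = - (\<i> * \<kappa> * of_real n) * y a" "z b = (\<i> * \<kappa> * of_real n) * y b"
  shows "is_mode n \<epsilon> \<kappa> y"
proof -
  define w where "w s = - \<kappa>\<^sup>2 * complex_of_real (\<epsilon> s) * y s" for s
  have py: "primitive_on UNIV y z" and pz: "primitive_on UNIV z w"
    using h unfolding helmholtz_on_def w_def[abs_def] by blast+
  have cy: "continuous_on UNIV y" and cz: "continuous_on UNIV z"
    by (rule primitive_on_UNIV_continuous[OF py], rule primitive_on_UNIV_continuous[OF pz])
  have bnd: "\<exists>C. \<forall>s\<in>{a..b}. norm (f s) \<le> C" if "continuous_on UNIV f" for f :: "real \<Rightarrow> complex" and a b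
    using continuous_bounded_Icc[OF that, of a b] by blast
  have wm: "w \<in> borel_measurable lebesgue"
    unfolding w_def using \<epsilon>(1) continuous_imp_lebesgue_measurable[OF cy] by measurable
  have wb: "\<exists>C. \<forall>s\<in>{a..b}. norm (w s) \<le> C" for a b
  proof -
    obtain C where C: "\<forall>s\<in>{a..b}. norm (y s) \<le> C" using bnd[OF cy] by blast
    have "norm (w s) \<le> (norm \<kappa>)\<^sup>2 * B * C" if "s \<in> {a..b}" for s
    proof -
      have "norm (w s) = (norm \<kappa>)\<^sup>2 * \<bar>\<epsilon> s\<bar> * norm (y s)" by (simp add: w_def norm_mult norm_power)
      also have "\<dots> \<le> (norm \<kappa>)\<^sup>2 * B * C"
        using \<epsilon>(2)[of s] C that by (intro mult_mono mult_nonneg_nonneg) auto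
      finally show ?thesis .
    qed
    then show ?thesis by blast
  qed
  have wd: "weak_deriv y z" "weak_deriv z w"
    using primitive_imp_weak_deriv[OF py continuous_imp_lebesgue_measurable[OF cz] bnd[OF cz]]
      primitive_imp_weak_deriv[OF pz wm wb] by blast+
  have "y \<in> Linf_loc" "z \<in> Linf_loc" "w \<in> Linf_loc"
    using Linf_locI[OF continuous_imp_lebesgue_measurable[OF cy] bnd[OF cy]]
      Linf_locI[OF continuous_imp_lebesgue_measurable[OF cz] bnd[OF cz]] Linf_locI[OF wm wb] by blast+
  then have "y \<in> W2inf_loc" using wd unfolding W2inf_loc_def by blast
  moreover have "AE s in lebesgue. w s = - \<kappa>\<^sup>2 * complex_of_real (\<epsilon> s) * y s"
    by (rule AE_I2) (simp add: w_def)
  moreover have "z a / \<kappa> = - \<i> * complex_of_real n * y a" "z b / \<kappa> = \<i> * complex_of_real n * y b"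
    using ab(2,3) \<kappa> by (simp_all add: field_simps)
  ultimately show ?thesis unfolding is_mode_def using wd cy cz y ab(1) by blast
qed

lemma const_outside_right:
  assumes "const_outside n \<epsilon> a b" "b \<le> p"
  shows "AE s in lebesgue. s \<in> {p..q} \<longrightarrow> \<epsilon> s = n\<^sup>2"
proof -
  have "AE s in lebesgue. s \<notin> {a..b} \<longrightarrow> \<epsilon> s = n\<^sup>2" using assms(1) by (simp add: const_outside_def)
  then show ?thesis using AE_lebesgue_neq[of p] by eventually_elim (use assms(2) in auto)
qed

lemma const_outside_left:
  assumes "const_outside n \<epsilon> a b" "q \<le> a"
  shows "AE s in lebesgue. s \<in> {p..q} \<longrightarrow> \<epsilon> s = n\<^sup>2"
proof -
  have "AE s in lebesgue. s \<notin> {a..b} \<longrightarrow> \<epsilon> s = n\<^sup>2" using assms(1) by (simp add: const_outside_def)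
  then show ?thesis using AE_lebesgue_neq[of q] by eventually_elim (use assms(2) in auto)
qed

text \<open>The boundary conditions are transported to \<open>\<plusminus> R\<close>, and \<open>y\<close> is scaled to 1 at \<open>- R\<close>.  The
  value there cannot vanish, since then the derivative would vanish as well and \<open>y\<close> would be zero.\<close>

lemma helmholtz_normalize:
  assumes h: "helmholtz_on UNIV \<kappa> \<epsilon> y z" and ab: "const_outside n \<epsilon> a b"
    and bc0: "z a = - (\<i> * \<kappa> * of_real n) * y a" "z b = (\<i> * \<kappa> * of_real n) * y b"
    and s: "y s \<noteq> 0"
    and out: "const_outside n \<epsilon> (- r) r" and R: "r \<le> R"
    and \<epsilon>': "AE s in lebesgue. \<epsilon> s = \<epsilon>' s" "\<And>s. \<bar>\<epsilon>' s\<bar> \<le> B"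
  obtains k where "helmholtz_on {-R..R} \<kappa> \<epsilon>' (\<lambda>s. k * y s) (\<lambda>s. k * z s)" "k * y (- R) = 1"
    "k * z (- R) = - (\<i> * \<kappa> * of_real n)" "k * z R = (\<i> * \<kappa> * of_real n) * (k * y R)"
proof -
  define c where "c = \<i> * \<kappa> * of_real n"
  have c2: "c\<^sup>2 = - (\<kappa> * of_real n)\<^sup>2" "(- c)\<^sup>2 = - (\<kappa> * of_real n)\<^sup>2"
    by (simp_all add: c_def power_mult_distrib)
  have bc: "z a = - c * y a" "z b = c * y b" using bc0 unfolding c_def .
  \<comment> \<open>Both \<open>b\<close> and \<open>R\<close> lie where \<open>\<epsilon>\<close> is constant to the right; compare them at a common point further right.\<close>
  have zR: "z R = c * y R"
    using outgoing_condition_shift[OF h _ const_outside_right[OF ab] c2(1), of b "max b R"]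
      outgoing_condition_shift[OF h _ const_outside_right[OF out R] c2(1), of "max b R"] bc(2) by simp
  have zL: "z (- R) = - c * y (- R)"
    using outgoing_condition_shift[OF h _ const_outside_left[OF ab] c2(2), of "min a (- R)" a]
      outgoing_condition_shift[OF h _ const_outside_left[OF out] c2(2), of "min a (- R)" "- R"] bc(1) R by simp
  have "AE s in lebesgue. s \<in> UNIV \<longrightarrow> \<epsilon> s = \<epsilon>' s" using \<epsilon>'(1) by eventually_elim blast
  then have h': "helmholtz_on UNIV \<kappa> \<epsilon>' y z"
    by (rule helmholtz_on_cong_AE[OF is_interval_univ h _ refl refl])
  have nz: "y (- R) \<noteq> 0"
  proof
    assume *: "y (- R) = 0"
    with zL have "z (- R) = 0" by simp
    then have "y s = 0" by (rule helmholtz_on_unique[OF h' \<epsilon>'(2) *])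
    with s show False by simp
  qed
  show thesis
  proof (rule that[of "inverse (y (- R))"])
    show "helmholtz_on {-R..R} \<kappa> \<epsilon>' (\<lambda>s. inverse (y (- R)) * y s) (\<lambda>s. inverse (y (- R)) * z s)"
      by (rule helmholtz_on_scale[OF helmholtz_on_subset[OF h']]) simp
  qed (use nz zL zR in \<open>simp_all add: c_def\<close>)
qed

lemma helmholtz_on_exp:
  assumes "d\<^sup>2 = - (\<kappa> * of_real n)\<^sup>2" "is_interval I"
  shows "helmholtz_on I \<kappa> (\<lambda>_. n\<^sup>2) (\<lambda>x. A * exp (d * of_real (x - p))) (\<lambda>x. d * (A * exp (d * of_real (x - p))))"
proof -
  have der: "((\<lambda>x. C * exp (d * of_real (x - p))) has_vector_derivative d * (C * exp (d * of_real (x - p)))) (at x within I)" for x C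
  proof -
    have "((\<lambda>z. C * exp (d * (z - of_real p))) has_field_derivative d * (C * exp (d * (of_real x - of_real p)))) (at (of_real x))"
      by (auto intro!: derivative_eq_intros)
    from has_vector_derivative_real_field[OF this] show ?thesis
      unfolding of_real_diff by (rule has_vector_derivative_at_within)
  qed
  have dd: "d * (d * C) = - \<kappa>\<^sup>2 * of_real (n\<^sup>2) * C" for C
    unfolding mult.assoc[symmetric] power2_eq_square[of d, symmetric] assms(1) by (simp add: power_mult_distrib)
  have "((\<lambda>x. d * (A * exp (d * of_real (x - p)))) has_vector_derivative
      - \<kappa>\<^sup>2 * of_real (n\<^sup>2) * (A * exp (d * of_real (x - p)))) (at x within I)" for x
    using der[of "d * A" x] unfolding mult.assoc[of d A] dd .
  with der[of A] show ?thesis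
    unfolding helmholtz_on_def by (intro conjI primitive_on_derivative assms(2)) auto
qed

text \<open>Outside \<open>{-R..R}\<close> the solution is continued by the outgoing exponentials, which fit both \<open>y\<close>
  and \<open>z\<close> by the boundary conditions and are mirror images of each other, so every parity of \<open>y\<close> on
  \<open>{-R..R}\<close> persists.\<close>

lemma outgoing_extension:
  assumes h: "helmholtz_on {-R..R} \<kappa> \<epsilon> y z" and R: "0 < R" and \<kappa>: "\<kappa> \<noteq> 0"
    and \<epsilon>: "\<epsilon> \<in> borel_measurable lebesgue" "\<And>s. \<bar>\<epsilon> s\<bar> \<le> B" "\<And>s. R < \<bar>s\<bar> \<Longrightarrow> \<epsilon> s = n\<^sup>2"
    and bc: "z (- R) = - (\<i> * \<kappa> * of_real n) * y (- R)" "z R = (\<i> * \<kappa> * of_real n) * y R"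
    and nz: "s0 \<in> {-R..R}" "y s0 \<noteq> 0"
  shows "\<exists>Y. is_mode n \<epsilon> \<kappa> Y \<and>
    (\<forall>\<sigma>. (\<forall>s\<in>{-R..R}. y (- s) = \<sigma> * y s) \<longrightarrow> (\<forall>s. Y (- s) = \<sigma> * Y s))"
proof -
  define c where "c = \<i> * \<kappa> * of_real n"
  have c2: "c\<^sup>2 = - (\<kappa> * of_real n)\<^sup>2" "(- c)\<^sup>2 = - (\<kappa> * of_real n)\<^sup>2"
    by (simp_all add: c_def power_mult_distrib)
  define L where "L x = y (- R) * exp (- c * of_real (x - - R))" for x
  define M where "M x = y R * exp (c * of_real (x - R))" for x
  define Y where "Y x = (if x < - R then L x else if x \<le> R then y x else M x)" for x
  define Z where "Z x = (if x < - R then - c * L x else if x \<le> R then z x else c * M x)" for x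
  have hM: "helmholtz_on {-R..R} \<kappa> \<epsilon> Y Z"
    by (rule helmholtz_on_cong_AE[OF _ h]) (auto simp: Y_def Z_def is_interval_cc)
  have hL: "helmholtz_on {..-R} \<kappa> \<epsilon> Y Z"
  proof (rule helmholtz_on_cong_AE)
    show "helmholtz_on {..-R} \<kappa> (\<lambda>_. n\<^sup>2) L (\<lambda>x. - c * L x)"
      unfolding L_def by (rule helmholtz_on_exp[OF c2(2)]) (rule is_interval_ic)
    show "AE s in lebesgue. s \<in> {..- R} \<longrightarrow> n\<^sup>2 = \<epsilon> s"
      using AE_lebesgue_neq[of "-R"] by eventually_elim (use \<epsilon>(3) R in auto)
    show "L s = Y s" "- c * L s = Z s" if "s \<in> {..-R}" for s
      using that bc R by (cases "s = -R"; auto simp: Y_def Z_def L_def c_def)+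
  qed (rule is_interval_ic)
  have hR: "helmholtz_on {R..} \<kappa> \<epsilon> Y Z"
  proof (rule helmholtz_on_cong_AE)
    show "helmholtz_on {R..} \<kappa> (\<lambda>_. n\<^sup>2) M (\<lambda>x. c * M x)"
      unfolding M_def by (rule helmholtz_on_exp[OF c2(1)]) (rule is_interval_ci)
    show "AE s in lebesgue. s \<in> {R..} \<longrightarrow> n\<^sup>2 = \<epsilon> s"
      using AE_lebesgue_neq[of "R"] by eventually_elim (use \<epsilon>(3) R in auto)
    show "M s = Y s" "c * M s = Z s" if "s \<in> {R..}" for s
      using that bc R by (cases "s = R"; auto simp: Y_def Z_def M_def c_def)+
  qed (rule is_interval_ci)
  have e1: "{..R} \<inter> {..-R} = {..-R}" "{..R} \<inter> {-R..} = {-R..R}" using R by auto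
  have "helmholtz_on {..R} \<kappa> \<epsilon> Y Z"
    by (rule helmholtz_on_glue[where c="-R"]) (use hL hM R e1 in auto)
  then have H: "helmholtz_on UNIV \<kappa> \<epsilon> Y Z"
    by (intro helmholtz_on_glue[where c="R" and I=UNIV]) (use hR in auto)
  show ?thesis
  proof (intro exI[of _ Y] conjI allI impI)
    show "is_mode n \<epsilon> \<kappa> Y"
    proof (rule helmholtz_imp_is_mode[OF H \<kappa> \<epsilon>(1,2)])
      show "Y s0 \<noteq> 0" using nz by (auto simp: Y_def)
      show "const_outside n \<epsilon> (- R) R"
        unfolding const_outside_def using R \<epsilon>(3) by (intro conjI AE_I2) auto
      show "Z (- R) = - (\<i> * \<kappa> * of_real n) * Y (- R)" "Z R = (\<i> * \<kappa> * of_real n) * Y R"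
        using bc R by (auto simp: Y_def Z_def)
    qed
    fix \<sigma> s assume par': "\<forall>s\<in>{-R..R}. y (- s) = \<sigma> * y s"
    have par: "y (- s) = \<sigma> * y s" if "s \<in> {-R..R}" for s using par' that by blast
    have ends: "y (- R) = \<sigma> * y R" "y R = \<sigma> * y (- R)" using par[of R] par[of "- R"] R by auto
    consider "s < - R" | "s \<in> {-R..R}" | "s > R" by force
    then show "Y (- s) = \<sigma> * Y s"
    proof cases
      case 1
      then have "Y (- s) = y R * exp (c * of_real (- s - R))" "Y s = y (- R) * exp (- c * of_real (s - - R))"
        using R by (auto simp: Y_def L_def M_def)
      moreover have "c * of_real (- s - R) = - c * of_real (s - - R)" by (simp add: algebra_simps)
      ultimately show ?thesis using ends(2) by simp
    next
      case 2
      then show ?thesis using par[of s] by (auto simp: Y_def)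
    next
      case 3
      then have "Y s = y R * exp (c * of_real (s - R))" "Y (- s) = y (- R) * exp (- c * of_real (- s - - R))"
        using R by (auto simp: Y_def L_def M_def)
      moreover have "c * of_real (s - R) = - c * of_real (- s - - R)" by (simp add: algebra_simps)
      ultimately show ?thesis using ends(1) by simp
    qed
  qed
qed

section \<open>Compactness of normalized modes\<close>

text \<open>Representatives of coefficients for which bounds, value outside \<open>{-r..r}\<close> and symmetry hold at
  every point.  These conditions survive midpoints and pointwise limits without exceptional null sets;
  in particular a limit of symmetric functions is symmetric without an argument about reflected null
  sets.\<close>

definition profile :: "real \<Rightarrow> real \<Rightarrow> real \<Rightarrow> bool \<Rightarrow> real \<Rightarrow> (real \<Rightarrow> real) \<Rightarrow> bool" where
  "profile l u m symm r \<epsilon> \<longleftrightarrow> \<epsilon> \<in> borel_measurable lebesgue \<and> (\<forall>s. l \<le> \<epsilon> s \<and> \<epsilon> s \<le> u) \<and>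
     (\<forall>s. r < \<bar>s\<bar> \<longrightarrow> \<epsilon> s = m) \<and> (symm \<longrightarrow> (\<forall>s. \<epsilon> (- s) = \<epsilon> s))"

lemma profile_mono: "profile l u m symm r \<epsilon> \<Longrightarrow> r \<le> r' \<Longrightarrow> profile l u m symm r' \<epsilon>"
  unfolding profile_def by (meson le_less_trans)

lemma profile_midpoint:
  assumes "profile l u m symm r f" "profile l u m symm r g"
  shows "profile l u m symm r (\<lambda>s. (f s + g s) / 2)"
  unfolding profile_def
proof (intro conjI allI impI)
  have [measurable]: "f \<in> borel_measurable lebesgue" "g \<in> borel_measurable lebesgue"
    using assms by (auto simp: profile_def)
  show "(\<lambda>s. (f s + g s) / 2) \<in> borel_measurable lebesgue" by measurable
  fix s
  have "l \<le> f s" "f s \<le> u" "l \<le> g s" "g s \<le> u" using assms by (auto simp: profile_def)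
  then show "l \<le> (f s + g s) / 2" "(f s + g s) / 2 \<le> u" by simp_all
qed (use assms in \<open>auto simp: profile_def\<close>)

lemma profile_abs_le: "profile l u m symm r f \<Longrightarrow> 0 \<le> l \<Longrightarrow> \<bar>f s\<bar> \<le> u"
  unfolding profile_def abs_le_iff by (meson minus_le_iff neg_le_0_iff_le order_trans)

lemma profile_mult_integrable:
  fixes y :: "real \<Rightarrow> complex"
  assumes f: "profile l u m symm r f" and y: "continuous_on {a..b} y"
  shows "(\<lambda>t. of_real (f t) * y t) absolutely_integrable_on {a..b}"
proof -
  have "(\<lambda>t. f t *\<^sub>R y t) absolutely_integrable_on {a..b}"
  proof (rule absolutely_integrable_bounded_measurable_product[where h="\<lambda>x y. x *\<^sub>R y"])
    show "bilinear (\<lambda>(x::real) (y::complex). x *\<^sub>R y)"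
      using bilinear_conv_bounded_bilinear bounded_bilinear_scaleR by blast
    show "f \<in> borel_measurable (lebesgue_on {a..b})"
      using f unfolding profile_def by (intro measurable_restrict_space1) blast
    show "bounded (f ` {a..b})"
      using f unfolding profile_def by (intro bounded_subset[OF bounded_closed_interval[of l u]]) auto
    show "y absolutely_integrable_on {a..b}" by (rule absolutely_integrable_continuous_real[OF y])
  qed simp
  then show ?thesis by (simp add: scaleR_conv_of_real)
qed

lemma AE_tendsto_integral_mult:
  fixes y :: "real \<Rightarrow> complex"
  assumes g: "\<And>n. profile l u m symm (r n) (g n)" and f: "profile l u m symm' r' f" and l: "0 \<le> l"
    and y: "continuous_on {a..b} y"
    and lim: "AE s in lebesgue. s \<in> {a..b} \<longrightarrow> (\<lambda>n. g n s) \<longlonglongrightarrow> f s"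
  shows "(\<lambda>n. integral {a..b} (\<lambda>t. of_real (g n t) * y t)) \<longlonglongrightarrow> integral {a..b} (\<lambda>t. of_real (f t) * y t)"
proof -
  have ai: "(\<lambda>t. of_real (h t) * y t) absolutely_integrable_on {a..b}"
    if "profile l u m sy ra h" for h sy ra by (rule profile_mult_integrable[OF that y])
  have *: "integral {a..b} (\<lambda>t. of_real (h t) * y t) = (LINT t|lebesgue. indicat_real {a..b} t *\<^sub>R (of_real (h t) * y t))"
    if "profile l u m sy ra h" for h sy ra
    using set_lebesgue_integral_eq_integral(2)[OF ai[OF that]] unfolding set_lebesgue_integral_def by simp
  have iy: "y absolutely_integrable_on {a..b}" by (rule absolutely_integrable_continuous_real[OF y])
  show ?thesis unfolding *[OF g] *[OF f]
  proof (rule integral_dominated_convergence[where w="\<lambda>t. u * norm (indicat_real {a..b} t *\<^sub>R y t)"])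
    show "(\<lambda>t. indicat_real {a..b} t *\<^sub>R (of_real (f t) * y t)) \<in> borel_measurable lebesgue"
      using ai[OF f] unfolding set_integrable_def by (rule borel_measurable_integrable)
    show "(\<lambda>t. indicat_real {a..b} t *\<^sub>R (of_real (g n t) * y t)) \<in> borel_measurable lebesgue" for n
      using ai[OF g] unfolding set_integrable_def by (rule borel_measurable_integrable)
    show "integrable lebesgue (\<lambda>t. u * norm (indicat_real {a..b} t *\<^sub>R y t))"
      using iy unfolding set_integrable_def by (intro integrable_mult_right integrable_norm)
    show "AE t in lebesgue. norm (indicat_real {a..b} t *\<^sub>R (of_real (g n t) * y t)) \<le> u * norm (indicat_real {a..b} t *\<^sub>R y t)" for n
    proof (rule AE_I2)
      fix t
      have "\<bar>g n t\<bar> * norm (y t) \<le> u * norm (y t)"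
        using profile_abs_le[OF g l] by (intro mult_right_mono) auto
      then show "norm (indicat_real {a..b} t *\<^sub>R (of_real (g n t) * y t)) \<le> u * norm (indicat_real {a..b} t *\<^sub>R y t)"
        by (simp add: norm_mult indicator_def)
    qed
    show "AE t in lebesgue. (\<lambda>n. indicat_real {a..b} t *\<^sub>R (of_real (g n t) * y t))
        \<longlonglongrightarrow> indicat_real {a..b} t *\<^sub>R (of_real (f t) * y t)"
      using lim
    proof eventually_elim
      case (elim t)
      show ?case
      proof (cases "t \<in> {a..b}")
        case True
        with elim have "(\<lambda>n. g n t) \<longlonglongrightarrow> f t" by blast
        then show ?thesis by (intro tendsto_intros)
      qed simp
    qed
  qed
qed

text \<open>Closedness of the normalized resonance problem as the radius outside of which \<open>\<epsilon> = m\<close> shrinks to \<open>r\<close>.  The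
  solutions are bounded and Lipschitz uniformly on \<open>{-R..R}\<close>, so by Arzela-Ascoli a subsequence
  converges uniformly to some \<open>(y, z)\<close>.  The coefficients need not converge in any strong sense.
  However, once \<open>y\<close> and \<open>z\<close> are known, the equation for \<open>z\<close> is affine in \<open>\<epsilon>\<close>: the coefficients that
  satisfy it up to an error \<open>\<delta>\<close> form a convex set, which is nonempty for every \<open>\<delta> > 0\<close>.  The selection
  principle for nested convex sets yields coefficients with errors tending to zero that converge almost
  everywhere, and their limit solves the equation exactly.\<close>

lemma outgoing_limit:
  assumes r: "0 \<le> r" "r < R" and l: "0 \<le> l" "l \<le> u" "l \<le> m" "m \<le> u"
    and sol: "\<And>\<delta>. 0 < \<delta> \<Longrightarrow> \<exists>\<epsilon> y z. profile l u m symm (r + \<delta>) \<epsilon> \<and> helmholtz_on {-R..R} \<kappa> \<epsilon> y z \<and>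
      y (- R) = 1 \<and> z (- R) = - c \<and> z R = c * y R \<and> (\<forall>\<sigma>\<in>S. \<forall>s\<in>{-R..R}. y (- s) = \<sigma> * y s)"
  shows "\<exists>\<epsilon> y z. profile l u m symm r \<epsilon> \<and> helmholtz_on {-R..R} \<kappa> \<epsilon> y z \<and>
      y (- R) = 1 \<and> z (- R) = - c \<and> z R = c * y R \<and> (\<forall>\<sigma>\<in>S. \<forall>s\<in>{-R..R}. y (- s) = \<sigma> * y s)"
proof -
  define \<delta> where "\<delta> n = 1 / real (Suc n)" for n
  have \<delta>: "\<delta> n > 0" for n by (simp add: \<delta>_def)
  have \<delta>_mono: "\<delta> j \<le> \<delta> i" if "i \<le> j" for i j unfolding \<delta>_def using that by (intro divide_left_mono) auto
  have \<delta>_lim: "\<delta> \<longlonglongrightarrow> 0" unfolding \<delta>_def[abs_def] by (rule LIMSEQ_Suc[OF lim_1_over_n])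
  have u: "u \<ge> 0" using l by simp
  have "\<forall>n. \<exists>\<epsilon> y z. profile l u m symm (r + \<delta> n) \<epsilon> \<and> helmholtz_on {-R..R} \<kappa> \<epsilon> y z \<and>
      y (- R) = 1 \<and> z (- R) = - c \<and> z R = c * y R \<and> (\<forall>\<sigma>\<in>S. \<forall>s\<in>{-R..R}. y (- s) = \<sigma> * y s)"
    using sol[OF \<delta>] by blast
  then obtain E Y Z where E: "\<And>n. profile l u m symm (r + \<delta> n) (E n)"
    and H: "\<And>n. helmholtz_on {-R..R} \<kappa> (E n) (Y n) (Z n)"
    and Y0: "\<And>n. Y n (- R) = 1" and Z0: "\<And>n. Z n (- R) = - c" and ZR: "\<And>n. Z n R = c * Y n R"
    and par: "\<And>n \<sigma> s. \<sigma> \<in> S \<Longrightarrow> s \<in> {-R..R} \<Longrightarrow> Y n (- s) = \<sigma> * Y n s"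
    by metis
  have pY: "primitive_on {-R..R} (Y n) (Z n)"
    and pZ: "primitive_on {-R..R} (Z n) (\<lambda>s. - \<kappa>\<^sup>2 * complex_of_real (E n s) * Y n s)" for n
    using H[of n] unfolding helmholtz_on_def by blast+
  have cY: "continuous_on {-R..R} (Y n)" and cZ: "continuous_on {-R..R} (Z n)" for n
    using primitive_on_Icc_continuous[OF pY] primitive_on_Icc_continuous[OF pZ] by blast+
  define M where "M = 2 * (1 + norm c) * exp (2 * (1 + (norm \<kappa>)\<^sup>2 * u) * (2 * R))"
  have M: "M \<ge> 0" by (simp add: M_def)
  have bound: "norm (Y n x) + norm (Z n x) \<le> M" if x: "x \<in> {-R..R}" for n x
  proof -
    have "norm (Y n x) + norm (Z n x) \<le> 2 * (norm (Y n (- R)) + norm (Z n (- R))) * exp (2 * (1 + (norm \<kappa>)\<^sup>2 * u) * (x - - R))"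
      by (rule helmholtz_on_growth[OF H _ u x]) (rule profile_abs_le[OF E l(1)])
    also have "\<dots> = 2 * (1 + norm c) * exp (2 * (1 + (norm \<kappa>)\<^sup>2 * u) * (x - - R))"
      by (simp add: Y0 Z0)
    also have "\<dots> \<le> M" unfolding M_def
      using x u by (intro mult_left_mono) (auto intro!: mult_left_mono)
    finally show ?thesis .
  qed
  define Q where "Q = (1 + (norm \<kappa>)\<^sup>2 * u) * M"
  have Q: "Q \<ge> 0" "M \<le> Q" "(norm \<kappa>)\<^sup>2 * u * M \<le> Q"
    using M u by (auto simp: Q_def distrib_right)
  have lipY: "norm (Y n y - Y n x) \<le> Q * (y - x)" if "-R \<le> x" "x \<le> y" "y \<le> R" for n x y
  proof -
    have "norm (Y n y - Y n x) \<le> Q * measure lborel (cbox x y)"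
    proof (rule has_integral_bound[OF Q(1)])
      show "(Z n has_integral Y n y - Y n x) (cbox x y)" using primitive_onD[OF pY, of x y n] that by simp
      show "norm (Z n t) \<le> Q" if "t \<in> cbox x y" for t
        using bound[of t n] norm_ge_zero[of "Y n t"] that \<open>-R \<le> x\<close> \<open>y \<le> R\<close> Q(2) by (simp del: norm_ge_zero)
    qed
    then show ?thesis using that by simp
  qed
  have lipZ: "norm (Z n y - Z n x) \<le> Q * (y - x)" if "-R \<le> x" "x \<le> y" "y \<le> R" for n x y
  proof -
    have "norm (Z n y - Z n x) \<le> Q * measure lborel (cbox x y)"
    proof (rule has_integral_bound[OF Q(1)])
      show "((\<lambda>s. - \<kappa>\<^sup>2 * complex_of_real (E n s) * Y n s) has_integral Z n y - Z n x) (cbox x y)"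
        using primitive_onD[OF pZ, of x y n] that by simp
      show "norm (- \<kappa>\<^sup>2 * complex_of_real (E n t) * Y n t) \<le> Q" if "t \<in> cbox x y" for t
      proof -
        have "norm (Y n t) \<le> M" using bound[of t n] norm_ge_zero[of "Z n t"] that \<open>-R \<le> x\<close> \<open>y \<le> R\<close> by (simp del: norm_ge_zero)
        then have "(norm \<kappa>)\<^sup>2 * \<bar>E n t\<bar> * norm (Y n t) \<le> (norm \<kappa>)\<^sup>2 * u * M"
          using profile_abs_le[OF E l(1), of n t] u by (intro mult_mono mult_nonneg_nonneg) auto
        with Q(3) show ?thesis by (simp add: norm_mult norm_power)
      qed
    qed
    then show ?thesis using that by simp
  qed
  define F where "F n x = (Y n x, Z n x)" for n x
  have F_le: "norm (F n x - F n y) \<le> 2 * Q * norm (x - y)" if "x \<in> {-R..R}" "y \<in> {-R..R}" for n x y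
  proof -
    have "norm (F n x - F n y) \<le> norm (Y n x - Y n y) + norm (Z n x - Z n y)"
      unfolding F_def by (simp add: norm_Pair_le)
    also have "\<dots> \<le> 2 * Q * norm (x - y)"
    proof (cases "x \<le> y")
      case True
      then show ?thesis using lipY[of x y n] lipZ[of x y n] that by (simp add: norm_minus_commute)
    next
      case False
      then show ?thesis using lipY[of y x n] lipZ[of y x n] that by simp
    qed
    finally show ?thesis .
  qed
  have F_bound: "norm (F n x) \<le> M" if "x \<in> {-R..R}" for n x
    using bound[OF that, of n] norm_Pair_le[of "Y n x" "Z n x"] unfolding F_def by linarith
  have equicont: "\<exists>d>0. \<forall>n y. y \<in> {-R..R} \<and> norm (x - y) < d \<longrightarrow> norm (F n x - F n y) < e"
    if "x \<in> {-R..R}" "0 < e" for x e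
  proof (intro exI[of _ "e / (2 * Q + 1)"] conjI allI impI)
    show "0 < e / (2 * Q + 1)" using that Q by simp
    fix n y assume y: "y \<in> {-R..R} \<and> norm (x - y) < e / (2 * Q + 1)"
    have "norm (F n x - F n y) \<le> 2 * Q * norm (x - y)" using F_le that(1) y by blast
    also have "\<dots> \<le> (2 * Q + 1) * norm (x - y)" by (intro mult_right_mono) auto
    also have "\<dots> < e" using y Q by (simp add: pos_less_divide_eq mult.commute)
    finally show "norm (F n x - F n y) < e" .
  qed
  have "\<exists>g (k :: nat \<Rightarrow> nat). continuous_on {-R..R} g \<and> strict_mono k \<and>
      (\<forall>e>0. \<exists>N. \<forall>n x. N \<le> n \<and> x \<in> {-R..R} \<longrightarrow> norm (F (k n) x - g x) < e)"
    by (rule Arzela_Ascoli[OF compact_Icc F_bound equicont];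
        (assumption | (intro exI conjI, assumption, assumption, blast)))
  then obtain g and k :: "nat \<Rightarrow> nat" where g: "continuous_on {-R..R} g" and k: "strict_mono k"
    and unif: "\<And>e. 0 < e \<Longrightarrow> \<exists>N. \<forall>n x. N \<le> n \<and> x \<in> {-R..R} \<longrightarrow> norm (F (k n) x - g x) < e"
    by (elim exE conjE) blast
  define y where "y x = fst (g x)" for x
  define z where "z x = snd (g x)" for x
  have cy: "continuous_on {-R..R} y"
    unfolding y_def by (intro continuous_intros g)
  have Fg: "F (k n) x - g x = (Y (k n) x - y x, Z (k n) x - z x)" for n x
    by (simp add: F_def y_def z_def prod_eq_iff)
  have unifY: "norm (Y (k n) x - y x) \<le> norm (F (k n) x - g x)"
    and unifZ: "norm (Z (k n) x - z x) \<le> norm (F (k n) x - g x)" for n x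
    unfolding Fg by (rule norm_fst_le, rule norm_snd_le)
  have uY: "uniform_limit {-R..R} (\<lambda>n. Y (k n)) y sequentially"
    and uZ: "uniform_limit {-R..R} (\<lambda>n. Z (k n)) z sequentially"
    unfolding uniform_limit_sequentially_iff dist_norm using unif unifY unifZ by (meson le_less_trans)+
  have tY: "(\<lambda>n. Y (k n) x) \<longlonglongrightarrow> y x" and tZ: "(\<lambda>n. Z (k n) x) \<longlonglongrightarrow> z x" if "x \<in> {-R..R}" for x
    using tendsto_uniform_limitI[OF uY that] tendsto_uniform_limitI[OF uZ that] by blast+
  have endpts: "- R \<in> {-R..R}" "R \<in> {-R..R}" using r by auto
  have y0: "y (- R) = 1" using LIMSEQ_unique[OF tY[OF endpts(1)]] Y0 by simp
  have z0: "z (- R) = - c" using LIMSEQ_unique[OF tZ[OF endpts(1)]] Z0 by simp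
  have zR: "z R = c * y R"
    using LIMSEQ_unique[OF tZ[OF endpts(2)]] tendsto_mult[OF tendsto_const[of c] tY[OF endpts(2)]] ZR by simp
  have pary: "y (- s) = \<sigma> * y s" if "\<sigma> \<in> S" "s \<in> {-R..R}" for \<sigma> s
  proof -
    have "(\<lambda>n. Y (k n) (- s)) \<longlonglongrightarrow> \<sigma> * y s"
      unfolding par[OF that] by (intro tendsto_mult tendsto_const tY that(2))
    moreover have "(\<lambda>n. Y (k n) (- s)) \<longlonglongrightarrow> y (- s)" using that(2) by (intro tY) auto
    ultimately show ?thesis using LIMSEQ_unique by blast
  qed
  have py: "primitive_on {-R..R} y z"
    unfolding primitive_on_def
  proof (intro ballI impI)
    fix a b assume ab: "a \<in> {-R..R}" "b \<in> {-R..R}" "a \<le> b"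
    then have sub: "{a..b} \<subseteq> {-R..R}" by auto
    obtain I J where I: "\<And>n. (Z (k n) has_integral I n) {a..b}" and J: "(z has_integral J) {a..b}" and IJ: "I \<longlonglongrightarrow> J"
      using uniform_limit_integral[OF uniform_limit_on_subset[OF uZ sub] continuous_on_subset[OF cZ sub] sequentially_bot]
      by blast
    have "I n = Y (k n) b - Y (k n) a" for n
      using has_integral_unique[OF I primitive_onD[OF pY ab]] .
    then have "I = (\<lambda>n. Y (k n) b - Y (k n) a)" by (rule ext)
    with IJ have "(\<lambda>n. Y (k n) b - Y (k n) a) \<longlonglongrightarrow> J" by (simp only:)
    moreover have "(\<lambda>n. Y (k n) b - Y (k n) a) \<longlonglongrightarrow> y b - y a" by (intro tendsto_diff tY ab)
    ultimately show "(z has_integral y b - y a) {a..b}" using J LIMSEQ_unique by blast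
  qed
  \<comment> \<open>The residual of the equation for \<open>z\<close>, integrated from \<open>- R\<close>; it is affine in \<open>f\<close>.\<close>
  define res where "res f x = z x - z (- R) + \<kappa>\<^sup>2 * integral {-R..x} (\<lambda>t. of_real (f t) * y t)" for f :: "real \<Rightarrow> real" and x
  define K where "K N = {f. profile l u m symm (r + \<delta> N) f \<and> (\<forall>x\<in>{-R..R}. norm (res f x) \<le> \<delta> N)}" for N
  have int: "(\<lambda>t. of_real (f t) * v t) integrable_on {-R..x}"
    if "profile l u m symm' r' f" "x \<in> {-R..R}" "continuous_on {-R..R} v" for f r' symm' x and v :: "real \<Rightarrow> complex"
    by (rule set_lebesgue_integral_eq_integral(1), rule profile_mult_integrable[OF that(1)], rule continuous_on_subset[OF that(3)])
       (use that(2) in auto)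
  have ne: "K N \<noteq> {}" for N
  proof -
    \<comment> \<open>An \<open>\<eta>\<close>-approximation of \<open>(y, z)\<close> produces a residual of at most \<open>2 \<eta>\<close> from \<open>z\<close> and \<open>\<bar>\<kappa>\<bar>\<^sup>2 u 2 R \<eta>\<close> from \<open>y\<close>.\<close>
    define \<eta> where "\<eta> = \<delta> N / (2 + (norm \<kappa>)\<^sup>2 * u * (2 * R))"
    have den: "2 + (norm \<kappa>)\<^sup>2 * u * (2 * R) > 0" using u r by (intro add_pos_nonneg) auto
    then have "(2 + (norm \<kappa>)\<^sup>2 * u * (2 * R)) * \<eta> = \<delta> N" unfolding \<eta>_def by simp
    then have \<eta>: "\<eta> > 0" "2 * \<eta> + (norm \<kappa>)\<^sup>2 * u * (2 * R) * \<eta> = \<delta> N"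
      using \<delta>[of N] den unfolding distrib_right by (simp_all add: \<eta>_def)
    obtain N' where N': "\<And>n x. N' \<le> n \<Longrightarrow> x \<in> {-R..R} \<Longrightarrow> norm (F (k n) x - g x) < \<eta>"
      using unif[OF \<eta>(1)] by blast
    define n where "n = max N N'"
    have kn: "N \<le> k n" using seq_suble[OF k, of n] by (simp add: n_def)
    have close: "norm (Y (k n) x - y x) \<le> \<eta>" "norm (Z (k n) x - z x) \<le> \<eta>" if "x \<in> {-R..R}" for x
      using N'[of n x] unifY[of n x] unifZ[of n x] that by (simp_all add: n_def)
    have prof: "profile l u m symm (r + \<delta> N) (E (k n))"
      by (rule profile_mono[OF E]) (use \<delta>_mono[OF kn] in simp)
    have "norm (res (E (k n)) x) \<le> \<delta> N" if x: "x \<in> {-R..R}" for x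
    proof -
      let ?f = "E (k n)"
      have fi: "(\<lambda>t. of_real (?f t) * y t) integrable_on {-R..x}" "(\<lambda>t. of_real (?f t) * Y (k n) t) integrable_on {-R..x}"
        by (rule int[OF E x cy], rule int[OF E x cY])
      have "((\<lambda>s. - \<kappa>\<^sup>2 * (of_real (?f s) * Y (k n) s)) has_integral Z (k n) x - Z (k n) (- R)) {-R..x}"
        using primitive_onD[OF pZ, of "-R" x "k n"] x by (simp add: mult.assoc)
      moreover have "((\<lambda>s. - \<kappa>\<^sup>2 * (of_real (?f s) * Y (k n) s)) has_integral - \<kappa>\<^sup>2 * integral {-R..x} (\<lambda>s. of_real (?f s) * Y (k n) s)) {-R..x}"
        by (intro has_integral_mult_right integrable_integral fi)
      ultimately have eqZ: "Z (k n) x - Z (k n) (- R) = - \<kappa>\<^sup>2 * integral {-R..x} (\<lambda>s. of_real (?f s) * Y (k n) s)"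
        by (rule has_integral_unique)
      define D where "D = integral {-R..x} (\<lambda>s. of_real (?f s) * Y (k n) s) - integral {-R..x} (\<lambda>s. of_real (?f s) * y s)"
      have "((\<lambda>s. of_real (?f s) * Y (k n) s - of_real (?f s) * y s) has_integral D) (cbox (-R) x)"
        unfolding D_def using has_integral_diff[OF integrable_integral[OF fi(2)] integrable_integral[OF fi(1)]] by simp
      then have "norm D \<le> (u * \<eta>) * measure lborel (cbox (-R) x)"
      proof (rule has_integral_bound[rotated])
        show "0 \<le> u * \<eta>" using u \<eta> by simp
        fix t assume "t \<in> cbox (-R) x"
        then have "t \<in> {-R..R}" using x by auto
        then have "\<bar>?f t\<bar> * norm (Y (k n) t - y t) \<le> u * \<eta>"
          using close(1) profile_abs_le[OF E l(1)] u by (intro mult_mono) auto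
        then show "norm (of_real (?f t) * Y (k n) t - of_real (?f t) * y t) \<le> u * \<eta>"
          by (simp add: norm_mult right_diff_distrib[symmetric])
      qed
      also have "\<dots> \<le> (u * \<eta>) * (2 * R)" using x u \<eta> by (intro mult_left_mono) auto
      finally have D: "(norm \<kappa>)\<^sup>2 * norm D \<le> (norm \<kappa>)\<^sup>2 * ((u * \<eta>) * (2 * R))"
        by (intro mult_left_mono) auto
      have eq: "res ?f x = (Z (k n) (- R) - z (- R)) - (Z (k n) x - z x) - \<kappa>\<^sup>2 * D"
        unfolding res_def D_def using eqZ by (simp add: algebra_simps)
      have "norm (res ?f x) \<le> norm (Z (k n) (- R) - z (- R)) + norm (Z (k n) x - z x) + norm (\<kappa>\<^sup>2 * D)"
        unfolding eq by (intro norm_triangle_le_diff add_right_mono norm_triangle_ineq4)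
      also have "\<dots> \<le> \<eta> + \<eta> + (norm \<kappa>)\<^sup>2 * ((u * \<eta>) * (2 * R))"
        using close(2)[OF x] close(2)[OF endpts(1)] D by (simp add: norm_mult norm_power)
      also have "\<dots> = \<delta> N" using \<eta>(2) by (simp add: mult_ac)
      finally show ?thesis .
    qed
    with prof have "E (k n) \<in> K N" by (simp add: K_def)
    then show ?thesis by blast
  qed
  have dec: "K (Suc N) \<subseteq> K N" for N
  proof -
    have "\<delta> (Suc N) \<le> \<delta> N" by (rule \<delta>_mono) simp
    then show ?thesis unfolding K_def by (auto intro: profile_mono order_trans)
  qed
  have mid: "(\<lambda>x. (f x + h x) / 2) \<in> K N" if f: "f \<in> K N" and h: "h \<in> K N" for f h N
  proof -
    have pf: "profile l u m symm (r + \<delta> N) f" "profile l u m symm (r + \<delta> N) h" using f h by (auto simp: K_def)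
    have "norm (res (\<lambda>x. (f x + h x) / 2) x) \<le> \<delta> N" if x: "x \<in> {-R..R}" for x
    proof -
      have "(\<lambda>t. of_real ((f t + h t) / 2) * y t) = (\<lambda>t. (1/2) * (of_real (f t) * y t + of_real (h t) * y t))"
        by (simp add: fun_eq_iff algebra_simps)
      then have "integral {-R..x} (\<lambda>t. of_real ((f t + h t) / 2) * y t)
          = (1/2) * (integral {-R..x} (\<lambda>t. of_real (f t) * y t) + integral {-R..x} (\<lambda>t. of_real (h t) * y t))"
        using Henstock_Kurzweil_Integration.integral_add[OF int[OF pf(1) x cy] int[OF pf(2) x cy]]
        by (simp only: Henstock_Kurzweil_Integration.integral_mult_right)
      then have "res (\<lambda>x. (f x + h x) / 2) x = (res f x + res h x) / 2"
        unfolding res_def by (simp add: field_simps)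
      then have "norm (res (\<lambda>x. (f x + h x) / 2) x) = norm (res f x + res h x) / 2"
        by (simp only: norm_divide norm_numeral)
      also have "\<dots> \<le> (norm (res f x) + norm (res h x)) / 2"
        by (intro divide_right_mono norm_triangle_ineq) simp
      also have "\<dots> \<le> (\<delta> N + \<delta> N) / 2" using f h x by (intro divide_right_mono add_mono) (auto simp: K_def)
      finally show ?thesis by simp
    qed
    with profile_midpoint[OF pf] show ?thesis by (simp add: K_def)
  qed
  have fin: "finite_measure (lebesgue_on {-R..R})"
    by (rule finite_measure_lebesgue_on) auto
  have meas: "f \<in> borel_measurable (lebesgue_on {-R..R})" if "f \<in> K n" for n f
    using that unfolding K_def profile_def by (intro measurable_restrict_space1) blast
  have bnd: "\<bar>f x\<bar> \<le> u" if "f \<in> K n" for n f x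
    using that unfolding K_def by (blast intro: profile_abs_le[OF _ l(1)])
  have "\<exists>h. (\<forall>n. h n \<in> K n) \<and> (AE s in lebesgue_on {-R..R}. Cauchy (\<lambda>n. h n s))"
    by (rule nested_midpoint_convex_AE_Cauchy[where B=u]) (fact fin ne dec meas bnd mid)+
  then obtain h where h: "\<And>n. h n \<in> K n" and Ch: "AE s in lebesgue_on {-R..R}. Cauchy (\<lambda>n. h n s)"
    by (elim exE conjE) blast
  have hp: "profile l u m symm (r + \<delta> n) (h n)" for n using h by (auto simp: K_def)
  \<comment> \<open>Clamping matters only on the null set where \<open>h\<close> fails to converge and \<open>lim\<close> is arbitrary.\<close>
  define \<epsilon> where "\<epsilon> s = (if \<bar>s\<bar> \<le> r then max l (min u (lim (\<lambda>n. h n s))) else m)" for s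
  have \<epsilon>p: "profile l u m symm r \<epsilon>"
    unfolding profile_def
  proof (intro conjI allI impI)
    have [measurable]: "h n \<in> borel_measurable lebesgue" for n using hp[of n] by (auto simp: profile_def)
    have [measurable]: "(\<lambda>s::real. \<bar>s\<bar>) \<in> borel_measurable lebesgue"
      by (intro continuous_imp_lebesgue_measurable continuous_intros)
    show "\<epsilon> \<in> borel_measurable lebesgue" unfolding \<epsilon>_def[abs_def] by measurable
    fix s
    show "l \<le> \<epsilon> s" "\<epsilon> s \<le> u" using l by (auto simp: \<epsilon>_def)
    show "\<epsilon> s = m" if "r < \<bar>s\<bar>" using that by (simp add: \<epsilon>_def)
    show "\<epsilon> (- s) = \<epsilon> s" if symm
      using hp that by (simp add: \<epsilon>_def profile_def)
  qed
  have lim: "AE s in lebesgue. s \<in> {-R..R} \<longrightarrow> (\<lambda>n. h n s) \<longlonglongrightarrow> \<epsilon> s"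
  proof -
    have "AE s in lebesgue. s \<in> {-R..R} \<longrightarrow> Cauchy (\<lambda>n. h n s)"
      using Ch by (subst (asm) AE_restrict_space_iff) auto
    then show ?thesis
    proof eventually_elim
      case (elim s)
      show ?case
      proof (cases "\<bar>s\<bar> \<le> r")
        case True
        with elim r have "Cauchy (\<lambda>n. h n s)" by (auto simp: abs_le_iff)
        then have L: "(\<lambda>n. h n s) \<longlonglongrightarrow> lim (\<lambda>n. h n s)"
          by (intro convergent_LIMSEQ_iff[THEN iffD1] real_Cauchy_convergent)
        have "l \<le> lim (\<lambda>n. h n s)" by (rule LIMSEQ_le_const[OF L]) (use hp in \<open>auto simp: profile_def\<close>)
        moreover have "lim (\<lambda>n. h n s) \<le> u" by (rule LIMSEQ_le_const2[OF L]) (use hp in \<open>auto simp: profile_def\<close>)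
        ultimately have "\<epsilon> s = lim (\<lambda>n. h n s)" using True by (simp add: \<epsilon>_def)
        with L show ?thesis by simp
      next
        case False
        have "eventually (\<lambda>n. \<delta> n < \<bar>s\<bar> - r) sequentially"
          using False by (intro order_tendstoD(2)[OF \<delta>_lim]) auto
        then have "eventually (\<lambda>n. h n s = \<epsilon> s) sequentially"
        proof eventually_elim
          case (elim n)
          then have "h n s = m" using hp[of n] by (simp add: profile_def)
          then show ?case using False by (simp add: \<epsilon>_def)
        qed
        from tendsto_eventually[OF this] show ?thesis by (rule impI)
      qed
    qed
  qed
  have res0: "res \<epsilon> x = 0" if x: "x \<in> {-R..R}" for x
  proof -
    have sub: "{-R..x} \<subseteq> {-R..R}" using x by auto
    have "AE s in lebesgue. s \<in> {-R..x} \<longrightarrow> (\<lambda>n. h n s) \<longlonglongrightarrow> \<epsilon> s"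
      using lim by eventually_elim (use sub in blast)
    from AE_tendsto_integral_mult[OF hp \<epsilon>p l(1) continuous_on_subset[OF cy sub] this]
    have "(\<lambda>n. res (h n) x) \<longlonglongrightarrow> res \<epsilon> x"
      unfolding res_def by (intro tendsto_intros)
    moreover have "(\<lambda>n. res (h n) x) \<longlonglongrightarrow> 0"
    proof (rule Lim_null_comparison[OF _ \<delta>_lim])
      show "\<forall>\<^sub>F n in sequentially. norm (res (h n) x) \<le> \<delta> n"
        using h x by (auto simp: K_def)
    qed
    ultimately show ?thesis by (rule LIMSEQ_unique)
  qed
  have alg: "- k * J = zb - za" if "Ia + J = Ib" "za - z0 + k * Ia = 0" "zb - z0 + k * Ib = 0"
    for k J Ia Ib za zb z0 :: complex
  proof -
    have "zb - z0 = - (k * Ib)" "za - z0 = - (k * Ia)"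
      using that(2,3) by (simp_all add: eq_neg_iff_add_eq_0)
    then have "zb - za = - (k * Ib) - - (k * Ia)" by (metis diff_diff_eq2 diff_add_cancel)
    then show ?thesis unfolding that(1)[symmetric] by (simp add: algebra_simps)
  qed
  have pz: "primitive_on {-R..R} z (\<lambda>s. - \<kappa>\<^sup>2 * complex_of_real (\<epsilon> s) * y s)"
    unfolding primitive_on_def
  proof (intro ballI impI)
    fix a b assume ab: "a \<in> {-R..R}" "b \<in> {-R..R}" "a \<le> b"
    let ?w = "\<lambda>t. of_real (\<epsilon> t) * y t"
    have ib: "?w integrable_on {-R..b}" by (rule int[OF \<epsilon>p ab(2) cy])
    have "integral {-R..a} ?w + integral {a..b} ?w = integral {-R..b} ?w"
      using ab by (intro Henstock_Kurzweil_Integration.integral_combine ib) auto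
    moreover have "z a - z (- R) + \<kappa>\<^sup>2 * integral {-R..a} ?w = 0" "z b - z (- R) + \<kappa>\<^sup>2 * integral {-R..b} ?w = 0"
      using res0[OF ab(1)] res0[OF ab(2)] unfolding res_def .
    ultimately have e: "- \<kappa>\<^sup>2 * integral {a..b} ?w = z b - z a"
      by (rule alg)
    have "?w integrable_on {a..b}" by (rule integrable_on_subinterval[OF ib]) (use ab in auto)
    then have "((\<lambda>t. - \<kappa>\<^sup>2 * ?w t) has_integral - \<kappa>\<^sup>2 * integral {a..b} ?w) {a..b}"
      by (intro has_integral_mult_right integrable_integral)
    then show "((\<lambda>s. - \<kappa>\<^sup>2 * complex_of_real (\<epsilon> s) * y s) has_integral z b - z a) {a..b}"
      unfolding e by (simp only: mult.assoc)
  qed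
  show ?thesis
    using \<epsilon>p py pz y0 z0 zR pary unfolding helmholtz_on_def by blast
qed

section \<open>Symmetric structures with a prescribed resonance\<close>

text \<open>As \<open>s\<close> increases, \<open>exp (\<mu> s)\<close> spirals into the origin, whereas \<open>G\<close> leaves the origin along a
  straight direction \<open>g0\<close>; a ray from the origin meets every turn of the spiral.  Quantitatively, the
  equation of moduli determines \<open>s\<close> in terms of \<open>t\<close>; after this substitution the difference of the
  arguments is a continuous function of \<open>t\<close> that is unbounded near 0, so by the intermediate value
  theorem it attains a multiple of \<open>2 \<pi>\<close>.\<close>

lemma spiral_meets_curve:
  fixes G :: "real \<Rightarrow> complex" and \<mu> g0 :: complex
  assumes G: "((\<lambda>t. G t / of_real t) \<longlongrightarrow> g0) (at_right 0)" "g0 \<noteq> 0"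
    and cont: "0 < t0" "continuous_on {0<..<t0} G"
    and \<mu>: "Re \<mu> < 0" "Im \<mu> \<noteq> 0"
  obtains s t where "0 < s" "0 < t" "t < t0" "exp (\<mu> * of_real s) = G t"
proof -
  \<comment> \<open>\<open>q\<close> tends to 1, so its principal logarithm is continuous near 0 and has bounded imaginary part.\<close>
  define q where "q t = G t / (of_real t * g0)" for t
  have "((\<lambda>t. G t / of_real t / g0) \<longlongrightarrow> g0 / g0) (at_right 0)"
    using G by (intro tendsto_divide tendsto_const)
  then have "(q \<longlongrightarrow> 1) (at_right 0)" using G(2) by (simp add: q_def[abs_def])
  then have ev1: "eventually (\<lambda>t. dist (q t) 1 < 1) (at_right 0)" by (rule tendstoD) simp
  have ev0: "eventually (\<lambda>t. 0 < t) (at_right (0::real))" by (simp add: eventually_at_right_less)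
  have "((\<lambda>t. of_real t * (G t / of_real t)) \<longlongrightarrow> of_real 0 * g0) (at_right 0)"
    by (intro tendsto_mult tendsto_of_real tendsto_ident_at G(1))
  then have "((\<lambda>t. of_real t * (G t / of_real t)) \<longlongrightarrow> 0) (at_right 0)" by simp
  moreover have "eventually (\<lambda>t. of_real t * (G t / of_real t) = G t) (at_right 0)"
    using ev0 by eventually_elim simp
  ultimately have Gt: "(G \<longlongrightarrow> 0) (at_right 0)" by (rule Lim_transform_eventually)
  then have ev2: "eventually (\<lambda>t. dist (G t) 0 < 1) (at_right 0)" by (rule tendstoD) simp
  have "eventually (\<lambda>t. t < t0) (at_right (0::real))"
    unfolding eventually_at_right_field using cont(1) by blast
  with ev1 ev2 ev0 have "eventually (\<lambda>t. dist (q t) 1 < 1 \<and> dist (G t) 0 < 1 \<and> t < t0 \<and> 0 < t) (at_right 0)"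
    by eventually_elim blast
  then obtain b where b: "b > 0"
    and good: "\<And>t. 0 < t \<Longrightarrow> t < b \<Longrightarrow> dist (q t) 1 < 1 \<and> norm (G t) < 1 \<and> t < t0"
    unfolding eventually_at_right_field by auto
  have G_eq: "G t = of_real t * g0 * q t" if "0 < t" for t
    using that G(2) by (simp add: q_def)
  have qpos: "q t \<notin> \<real>\<^sub>\<le>\<^sub>0" "q t \<noteq> 0" if "0 < t" "t < b" for t
  proof -
    have "Re (q t) > 0"
      using good[OF that, THEN conjunct1] abs_Re_le_cmod[of "q t - 1"] unfolding dist_norm by simp
    then show "q t \<notin> \<real>\<^sub>\<le>\<^sub>0" "q t \<noteq> 0" by (auto simp: complex_nonpos_Reals_iff)
  qed
  have Gnz: "G t \<noteq> 0" if "0 < t" "t < b" for t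
    using G_eq[OF that(1)] qpos(2)[OF that] that G(2) by simp
  define \<theta> where "\<theta> t = Im \<mu> / Re \<mu> * ln (norm (G t)) - Im (Ln (q t))" for t
  have c\<theta>: "continuous_on {0<..<b} \<theta>"
  proof -
    have cG: "continuous_on {0<..<b} G"
      by (rule continuous_on_subset[OF cont(2)]) (use good in auto)
    then have "continuous_on {0<..<b} q"
      unfolding q_def using G(2) by (intro continuous_intros) auto
    then show ?thesis
      unfolding \<theta>_def using cG Gnz qpos by (intro continuous_intros continuous_on_Ln) auto
  qed
  have Im_le: "\<bar>Im (Ln (q t))\<bar> \<le> pi" if "0 < t" "t < b" for t
    using mpi_less_Im_Ln[OF qpos(2)[OF that]] Im_Ln_le_pi[OF qpos(2)[OF that]] by linarith
  define t1 where "t1 = b / 2"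
  have t1: "0 < t1" "t1 < b" using b by (auto simp: t1_def)
  define a where "a = Im \<mu> / Re \<mu>"
  have a: "a \<noteq> 0" using \<mu> by (simp add: a_def)
  \<comment> \<open>As \<open>ln (norm (G t))\<close> is unbounded near 0, \<open>\<theta>\<close> covers an interval of length \<open>2 \<pi>\<close>.\<close>
  obtain t2 where t2: "0 < t2" "t2 < b" "\<bar>\<theta> t2 - \<theta> t1\<bar> \<ge> 2 * pi"
  proof -
    \<comment> \<open>One \<open>\<pi>\<close> compensates the imaginary part of the logarithm.\<close>
    define B where "B = (2 * pi + pi + \<bar>\<theta> t1\<bar>) / \<bar>a\<bar>"
    have "eventually (\<lambda>t. dist (G t) 0 < exp (- B)) (at_right 0)" by (rule tendstoD[OF Gt]) simp
    moreover have "eventually (\<lambda>t. 0 < t \<and> t < b) (at_right 0)"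
      unfolding eventually_at_right_field using b by blast
    ultimately have "eventually (\<lambda>t. dist (G t) 0 < exp (- B) \<and> 0 < t \<and> t < b) (at_right 0)"
      by eventually_elim auto
    then obtain t where t: "norm (G t) < exp (- B)" "0 < t" "t < b"
      using eventually_happens'[OF trivial_limit_at_right_real] by auto
    have "ln (norm (G t)) < - B" using t Gnz[OF t(2,3)] by (metis ln_exp ln_less_cancel_iff exp_gt_zero zero_less_norm_iff)
    then have "\<bar>a\<bar> * B \<le> \<bar>a\<bar> * \<bar>ln (norm (G t))\<bar>" by (intro mult_left_mono) auto
    then have "2 * pi + pi + \<bar>\<theta> t1\<bar> \<le> \<bar>a * ln (norm (G t))\<bar>" using a by (simp add: B_def abs_mult)
    moreover have "\<theta> t = a * ln (norm (G t)) - Im (Ln (q t))" by (simp add: \<theta>_def a_def)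
    ultimately have "\<bar>\<theta> t - \<theta> t1\<bar> \<ge> 2 * pi" using Im_le[OF t(2,3)] by linarith
    with t show thesis using that by blast
  qed
  define lo where "lo = min (\<theta> t1) (\<theta> t2)"
  \<comment> \<open>The representative of \<open>Arg g0\<close> modulo \<open>2 \<pi>\<close> in that interval.\<close>
  define j where "j = \<lceil>(lo - Arg g0) / (2 * pi)\<rceil>"
  define v where "v = Arg g0 + 2 * pi * of_int j"
  have "(lo - Arg g0) / (2 * pi) \<le> of_int j" "of_int j < (lo - Arg g0) / (2 * pi) + 1"
    unfolding j_def by linarith+
  then have "lo \<le> v" "v \<le> lo + 2 * pi" by (simp_all add: v_def field_simps)
  moreover have "lo + 2 * pi \<le> max (\<theta> t1) (\<theta> t2)" using t2(3) by (auto simp: lo_def)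
  ultimately have v: "v \<in> {min (\<theta> t1) (\<theta> t2)..max (\<theta> t1) (\<theta> t2)}" by (simp add: lo_def)
  have "connected (\<theta> ` {0<..<b})"
    by (intro connected_continuous_image c\<theta>) (simp add: connected_Ioo)
  then have "{min (\<theta> t1) (\<theta> t2)..max (\<theta> t1) (\<theta> t2)} \<subseteq> \<theta> ` {0<..<b}"
    by (rule connected_contains_Icc) (use t1 t2 in \<open>auto simp: min_def max_def\<close>)
  with v have "v \<in> \<theta> ` {0<..<b}" by (rule subsetD[rotated])
  then obtain t where t: "0 < t" "t < b" "\<theta> t = v" by auto
  define s where "s = ln (norm (G t)) / Re \<mu>"
  have nG: "0 < norm (G t)" "norm (G t) < 1" using Gnz[OF t(1,2)] good[OF t(1,2)] by auto
  have "s > 0" using nG \<mu>(1) by (simp add: s_def divide_neg_neg)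
  moreover have "exp (\<mu> * of_real s) = G t"
  proof -
    have "norm (q t) * (t * norm g0) = norm (G t)" using t(1) G_eq[OF t(1)] by (simp add: norm_mult)
    have "exp (\<mu> * of_real s) = exp (of_real (Re \<mu> * s) + \<i> * of_real (Im \<mu> * s))"
      by (rule arg_cong[of _ _ exp]) (simp add: complex_eq_iff)
    also have "\<dots> = of_real (norm (G t)) * exp (\<i> * of_real (Im \<mu> * s))"
      using nG \<mu>(1) by (simp add: exp_add s_def exp_of_real)
    also have "Im \<mu> * s = v + Im (Ln (q t))"
      using t(3) by (simp add: s_def \<theta>_def)
    also have "exp (\<i> * of_real (v + Im (Ln (q t)))) = exp (\<i> * of_real (Arg g0)) * exp (\<i> * of_real (Im (Ln (q t))))"
    proof -
      have "\<i> * of_real (v + Im (Ln (q t))) = (\<i> * of_real (Arg g0) + \<i> * of_real (Im (Ln (q t)))) + 2 * of_int j * of_real pi * \<i>"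
        by (simp add: v_def algebra_simps)
      moreover have "exp (2 * of_int j * of_real pi * \<i>) = 1"
        using exp_integer_2pi[of "of_int j"] by simp
      ultimately show ?thesis by (simp only: exp_add mult_1_right)
    qed
    also have "of_real (norm (G t)) * (exp (\<i> * of_real (Arg g0)) * exp (\<i> * of_real (Im (Ln (q t))))) = G t"
    proof -
      have 1: "of_real (norm g0) * exp (\<i> * of_real (Arg g0)) = g0"
        using rcis_cmod_Arg[of g0] by (simp add: rcis_def cis_conv_exp)
      have 2: "of_real (norm (q t)) * exp (\<i> * of_real (Im (Ln (q t)))) = q t"
        using rcis_cmod_Arg[of "q t"] qpos(2)[OF t(1,2)] by (simp add: rcis_def cis_conv_exp Arg_eq_Im_Ln)
      have "of_real (norm (G t)) * (exp (\<i> * of_real (Arg g0)) * exp (\<i> * of_real (Im (Ln (q t)))))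
          = of_real t * (of_real (norm g0) * exp (\<i> * of_real (Arg g0))) * (of_real (norm (q t)) * exp (\<i> * of_real (Im (Ln (q t)))))"
        using t(1) G_eq[OF t(1)] by (simp add: norm_mult)
      then show ?thesis unfolding 1 2 using G_eq[OF t(1)] by simp
    qed
    finally show ?thesis .
  qed
  ultimately show thesis using that[of s t] t good[OF t(1,2)] by blast
qed

lemma helmholtz_on_add:
  assumes "helmholtz_on I \<kappa> \<epsilon> y z" "helmholtz_on I \<kappa> \<epsilon> y' z'"
  shows "helmholtz_on I \<kappa> \<epsilon> (\<lambda>s. y s + y' s) (\<lambda>s. z s + z' s)"
proof -
  have "(\<lambda>s. - \<kappa>\<^sup>2 * complex_of_real (\<epsilon> s) * (y s + y' s))
      = (\<lambda>s. - \<kappa>\<^sup>2 * complex_of_real (\<epsilon> s) * y s + - \<kappa>\<^sup>2 * complex_of_real (\<epsilon> s) * y' s)"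
    by (simp only: distrib_left)
  then show ?thesis
    using assms primitive_on_add[of I y z y' z']
      primitive_on_add[of I z "\<lambda>s. - \<kappa>\<^sup>2 * complex_of_real (\<epsilon> s) * y s" z' "\<lambda>s. - \<kappa>\<^sup>2 * complex_of_real (\<epsilon> s) * y' s"]
    unfolding helmholtz_on_def by simp
qed

text \<open>The equation that expresses resonance for a central layer of index \<open>n\<close> and half-width \<open>s\<close>
  between two layers of index \<open>n'\<close> and width \<open>t\<close>.  Solved for its first factor it reads
  \<open>exp (\<mu> s) = G t\<close> with \<open>\<mu> = - 2 \<i> \<kappa> n\<close>.  The hypotheses on \<open>\<kappa>\<close> say that \<open>exp (\<mu> s)\<close> is a genuine
  spiral into the origin, and \<open>n' \<noteq> n\<close> gives \<open>G\<close> a nonzero derivative at 0.\<close>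

lemma resonance_condition_solvable:
  fixes \<kappa> \<sigma> :: complex and n n' :: real
  assumes n: "0 < n" "0 < n'" "n' \<noteq> n" and \<kappa>: "Im \<kappa> < 0" "Re \<kappa> \<noteq> 0" and \<sigma>: "\<sigma>\<^sup>2 = 1"
  obtains s t where "0 < s" "0 < t"
    "exp (- (2 * \<i> * \<kappa> * of_real n * of_real s)) * (of_real ((n' + n)\<^sup>2) - of_real ((n' - n)\<^sup>2) * exp (2 * \<i> * \<kappa> * of_real n' * of_real t))
      = \<sigma> * of_real ((n' - n) * (n' + n)) * (exp (2 * \<i> * \<kappa> * of_real n' * of_real t) - 1)"
proof -
  define c where "c = 2 * \<i> * \<kappa> * of_real n'"
  define \<mu> where "\<mu> = - (2 * \<i> * \<kappa> * of_real n)"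
  define a where "a = complex_of_real ((n' + n)\<^sup>2)"
  define d where "d = complex_of_real ((n' - n)\<^sup>2)"
  define b where "b = \<sigma> * of_real ((n' - n) * (n' + n))"
  define Q where "Q t = a - d * exp (c * of_real t)" for t
  define G where "G t = b * (exp (c * of_real t) - 1) / Q t" for t
  have ad: "a - d = of_real (4 * n * n')" by (simp add: a_def d_def power2_eq_square algebra_simps)
  then have ad0: "a - d \<noteq> 0" using n by simp
  have \<sigma>0: "\<sigma> \<noteq> 0" using \<sigma> by auto
  have "(n' - n) * (n' + n) \<noteq> 0" using n by simp
  then have b0: "b \<noteq> 0" unfolding b_def using \<sigma>0 by (simp only: mult_eq_0_iff of_real_eq_0_iff simp_thms)
  have \<kappa>0: "\<kappa> \<noteq> 0" using \<kappa> by auto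
  have c0: "c \<noteq> 0" using n \<kappa>0 by (simp add: c_def)
  have lim_exp: "((\<lambda>t. (exp (c * of_real t) - 1) / of_real t) \<longlongrightarrow> c) (at_right (0::real))"
  proof -
    have "((\<lambda>z. exp (c * z)) has_field_derivative c) (at 0)"
      by (auto intro!: derivative_eq_intros)
    then have D: "((\<lambda>h. (exp (c * h) - 1) / h) \<longlongrightarrow> c) (at 0)"
      by (simp add: DERIV_def)
    have "filterlim complex_of_real (at 0) (at_right 0)"
    proof (rule filterlim_atI)
      show "(complex_of_real \<longlongrightarrow> 0) (at_right 0)"
        using tendsto_of_real[OF tendsto_ident_at[of 0 "{0<..}"], where 'a=complex] by simp
      show "\<forall>\<^sub>F x in at_right 0. complex_of_real x \<noteq> 0"
        unfolding eventually_at_right_field by (intro exI[of _ 1]) auto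
    qed
    from filterlim_compose[OF D this] show ?thesis .
  qed
  have Q_lim: "(Q \<longlongrightarrow> a - d) (at_right 0)"
  proof -
    have "((\<lambda>t. a - d * exp (c * of_real t)) \<longlongrightarrow> a - d * exp (c * of_real 0)) (at_right (0::real))"
      by (intro tendsto_intros)
    then show ?thesis by (simp add: Q_def[abs_def])
  qed
  have G_lim: "((\<lambda>t. G t / of_real t) \<longlongrightarrow> b * c / (a - d)) (at_right 0)"
  proof -
    have "((\<lambda>t. b * ((exp (c * of_real t) - 1) / of_real t) / Q t) \<longlongrightarrow> b * c / (a - d)) (at_right 0)"
      by (intro tendsto_intros lim_exp Q_lim ad0)
    then show ?thesis by (simp add: G_def mult.commute)
  qed
  have "eventually (\<lambda>t. dist (Q t) (a - d) < norm (a - d)) (at_right 0)"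
    by (rule tendstoD[OF Q_lim]) (use ad0 in simp)
  then obtain t0 where t0: "t0 > 0" "\<And>t. 0 < t \<Longrightarrow> t < t0 \<Longrightarrow> dist (Q t) (a - d) < norm (a - d)"
    unfolding eventually_at_right_field by blast
  have Q0: "Q t \<noteq> 0" if "0 < t" "t < t0" for t
    using t0(2)[OF that] by (auto simp: dist_norm norm_minus_commute)
  have cont: "continuous_on {0<..<t0} G"
    unfolding G_def using Q0 unfolding Q_def by (intro continuous_intros) auto
  have \<mu>: "Re \<mu> < 0" "Im \<mu> \<noteq> 0"
    using n \<kappa> by (simp_all add: \<mu>_def mult_neg_pos mult_pos_neg)
  have "b * c / (a - d) \<noteq> 0" using b0 c0 ad0 by simp
  from spiral_meets_curve[OF G_lim this t0(1) cont \<mu>]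
  obtain s t where st: "0 < s" "0 < t" "t < t0" "exp (\<mu> * of_real s) = G t" .
  have "exp (\<mu> * of_real s) * Q t = b * (exp (c * of_real t) - 1)"
    unfolding st(4) G_def using Q0[OF st(2,3)] by simp
  then show thesis
    using that[OF st(1,2)] unfolding \<mu>_def Q_def a_def b_def c_def d_def mult_minus_left by blast
qed

text \<open>Here \<open>\<epsilon> = n\<^sup>2\<close> for \<open>\<bar>x\<bar> \<le> s\<close> and outside \<open>{-R..R}\<close>, and \<open>\<epsilon> = n'\<^sup>2\<close> in between.  The solution of
  parity \<open>\<sigma>\<close> in the central layer is continued into the layer \<open>{s..R}\<close>; the outgoing condition at \<open>R\<close>
  is then the equation for \<open>s\<close> and \<open>t\<close> solved above.\<close>

lemma symmetric_resonator_exists: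
  fixes \<kappa> \<sigma> :: complex and n n' :: real
  assumes n: "0 < n" "0 < n'" "n' \<noteq> n" and \<kappa>: "Im \<kappa> < 0" "Re \<kappa> \<noteq> 0" and \<sigma>: "\<sigma>\<^sup>2 = 1"
    and lu: "l \<le> n\<^sup>2" "l \<le> n'\<^sup>2" "n\<^sup>2 \<le> u" "n'\<^sup>2 \<le> u"
  obtains R \<epsilon> y z s0 where "0 < R" "profile l u (n\<^sup>2) True R \<epsilon>" "helmholtz_on {-R..R} \<kappa> \<epsilon> y z"
    "z (- R) = - (\<i> * \<kappa> * of_real n) * y (- R)" "z R = (\<i> * \<kappa> * of_real n) * y R"
    "s0 \<in> {-R..R}" "y s0 \<noteq> 0" "\<And>s. s \<in> {-R..R} \<Longrightarrow> y (- s) = \<sigma> * y s"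
proof -
  obtain s t where s: "0 < s" and t: "0 < t"
    and st: "exp (- (2 * \<i> * \<kappa> * of_real n * of_real s)) * (of_real ((n' + n)\<^sup>2) - of_real ((n' - n)\<^sup>2) * exp (2 * \<i> * \<kappa> * of_real n' * of_real t))
      = \<sigma> * of_real ((n' - n) * (n' + n)) * (exp (2 * \<i> * \<kappa> * of_real n' * of_real t) - 1)"
    using resonance_condition_solvable[OF n \<kappa> \<sigma>] .
  define R where "R = s + t"
  define k where "k = \<i> * \<kappa> * of_real n"
  define k' where "k' = \<i> * \<kappa> * of_real n'"
  define w where "w = exp (- (2 * k * of_real s))"
  define E where "E = exp (k' * of_real t)"
  define F where "F = exp (- k' * of_real t)"
  have \<sigma>\<sigma>: "\<sigma> * \<sigma> = 1" using \<sigma> by (simp add: power2_eq_square)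
  have EF: "E * F = 1" by (simp add: E_def F_def exp_minus)
  have "exp (2 * \<i> * \<kappa> * of_real n' * of_real t) = E * E"
    unfolding E_def exp_add[symmetric] k'_def by (rule arg_cong[of _ _ exp]) simp
  moreover have "exp (- (2 * \<i> * \<kappa> * of_real n * of_real s)) = w"
    unfolding w_def k_def by (rule arg_cong[of _ _ exp]) simp
  ultimately have cond: "w * (of_real ((n' + n)\<^sup>2) - of_real ((n' - n)\<^sup>2) * (E * E))
      = \<sigma> * of_real ((n' - n) * (n' + n)) * (E * E - 1)"
    using st by simp
  define N where "N = complex_of_real n"
  define N' where "N' = complex_of_real n'"
  have N'0: "N' \<noteq> 0" using n by (simp add: N'_def)
  define D where "D = N' - N"
  define S where "S = N' + N"
  have cond': "w * (S * S - D * D * (E * E)) = \<sigma> * (D * S) * (E * E - 1)"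
    using cond by (simp add: S_def D_def N_def N'_def power2_eq_square)
  \<comment> \<open>\<open>A\<close> and \<open>B\<close> are determined by the values of \<open>y1\<close> and its derivative at \<open>s\<close>.\<close>
  define A where "A = (S + \<sigma> * w * D) / (2 * N')"
  define B where "B = (D + \<sigma> * w * S) / (2 * N')"
  have AB: "A + B = 1 + \<sigma> * w" "N' * (A - B) = N * (1 - \<sigma> * w)"
    using N'0 by (simp_all add: A_def B_def S_def D_def field_simps)
  have out: "N' * (A * E - B * F) = N * (A * E + B * F)"
  proof -
    have "D * (S + \<sigma> * w * D) * (E * E) - S * (D + \<sigma> * w * S)
        = D * S * (E * E - 1) - \<sigma> * (w * (S * S - D * D * (E * E)))"
      by (simp add: algebra_simps)
    also have "\<dots> = 0" unfolding cond' using \<sigma>\<sigma> by (simp add: mult.assoc[symmetric])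
    finally have "D * (S + \<sigma> * w * D) * (E * E) = S * (D + \<sigma> * w * S)" by simp
    then have "D * (S + \<sigma> * w * D) * (E * E) * F = S * (D + \<sigma> * w * S) * F" by simp
    moreover have "D * (S + \<sigma> * w * D) * (E * E) * F = D * (S + \<sigma> * w * D) * E"
      using EF by (simp add: mult.assoc)
    ultimately have "D * (S + \<sigma> * w * D) * E = S * (D + \<sigma> * w * S) * F" by simp
    then have "D * (A * E) = S * (B * F)" using N'0 by (simp add: A_def B_def mult.assoc)
    then show ?thesis by (simp add: D_def S_def algebra_simps)
  qed
  \<comment> \<open>The phase is normalized at \<open>s\<close>; with the factor \<open>w\<close> the solution \<open>y1\<close> has parity \<open>\<sigma>\<close> about 0.\<close>
  define y1 where "y1 x = 1 * exp (k * of_real (x - s)) + \<sigma> * w * exp (- k * of_real (x - s))" for x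
  define z1 where "z1 x = k * (1 * exp (k * of_real (x - s))) + - k * (\<sigma> * w * exp (- k * of_real (x - s)))" for x
  define y2 where "y2 x = A * exp (k' * of_real (x - s)) + B * exp (- k' * of_real (x - s))" for x
  define z2 where "z2 x = k' * (A * exp (k' * of_real (x - s))) + - k' * (B * exp (- k' * of_real (x - s)))" for x
  have k2: "k\<^sup>2 = - (\<kappa> * of_real n)\<^sup>2" "(- k)\<^sup>2 = - (\<kappa> * of_real n)\<^sup>2"
      "k'\<^sup>2 = - (\<kappa> * of_real n')\<^sup>2" "(- k')\<^sup>2 = - (\<kappa> * of_real n')\<^sup>2"
    by (simp_all add: k_def k'_def power_mult_distrib)
  have h1: "helmholtz_on {-s..s} \<kappa> (\<lambda>_. n\<^sup>2) y1 z1"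
    unfolding y1_def z1_def
    by (rule helmholtz_on_add[OF helmholtz_on_exp[OF k2(1)] helmholtz_on_exp[OF k2(2)]]) (rule is_interval_cc)+
  have h2: "helmholtz_on {s..R} \<kappa> (\<lambda>_. n'\<^sup>2) y2 z2"
    unfolding y2_def z2_def
    by (rule helmholtz_on_add[OF helmholtz_on_exp[OF k2(3)] helmholtz_on_exp[OF k2(4)]]) (rule is_interval_cc)+
  have match: "y2 s = y1 s" "z2 s = z1 s"
  proof -
    show "y2 s = y1 s" using AB(1) by (simp add: y1_def y2_def)
    have "z2 s = \<i> * \<kappa> * (N' * (A - B))" by (simp add: z2_def k'_def N'_def algebra_simps)
    also have "\<dots> = z1 s" unfolding AB(2) by (simp add: z1_def k_def N_def algebra_simps)
    finally show "z2 s = z1 s" .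
  qed
  have e: "w * exp (- k * of_real (x - s)) = exp (k * of_real (- x - s))" for x
    unfolding w_def exp_add[symmetric] by (rule arg_cong[of _ _ exp]) (simp add: algebra_simps)
  have par1: "y1 (- x) = \<sigma> * y1 x" for x
  proof -
    have "y1 (- x) = exp (k * of_real (- x - s)) + \<sigma> * exp (k * of_real (x - s))"
      using e[of "- x"] by (simp add: y1_def mult.assoc)
    also have "\<dots> = \<sigma> * (exp (k * of_real (x - s)) + \<sigma> * exp (k * of_real (- x - s)))"
      by (simp only: distrib_left mult.assoc[symmetric] \<sigma>\<sigma> mult_1_left add.commute)
    also have "\<dots> = \<sigma> * y1 x" unfolding y1_def e[symmetric] by (simp add: mult.assoc)
    finally show ?thesis .
  qed
  have par1z: "z1 (- x) = - (\<sigma> * z1 x)" for x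
  proof -
    have "z1 (- x) = k * exp (k * of_real (- x - s)) - k * \<sigma> * exp (k * of_real (x - s))"
      using e[of "- x"] by (simp add: z1_def mult.assoc)
    also have "\<dots> = - (\<sigma> * (k * exp (k * of_real (x - s)) - k * \<sigma> * exp (k * of_real (- x - s))))"
      using \<sigma>\<sigma> by (simp add: right_diff_distrib mult_ac)
    also have "\<dots> = - (\<sigma> * z1 x)" unfolding z1_def e[symmetric] by (simp add: mult.assoc)
    finally show ?thesis .
  qed
  define \<epsilon> where "\<epsilon> x = (if s < \<bar>x\<bar> \<and> \<bar>x\<bar> \<le> R then n'\<^sup>2 else n\<^sup>2)" for x
  define y where "y x = (if x < - s then \<sigma> * y2 (- x) else if x \<le> s then y1 x else y2 x)" for x
  define z where "z x = (if x < - s then \<sigma> * - z2 (- x) else if x \<le> s then z1 x else z2 x)" for x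
  have sR: "s < R" using t by (simp add: R_def)
  have hM: "helmholtz_on {-s..s} \<kappa> \<epsilon> y z"
    by (rule helmholtz_on_cong_AE[OF is_interval_cc h1]) (auto simp: y_def z_def \<epsilon>_def intro!: AE_I2)
  have hR: "helmholtz_on {s..R} \<kappa> \<epsilon> y z"
  proof (rule helmholtz_on_cong_AE[OF is_interval_cc h2])
    show "AE x in lebesgue. x \<in> {s..R} \<longrightarrow> n'\<^sup>2 = \<epsilon> x"
      using AE_lebesgue_neq[of s] by eventually_elim (use s in \<open>auto simp: \<epsilon>_def\<close>)
    show "y2 x = y x" "z2 x = z x" if "x \<in> {s..R}" for x
      using that match s by (cases "x = s"; simp add: y_def z_def)+
  qed
  have "uminus ` {s..R} = {-R..-s}" by simp
  then have h3: "helmholtz_on {-R..-s} \<kappa> (\<lambda>_. n'\<^sup>2) (\<lambda>x. \<sigma> * y2 (- x)) (\<lambda>x. \<sigma> * - z2 (- x))"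
    using helmholtz_on_scale[OF helmholtz_on_reflect[OF h2], of \<sigma>] by simp
  have hL: "helmholtz_on {-R..-s} \<kappa> \<epsilon> y z"
  proof (rule helmholtz_on_cong_AE[OF is_interval_cc h3])
    show "AE x in lebesgue. x \<in> {-R..-s} \<longrightarrow> n'\<^sup>2 = \<epsilon> x"
      using AE_lebesgue_neq[of "- s"] by eventually_elim (use s in \<open>auto simp: \<epsilon>_def\<close>)
    show "\<sigma> * y2 (- x) = y x" "\<sigma> * - z2 (- x) = z x" if "x \<in> {-R..-s}" for x
      using that match par1[of s] par1z[of s] s by (cases "x = - s"; simp add: y_def z_def)+
  qed
  have e1: "{-R..s} \<inter> {..-s} = {-R..-s}" "{-R..s} \<inter> {-s..} = {-s..s}"
    "{-R..R} \<inter> {..s} = {-R..s}" "{-R..R} \<inter> {s..} = {s..R}" using s sR by auto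
  have "helmholtz_on {-R..s} \<kappa> \<epsilon> y z"
    by (rule helmholtz_on_glue[where c="-s"]) (use hL hM s sR e1 in auto)
  then have H: "helmholtz_on {-R..R} \<kappa> \<epsilon> y z"
    by (intro helmholtz_on_glue[where c="s" and I="{-R..R}"]) (use hR s sR e1 in auto)
  have prof: "profile l u (n\<^sup>2) True R \<epsilon>"
    unfolding profile_def
  proof (intro conjI allI impI)
    have [measurable]: "(\<lambda>x::real. \<bar>x\<bar>) \<in> borel_measurable lebesgue"
      by (intro continuous_imp_lebesgue_measurable continuous_intros)
    show "\<epsilon> \<in> borel_measurable lebesgue" unfolding \<epsilon>_def[abs_def] by measurable
  qed (use lu in \<open>auto simp: \<epsilon>_def\<close>)
  have R_val: "y R = A * E + B * F" "z R = k' * (A * E) + - k' * (B * F)"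
    using s sR by (simp_all add: y_def z_def y2_def z2_def R_def E_def F_def)
  have L_val: "y (- R) = \<sigma> * y R" "z (- R) = - \<sigma> * z R"
    using s sR by (simp_all add: y_def z_def)
  have bcR: "z R = k * y R"
  proof -
    have "z R = \<i> * \<kappa> * (N' * (A * E - B * F))" by (simp add: R_val k'_def N'_def algebra_simps)
    also have "\<dots> = k * y R" unfolding out R_val by (simp add: k_def N_def mult_ac)
    finally show ?thesis .
  qed
  have "norm w < 1"
  proof -
    have "Re (- (2 * k * of_real s)) < 0"
      using n s \<kappa> by (simp add: k_def mult_neg_pos mult_pos_neg)
    then show ?thesis unfolding w_def norm_exp_eq_Re by (simp only: exp_less_one_iff)
  qed
  then have "norm (\<sigma> * w) < 1" using \<sigma>\<sigma> by (metis norm_mult norm_one mult_1_left power2_eq_1_iff norm_minus_cancel power2_eq_square)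
  then have "\<sigma> * w \<noteq> - 1" by auto
  then have ys: "y s \<noteq> 0" using s by (simp add: y_def y1_def add_eq_0_iff)
  have par: "y (- x) = \<sigma> * y x" for x
  proof -
    have \<sigma>2: "\<sigma> * (\<sigma> * X) = X" for X using \<sigma>\<sigma> by (simp add: mult.assoc[symmetric])
    show ?thesis using s par1[of x] by (auto simp: y_def \<sigma>2)
  qed
  show thesis
  proof (rule that[of R \<epsilon> y z s])
    show "z (- R) = - (\<i> * \<kappa> * of_real n) * y (- R)" using L_val bcR by (simp add: k_def)
    show "z R = (\<i> * \<kappa> * of_real n) * y R" using bcR by (simp add: k_def)
  qed (use prof H ys par s sR in auto)
qed

section \<open>Length minimization\<close>

lemma AE_lebesgue_affine:
  assumes P: "AE s in lebesgue. P (s::real)" and c: "c \<noteq> 0"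
  shows "AE s in lebesgue. P (t + c * s)"
proof -
  from P have "AE s in lborel. P s" unfolding AE_completion_iff .
  then obtain N where N: "N \<in> null_sets lborel" "{s \<in> space lborel. \<not> P s} \<subseteq> N"
    unfolding eventually_ae_filter by (elim bexE)
  have "AE x in lborel. x \<notin> N" by (rule AE_not_in[OF N(1)])
  then have "AE x in density (distr lborel borel (\<lambda>x. t + c * x)) (\<lambda>_. ennreal \<bar>c\<bar>). x \<notin> N"
    by (subst (asm) lborel_real_affine[OF c, of t])
  then have 1: "AE x in distr lborel borel (\<lambda>x. t + c * x). x \<notin> N"
    by (subst (asm) AE_density) (use c in simp_all)
  have "AE x in lborel. t + c * x \<notin> N"
  proof (rule AE_distr_iff[THEN iffD1, OF _ _ 1])
    show "(\<lambda>x. t + c * x) \<in> lborel \<rightarrow>\<^sub>M borel" by simp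
    show "{x \<in> space borel. x \<notin> N} \<in> sets borel" using N(1) by auto
  qed
  then have "AE x in lborel. P (t + c * x)" by eventually_elim (use N(2) in auto)
  then show ?thesis by (rule AE_completion)
qed

lemma lebesgue_measurable_affine:
  fixes f :: "real \<Rightarrow> real"
  assumes f: "f \<in> borel_measurable lebesgue" and c: "c \<noteq> 0"
  shows "(\<lambda>s. f (t + c * s)) \<in> borel_measurable lebesgue"
proof -
  have "(\<lambda>s::real. t + c * s) \<in> lebesgue \<rightarrow>\<^sub>M lebesgue"
    using lebesgue_affine_measurable[of "\<lambda>_::real. c" t] c by simp
  from measurable_compose[OF this f] show ?thesis .
qed

lemma const_outside_AE_const:
  assumes "const_outside n \<epsilon> a b" "const_outside n \<epsilon> a' b'" "b' < a"
  shows "AE s in lebesgue. \<epsilon> s = n\<^sup>2"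
proof -
  have "AE s in lebesgue. s \<notin> {a..b} \<longrightarrow> \<epsilon> s = n\<^sup>2" "AE s in lebesgue. s \<notin> {a'..b'} \<longrightarrow> \<epsilon> s = n\<^sup>2"
    using assms by (simp_all only: const_outside_def)
  then show ?thesis by eventually_elim (use assms(3) in auto)
qed

lemma const_outside_combine:
  assumes "const_outside n \<epsilon> a b" "const_outside n \<epsilon> a' b'" "a \<le> b'"
  shows "const_outside n \<epsilon> a b'"
proof -
  have "AE s in lebesgue. s \<notin> {a..b} \<longrightarrow> \<epsilon> s = n\<^sup>2" "AE s in lebesgue. s \<notin> {a'..b'} \<longrightarrow> \<epsilon> s = n\<^sup>2"
    "a \<le> b" "a' \<le> b'"
    using assms by (simp_all only: const_outside_def)
  then have "AE s in lebesgue. s \<notin> {a..b'} \<longrightarrow> \<epsilon> s = n\<^sup>2" by (elim AE_mp) (intro AE_I2, auto)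
  then show ?thesis using assms(3) by (simp only: const_outside_def)
qed

lemma const_outside_limit:
  assumes "\<And>k. const_outside n \<epsilon> (a k) (b k)" "a \<longlonglongrightarrow> \<alpha>" "b \<longlonglongrightarrow> \<beta>"
  shows "const_outside n \<epsilon> \<alpha> \<beta>"
proof -
  have "a k \<le> b k" "AE s in lebesgue. s \<notin> {a k..b k} \<longrightarrow> \<epsilon> s = n\<^sup>2" for k
    using assms(1)[of k] by (simp_all only: const_outside_def)
  then have le: "\<And>k. a k \<le> b k" and "AE s in lebesgue. \<forall>k. s \<notin> {a k..b k} \<longrightarrow> \<epsilon> s = n\<^sup>2"
    unfolding AE_all_countable by blast+
  from this(2) have "AE s in lebesgue. s \<notin> {\<alpha>..\<beta>} \<longrightarrow> \<epsilon> s = n\<^sup>2"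
  proof eventually_elim
    case (elim s)
    show ?case
    proof
      assume "s \<notin> {\<alpha>..\<beta>}"
      then consider "s < \<alpha>" | "\<beta> < s" by force
      then have "\<exists>k. s \<notin> {a k..b k}"
      proof cases
        case 1
        from order_tendstoD(1)[OF assms(2) this] obtain k where "s < a k"
          unfolding eventually_sequentially by blast
        then show ?thesis by (intro exI[of _ k]) simp
      next
        case 2
        from order_tendstoD(2)[OF assms(3) this] obtain k where "b k < s"
          unfolding eventually_sequentially by blast
        then show ?thesis by (intro exI[of _ k]) simp
      qed
      with elim show "\<epsilon> s = n\<^sup>2" by blast
    qed
  qed
  moreover have "\<alpha> \<le> \<beta>" by (rule LIMSEQ_le[OF assms(2,3)]) (use le in blast)
  ultimately show ?thesis unfolding const_outside_def by blast
qed

text \<open>Unless \<open>\<epsilon>\<close> is constant almost everywhere, two intervals outside of which it equals \<open>n\<^sup>2\<close> intersect,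
  and the left end point of one may be combined with the right end point of the other.  The supremum of the left and the
  infimum of the right end points are therefore the end points of the least interval.\<close>

lemma shortest_interval_exists:
  assumes ex: "const_outside n \<epsilon> a0 b0" and nc: "\<not> (AE s in lebesgue. \<epsilon> s = n\<^sup>2)"
  shows "\<exists>\<alpha> \<beta>. const_outside n \<epsilon> \<alpha> \<beta> \<and>
    (\<forall>a b. const_outside n \<epsilon> a b \<longrightarrow> a \<le> \<alpha> \<and> \<beta> \<le> b) \<and> LL n \<epsilon> = \<beta> - \<alpha>"
proof -
  have ord: "a \<le> b'" if "const_outside n \<epsilon> a b" "const_outside n \<epsilon> a' b'" for a b a' b'
    using const_outside_AE_const[OF that] nc by force
  define A where "A = {a. \<exists>b. const_outside n \<epsilon> a b}"
  define B where "B = {b. \<exists>a. const_outside n \<epsilon> a b}"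
  have ne: "A \<noteq> {}" "B \<noteq> {}" using ex by (auto simp: A_def B_def)
  have AB: "const_outside n \<epsilon> a b" if ab: "a \<in> A" "b \<in> B" for a b
  proof -
    obtain b' a' where "const_outside n \<epsilon> a b'" "const_outside n \<epsilon> a' b"
      using ab unfolding A_def B_def by blast
    then show ?thesis using const_outside_combine ord by blast
  qed
  have bA: "bdd_above A" and bB: "bdd_below B"
    using AB ord ne unfolding bdd_above_def bdd_below_def by (meson ex_in_conv)+
  define \<alpha> where "\<alpha> = Sup A"
  define \<beta> where "\<beta> = Inf B"
  have "\<exists>x\<in>A. \<alpha> - 1 / real (Suc k) < x" "\<exists>x\<in>B. x < \<beta> + 1 / real (Suc k)" for k
    using less_cSupD[OF ne(1), of "\<alpha> - 1 / real (Suc k)"] cInf_lessD[OF ne(2), of "\<beta> + 1 / real (Suc k)"]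
    unfolding \<alpha>_def[symmetric] \<beta>_def[symmetric] by auto
  then obtain a b where a: "\<And>k. a k \<in> A" "\<And>k. \<alpha> - 1 / real (Suc k) < a k"
    and b: "\<And>k. b k \<in> B" "\<And>k. b k < \<beta> + 1 / real (Suc k)"
    by metis
  have le: "a k \<le> \<alpha>" "\<beta> \<le> b k" for k
    unfolding \<alpha>_def \<beta>_def using a(1) b(1) bA bB by (auto intro: cSup_upper cInf_lower)
  have l0: "(\<lambda>k. 1 / real (Suc k)) \<longlonglongrightarrow> 0" by (rule LIMSEQ_Suc[OF lim_1_over_n])
  have "a \<longlonglongrightarrow> \<alpha>"
  proof (rule tendsto_sandwich[of "\<lambda>k. \<alpha> - 1 / real (Suc k)" _ _ "\<lambda>_. \<alpha>"])
    show "(\<lambda>k. \<alpha> - 1 / real (Suc k)) \<longlonglongrightarrow> \<alpha>" using tendsto_diff[OF tendsto_const l0, of \<alpha>] by simp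
  qed (use a(2) le in \<open>auto intro!: always_eventually less_imp_le\<close>)
  moreover have "b \<longlonglongrightarrow> \<beta>"
  proof (rule tendsto_sandwich[of "\<lambda>_. \<beta>" _ _ "\<lambda>k. \<beta> + 1 / real (Suc k)"])
    show "(\<lambda>k. \<beta> + 1 / real (Suc k)) \<longlonglongrightarrow> \<beta>" using tendsto_add[OF tendsto_const l0, of \<beta>] by simp
  qed (use b(2) le in \<open>auto intro!: always_eventually less_imp_le\<close>)
  ultimately have out: "const_outside n \<epsilon> \<alpha> \<beta>"
    by (rule const_outside_limit[OF AB[OF a(1) b(1)]])
  have min: "a \<le> \<alpha> \<and> \<beta> \<le> b" if "const_outside n \<epsilon> a b" for a b
    unfolding \<alpha>_def \<beta>_def using that bA bB by (auto simp: A_def B_def intro!: cSup_upper cInf_lower)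
  have "(THE I. shortest_interval n \<epsilon> I) = (\<alpha>, \<beta>)"
  proof (rule the_equality)
    show "shortest_interval n \<epsilon> (\<alpha>, \<beta>)"
      unfolding shortest_interval_def is_arg_min_def using out min by (auto simp: not_less) (fastforce dest: min)
  next
    fix I assume I: "shortest_interval n \<epsilon> I"
    obtain p q where pq: "I = (p, q)" by (cases I)
    have "const_outside n \<epsilon> p q" "\<not> \<beta> - \<alpha> < q - p"
      using I out unfolding shortest_interval_def is_arg_min_def pq by auto
    with min[of p q] show "I = (\<alpha>, \<beta>)" by (auto simp: pq)
  qed
  then have "LL n \<epsilon> = \<beta> - \<alpha>" using nc unfolding LL_def by simp
  with out min show ?thesis by blast
qed

text \<open>For a symmetric \<open>\<epsilon>\<close> the reflected interval qualifies as well, so the least interval is its own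
  reflection.  In the constant case \<open>{0..0}\<close> serves.\<close>

lemma LL_attained:
  assumes ex: "const_outside n \<epsilon> a0 b0"
  shows "\<exists>\<alpha> \<beta>. const_outside n \<epsilon> \<alpha> \<beta> \<and> LL n \<epsilon> = \<beta> - \<alpha> \<and>
    ((AE s in lebesgue. \<epsilon> s = \<epsilon> (- s)) \<longrightarrow> \<alpha> = - \<beta>)"
proof (cases "AE s in lebesgue. \<epsilon> s = n\<^sup>2")
  case True
  then have "AE s in lebesgue. s \<notin> {0..0} \<longrightarrow> \<epsilon> s = n\<^sup>2" by eventually_elim blast
  then have "const_outside n \<epsilon> 0 0" unfolding const_outside_def by blast
  moreover have "LL n \<epsilon> = 0 - 0" unfolding LL_def by (simp only: True if_True diff_zero)
  ultimately show ?thesis by (intro exI[of _ 0] conjI impI) simp_all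
next
  case False
  obtain \<alpha> \<beta> where out: "const_outside n \<epsilon> \<alpha> \<beta>"
    and min: "\<forall>a b. const_outside n \<epsilon> a b \<longrightarrow> a \<le> \<alpha> \<and> \<beta> \<le> b" and LL: "LL n \<epsilon> = \<beta> - \<alpha>"
    using shortest_interval_exists[OF ex False] by (elim exE conjE) blast
  show ?thesis
  proof (intro exI conjI impI)
    show "const_outside n \<epsilon> \<alpha> \<beta>" "LL n \<epsilon> = \<beta> - \<alpha>" by (rule out, rule LL)
    assume s: "AE s in lebesgue. \<epsilon> s = \<epsilon> (- s)"
    have o: "AE s in lebesgue. s \<notin> {\<alpha>..\<beta>} \<longrightarrow> \<epsilon> s = n\<^sup>2" "\<alpha> \<le> \<beta>"
      using out by (simp_all only: const_outside_def)
    have "AE s in lebesgue. 0 + -1 * s \<notin> {\<alpha>..\<beta>} \<longrightarrow> \<epsilon> (0 + -1 * s) = n\<^sup>2"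
      by (rule AE_lebesgue_affine[OF o(1)]) simp
    with s have "AE s in lebesgue. s \<notin> {-\<beta>..-\<alpha>} \<longrightarrow> \<epsilon> s = n\<^sup>2"
    proof eventually_elim
      case (elim s)
      show ?case
      proof
        assume "s \<notin> {-\<beta>..-\<alpha>}"
        then have "0 + -1 * s \<notin> {\<alpha>..\<beta>}" by auto
        with elim(2) have "\<epsilon> (0 + -1 * s) = n\<^sup>2" by blast
        then have "\<epsilon> (- s) = n\<^sup>2" by (simp only: mult_minus_left mult_1_left add_0_left)
        with elim(1) show "\<epsilon> s = n\<^sup>2" by (rule trans)
      qed
    qed
    then have "const_outside n \<epsilon> (- \<beta>) (- \<alpha>)" using o(2) unfolding const_outside_def by (intro conjI) (simp, assumption)
    from min[rule_format, OF this] show "\<alpha> = - \<beta>" by linarith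
  qed
qed

lemma LL_le:
  assumes "const_outside n \<epsilon> a b"
  shows "LL n \<epsilon> \<le> b - a"
proof (cases "AE s in lebesgue. \<epsilon> s = n\<^sup>2")
  case True
  then have "LL n \<epsilon> = 0" unfolding LL_def by (simp only: if_True)
  moreover have "a \<le> b" using assms by (simp only: const_outside_def)
  ultimately show ?thesis by simp
next
  case False
  obtain \<alpha> \<beta> where "const_outside n \<epsilon> \<alpha> \<beta>"
    and min: "\<forall>a b. const_outside n \<epsilon> a b \<longrightarrow> a \<le> \<alpha> \<and> \<beta> \<le> b" and LL: "LL n \<epsilon> = \<beta> - \<alpha>"
    using shortest_interval_exists[OF assms False] by (elim exE conjE) blast
  show ?thesis using min[rule_format, OF assms] LL by linarith
qed

lemma FF_bounds:
  assumes "\<epsilon> \<in> FF n\<^sub>1 n\<^sub>2 n" "n\<^sub>1\<^sup>2 \<le> n\<^sup>2" "n\<^sup>2 \<le> n\<^sub>2\<^sup>2"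
  shows "AE s in lebesgue. n\<^sub>1\<^sup>2 \<le> \<epsilon> s \<and> \<epsilon> s \<le> n\<^sub>2\<^sup>2"
proof -
  obtain a b where out: "AE s in lebesgue. s \<notin> {a..b} \<longrightarrow> \<epsilon> s = n\<^sup>2"
    and ins: "AE s in lebesgue. s \<in> {a<..<b} \<longrightarrow> n\<^sub>1\<^sup>2 \<le> \<epsilon> s \<and> \<epsilon> s \<le> n\<^sub>2\<^sup>2"
    using assms(1) unfolding FF_def const_outside_def by blast
  from out ins AE_lebesgue_neq[of a] AE_lebesgue_neq[of b] show ?thesis
  proof eventually_elim
    case (elim s)
    consider "s \<notin> {a..b}" | "s \<in> {a<..<b}" using elim(3,4) by force
    then show ?case
    proof cases
      case 1
      with elim(1) have "\<epsilon> s = n\<^sup>2" by blast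
      with assms(2,3) show ?thesis by simp
    qed (use elim(2) in blast)
  qed
qed

lemma profile_imp_FF:
  assumes p: "profile (n\<^sub>1\<^sup>2) (n\<^sub>2\<^sup>2) (n\<^sup>2) symm r \<epsilon>" and n: "0 < n\<^sub>1" and r: "0 \<le> r"
  shows "const_outside n \<epsilon> (- r) r" "\<epsilon> \<in> FF n\<^sub>1 n\<^sub>2 n"
proof -
  have b: "n\<^sub>1\<^sup>2 \<le> \<epsilon> s" "\<epsilon> s \<le> n\<^sub>2\<^sup>2" for s using p by (auto simp: profile_def)
  have pos: "0 < \<epsilon> s" for s using b(1)[of s] n zero_less_power[of n\<^sub>1 2] by linarith
  have "\<epsilon> s = n\<^sup>2" if "s \<notin> {-r..r}" for s
    using p that unfolding profile_def by (auto simp: abs_less_iff)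
  then have "AE s in lebesgue. s \<notin> {-r..r} \<longrightarrow> \<epsilon> s = n\<^sup>2" by (intro AE_I2) blast
  with r show out: "const_outside n \<epsilon> (- r) r" unfolding const_outside_def by (intro conjI) (simp, assumption)
  have "\<bar>\<epsilon> s\<bar> \<le> n\<^sub>2\<^sup>2" for s using b(2)[of s] pos[of s] by linarith
  then have "AE s in lebesgue. \<bar>\<epsilon> s\<bar> \<le> n\<^sub>2\<^sup>2" by (intro AE_I2)
  then have "\<epsilon> \<in> Linf" using p unfolding Linf_def profile_def by blast
  moreover have "AE s in lebesgue. 0 < \<epsilon> s" by (intro AE_I2 pos)
  moreover have "AE s in lebesgue. s \<in> {-r<..<r} \<longrightarrow> n\<^sub>1\<^sup>2 \<le> \<epsilon> s \<and> \<epsilon> s \<le> n\<^sub>2\<^sup>2"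
    by (rule AE_I2) (use b in blast)
  ultimately show "\<epsilon> \<in> FF n\<^sub>1 n\<^sub>2 n" using out unfolding FF_def by blast
qed

text \<open>Averaging with the reflection, clamping to \<open>[l, u]\<close> and overwriting outside \<open>{-r..r}\<close> change
  \<open>\<epsilon>\<close> only on a null set.\<close>

lemma profile_representative:
  assumes meas: "\<epsilon> \<in> borel_measurable lebesgue"
    and bnd: "AE s in lebesgue. l \<le> \<epsilon> s \<and> \<epsilon> s \<le> u" and m: "l \<le> m" "m \<le> u"
    and out: "AE s in lebesgue. s \<notin> {-r..r} \<longrightarrow> \<epsilon> s = m"
    and sym: "symm \<Longrightarrow> AE s in lebesgue. \<epsilon> s = \<epsilon> (- s)"
  obtains \<epsilon>' where "profile l u m symm r \<epsilon>'" "AE s in lebesgue. \<epsilon> s = \<epsilon>' s"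
proof -
  define h where "h s = (if symm then (\<epsilon> s + \<epsilon> (0 + -1 * s)) / 2 else \<epsilon> s)" for s
  define \<epsilon>' where "\<epsilon>' s = (if \<bar>s\<bar> \<le> r then max l (min u (h s)) else m)" for s
  have [measurable]: "h \<in> borel_measurable lebesgue"
    using meas lebesgue_measurable_affine[OF meas, of "-1" 0] unfolding h_def[abs_def] by (cases symm) auto
  have [measurable]: "(\<lambda>s::real. \<bar>s\<bar>) \<in> borel_measurable lebesgue"
    by (intro continuous_imp_lebesgue_measurable continuous_intros)
  have "profile l u m symm r \<epsilon>'"
    unfolding profile_def
  proof (intro conjI allI impI)
    show "\<epsilon>' \<in> borel_measurable lebesgue" unfolding \<epsilon>'_def[abs_def] by measurable
    fix s
    show "l \<le> \<epsilon>' s" "\<epsilon>' s \<le> u" using m by (auto simp: \<epsilon>'_def)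
    show "\<epsilon>' s = m" if "r < \<bar>s\<bar>" using that by (simp add: \<epsilon>'_def)
    show "\<epsilon>' (- s) = \<epsilon>' s" if symm using that by (simp add: \<epsilon>'_def h_def add.commute)
  qed
  moreover have "AE s in lebesgue. h s = \<epsilon> s"
  proof (cases symm)
    case True
    from sym[OF this] show ?thesis
    proof eventually_elim
      case (elim s)
      have "h s = (\<epsilon> s + \<epsilon> (- s)) / 2" using True by (simp add: h_def)
      also have "\<dots> = (\<epsilon> s + \<epsilon> s) / 2" by (simp only: elim[symmetric])
      finally show ?case by simp
    qed
  qed (simp add: h_def)
  with bnd out have "AE s in lebesgue. \<epsilon> s = \<epsilon>' s"
  proof eventually_elim
    case (elim s)
    show ?case
    proof (cases "\<bar>s\<bar> \<le> r")
      case True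
      then show ?thesis using elim(1,3) by (simp add: \<epsilon>'_def)
    next
      case False
      then have "s \<notin> {-r..r}" by auto
      with elim(2) False show ?thesis by (simp add: \<epsilon>'_def)
    qed
  qed
  ultimately show thesis using that by blast
qed

text \<open>The four minimization problems at once: \<open>symm\<close> restricts to symmetric coefficients, and \<open>S\<close> is
  the set of eigenvalues that the mode is required to have under reflection, that is \<open>{}\<close>, \<open>{-1}\<close> for
  odd or \<open>{1}\<close> for even modes.\<close>

definition admissible ::
  "real \<Rightarrow> real \<Rightarrow> real \<Rightarrow> complex \<Rightarrow> bool \<Rightarrow> complex set \<Rightarrow> (real \<Rightarrow> real) \<Rightarrow> bool" where
  "admissible n\<^sub>1 n\<^sub>2 n \<kappa> symm S \<epsilon> \<longleftrightarrow> \<epsilon> \<in> FF n\<^sub>1 n\<^sub>2 n \<and> (symm \<longrightarrow> (AE s in lebesgue. \<epsilon> s = \<epsilon> (- s))) \<and>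
     (\<exists>y. is_mode n \<epsilon> \<kappa> y \<and> (\<forall>\<sigma>\<in>S. \<forall>s. y (- s) = \<sigma> * y s))"

text \<open>The problem is invariant under translations, so the shortest interval may be centred at the
  origin.  A prescribed parity is no obstacle, since for symmetric \<open>\<epsilon>\<close> the interval is centred
  already.\<close>

lemma admissible_centred:
  assumes adm: "admissible n\<^sub>1 n\<^sub>2 n \<kappa> symm S \<epsilon>" and S: "S \<noteq> {} \<Longrightarrow> symm"
    and n: "0 < n\<^sub>1" "n\<^sub>1\<^sup>2 \<le> n\<^sup>2" "n\<^sup>2 \<le> n\<^sub>2\<^sup>2" and \<kappa>: "\<kappa> \<noteq> 0" and R: "LL n \<epsilon> / 2 \<le> R"
  shows "\<exists>\<epsilon>' y z. profile (n\<^sub>1\<^sup>2) (n\<^sub>2\<^sup>2) (n\<^sup>2) symm (LL n \<epsilon> / 2) \<epsilon>' \<and> helmholtz_on {-R..R} \<kappa> \<epsilon>' y z \<and>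
      y (- R) = 1 \<and> z (- R) = - (\<i> * \<kappa> * of_real n) \<and> z R = (\<i> * \<kappa> * of_real n) * y R \<and>
      (\<forall>\<sigma>\<in>S. \<forall>s\<in>{-R..R}. y (- s) = \<sigma> * y s)"
proof -
  define r where "r = LL n \<epsilon> / 2"
  have FF: "\<epsilon> \<in> FF n\<^sub>1 n\<^sub>2 n" using adm unfolding admissible_def by blast
  obtain y where y: "is_mode n \<epsilon> \<kappa> y" and par: "\<forall>\<sigma>\<in>S. \<forall>s. y (- s) = \<sigma> * y s"
    using adm unfolding admissible_def by (elim conjE exE)
  obtain z a b where h: "helmholtz_on UNIV \<kappa> \<epsilon> y z" and ab: "const_outside n \<epsilon> a b"
    and bc: "z a = - (\<i> * \<kappa> * of_real n) * y a" "z b = (\<i> * \<kappa> * of_real n) * y b"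
    using is_mode_imp_helmholtz[OF y \<kappa>] .
  have "\<exists>s. y s \<noteq> 0" using y unfolding is_mode_def by (elim conjE)
  then obtain s0 where s0: "y s0 \<noteq> 0" ..
  obtain \<alpha> \<beta> where I: "const_outside n \<epsilon> \<alpha> \<beta>" "LL n \<epsilon> = \<beta> - \<alpha>"
    and Isym: "(AE s in lebesgue. \<epsilon> s = \<epsilon> (- s)) \<longrightarrow> \<alpha> = - \<beta>"
    using LL_attained[OF ab] by (elim exE conjE) blast
  define c where "c = (\<alpha> + \<beta>) / 2"
  have sm: "AE s in lebesgue. \<epsilon> s = \<epsilon> (- s)" if symm
    using adm that unfolding admissible_def by (elim conjE) (rule mp)
  have c0: "c = 0" if symm using mp[OF Isym sm[OF that]] by (simp add: c_def)
  have ends: "\<alpha> = c - r" "\<beta> = c + r" using I(2) by (simp_all add: c_def r_def field_simps)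
  define e where "e s = \<epsilon> (c + 1 * s)" for s
  have em: "e \<in> borel_measurable lebesgue"
    using FF unfolding e_def[abs_def] FF_def Linf_def by (intro lebesgue_measurable_affine) auto
  have eb: "AE s in lebesgue. n\<^sub>1\<^sup>2 \<le> e s \<and> e s \<le> n\<^sub>2\<^sup>2"
    unfolding e_def by (rule AE_lebesgue_affine[OF FF_bounds[OF FF n(2,3)]]) simp
  have out_shift: "const_outside n e (p - c) (q - c)" if "const_outside n \<epsilon> p q" for p q
  proof -
    have "AE s in lebesgue. s \<notin> {p..q} \<longrightarrow> \<epsilon> s = n\<^sup>2" "p \<le> q" using that by (simp_all only: const_outside_def)
    from AE_lebesgue_affine[OF this(1), of 1 c]
    have "AE s in lebesgue. c + 1 * s \<notin> {p..q} \<longrightarrow> e s = n\<^sup>2" unfolding e_def by simp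
    then have "AE s in lebesgue. s \<notin> {p - c..q - c} \<longrightarrow> e s = n\<^sup>2"
      by eventually_elim auto
    with \<open>p \<le> q\<close> show ?thesis unfolding const_outside_def by (intro conjI) (simp, assumption)
  qed
  have eo: "const_outside n e (- r) r" using out_shift[OF I(1)] by (simp add: ends)
  have es: "AE s in lebesgue. e s = e (- s)" if symm
    using sm[OF that] c0[OF that] unfolding e_def by simp
  have "AE s in lebesgue. s \<notin> {-r..r} \<longrightarrow> e s = n\<^sup>2" using eo by (simp only: const_outside_def)
  then obtain \<epsilon>' where p: "profile (n\<^sub>1\<^sup>2) (n\<^sub>2\<^sup>2) (n\<^sup>2) symm r \<epsilon>'" and ae: "AE s in lebesgue. e s = \<epsilon>' s"
    using profile_representative[OF em eb n(2,3) _ es] by blast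
  have h': "helmholtz_on UNIV \<kappa> e (\<lambda>s. y (s + c)) (\<lambda>s. z (s + c))"
    using helmholtz_on_translate[OF h, of c] unfolding e_def by (simp add: add.commute)
  obtain k where k: "helmholtz_on {-R..R} \<kappa> \<epsilon>' (\<lambda>s. k * y (s + c)) (\<lambda>s. k * z (s + c))" "k * y (- R + c) = 1"
    "k * z (- R + c) = - (\<i> * \<kappa> * of_real n)" "k * z (R + c) = (\<i> * \<kappa> * of_real n) * (k * y (R + c))"
  proof (rule helmholtz_normalize[OF h' out_shift[OF ab] _ _ _ eo _ ae])
    show "z (a - c + c) = - (\<i> * \<kappa> * of_real n) * y (a - c + c)"
      "z (b - c + c) = \<i> * \<kappa> * of_real n * y (b - c + c)" "y (s0 - c + c) \<noteq> 0"
      using bc s0 by simp_all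
    show "r \<le> R" using R by (simp add: r_def)
    show "\<bar>\<epsilon>' s\<bar> \<le> n\<^sub>2\<^sup>2" for s by (rule profile_abs_le[OF p]) simp
  qed
  have "k * y (- s + c) = \<sigma> * (k * y (s + c))" if "\<sigma> \<in> S" for \<sigma> s
  proof -
    have "c = 0" using S that by (intro c0) blast
    then show ?thesis using par that by simp
  qed
  then show ?thesis unfolding r_def[symmetric] using p k
    by (intro exI[of _ \<epsilon>'] exI[of _ "\<lambda>s. k * y (s + c)"] exI[of _ "\<lambda>s. k * z (s + c)"]) blast
qed

lemma admissibleI:
  assumes p: "profile (n\<^sub>1\<^sup>2) (n\<^sub>2\<^sup>2) (n\<^sup>2) symm r \<epsilon>" and h: "helmholtz_on {-R..R} \<kappa> \<epsilon> y z"
    and bc: "z (- R) = - (\<i> * \<kappa> * of_real n) * y (- R)" "z R = (\<i> * \<kappa> * of_real n) * y R"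
    and s0: "s0 \<in> {-R..R}" "y s0 \<noteq> 0"
    and par: "\<And>\<sigma> s. \<sigma> \<in> S \<Longrightarrow> s \<in> {-R..R} \<Longrightarrow> y (- s) = \<sigma> * y s"
    and n: "0 < n\<^sub>1" and \<kappa>: "\<kappa> \<noteq> 0" and r: "0 \<le> r" "r \<le> R" "0 < R"
  shows "admissible n\<^sub>1 n\<^sub>2 n \<kappa> symm S \<epsilon>" "LL n \<epsilon> \<le> 2 * r"
proof -
  have out: "\<epsilon> s = n\<^sup>2" if "R < \<bar>s\<bar>" for s
    using p r that unfolding profile_def by auto
  have bnd: "\<bar>\<epsilon> s\<bar> \<le> n\<^sub>2\<^sup>2" for s by (rule profile_abs_le[OF p]) simp
  have meas: "\<epsilon> \<in> borel_measurable lebesgue" using p unfolding profile_def by blast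
  have "\<exists>Y. is_mode n \<epsilon> \<kappa> Y \<and>
      (\<forall>\<sigma>. (\<forall>s\<in>{-R..R}. y (- s) = \<sigma> * y s) \<longrightarrow> (\<forall>s. Y (- s) = \<sigma> * Y s))"
    by (rule outgoing_extension[OF h r(3) \<kappa> meas bnd _ bc s0]) (rule out)
  then obtain Y where Y: "is_mode n \<epsilon> \<kappa> Y"
    and Ypar: "\<forall>\<sigma>. (\<forall>s\<in>{-R..R}. y (- s) = \<sigma> * y s) \<longrightarrow> (\<forall>s. Y (- s) = \<sigma> * Y s)"
    by (elim exE conjE)
  have "AE s in lebesgue. \<epsilon> s = \<epsilon> (- s)" if symm
    by (rule AE_I2) (use p that in \<open>simp add: profile_def\<close>)
  moreover have "\<forall>\<sigma>\<in>S. \<forall>s. Y (- s) = \<sigma> * Y s" using Ypar par by blast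
  ultimately show "admissible n\<^sub>1 n\<^sub>2 n \<kappa> symm S \<epsilon>"
    using profile_imp_FF(2)[OF p n r(1)] Y unfolding admissible_def by blast
  show "LL n \<epsilon> \<le> 2 * r" using LL_le[OF profile_imp_FF(1)[OF p n r(1)]] by simp
qed

text \<open>Centred members of a minimizing sequence equal \<open>n\<^sup>2\<close> outside \<open>{-(r + \<delta>)..r + \<delta>}\<close> with
  \<open>\<delta> \<rightarrow> 0\<close>, where \<open>2 r\<close> is the infimum of the lengths, so the limit coefficient equals
  \<open>n\<^sup>2\<close> outside \<open>{-r..r}\<close> and cannot be longer than \<open>2 r\<close>.\<close>

lemma minimizer_exists:
  assumes ne: "admissible n\<^sub>1 n\<^sub>2 n \<kappa> symm S \<epsilon>0" and S: "S \<noteq> {} \<Longrightarrow> symm"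
    and n: "0 < n\<^sub>1" "n\<^sub>1\<^sup>2 \<le> n\<^sup>2" "n\<^sup>2 \<le> n\<^sub>2\<^sup>2" and \<kappa>: "\<kappa> \<noteq> 0"
  shows "\<exists>\<epsilon>. is_arg_min (LL n) (admissible n\<^sub>1 n\<^sub>2 n \<kappa> symm S) \<epsilon>"
proof -
  let ?P = "admissible n\<^sub>1 n\<^sub>2 n \<kappa> symm S"
  define V where "V = LL n ` {\<epsilon>. ?P \<epsilon>}"
  have V: "V \<noteq> {}" using ne by (auto simp: V_def)
  have nonneg: "0 \<le> LL n \<epsilon>" if P: "?P \<epsilon>" for \<epsilon>
  proof -
    have "\<exists>a b. const_outside n \<epsilon> a b" using P unfolding admissible_def FF_def by blast
    then obtain a b where "const_outside n \<epsilon> a b" by (elim exE)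
    then obtain \<alpha> \<beta> where "const_outside n \<epsilon> \<alpha> \<beta>" "LL n \<epsilon> = \<beta> - \<alpha>"
      using LL_attained by blast
    then show ?thesis unfolding const_outside_def by (elim conjE) linarith
  qed
  then have bdd: "bdd_below V" by (intro bdd_belowI[of _ 0]) (auto simp: V_def)
  define r where "r = Inf V / 2"
  have Inf_le: "2 * r \<le> LL n \<epsilon>" if "?P \<epsilon>" for \<epsilon>
    using cInf_lower[OF _ bdd, of "LL n \<epsilon>"] that by (simp add: r_def V_def)
  have r: "0 \<le> r" unfolding r_def using cInf_greatest[OF V, of 0] nonneg by (auto simp: V_def)
  \<comment> \<open>Any fixed radius larger than \<open>r\<close> leaves room for all nearly minimal structures.\<close>
  define R where "R = r + 1"
  define c where "c = \<i> * \<kappa> * of_real n"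
  have "\<exists>\<epsilon> y z. profile (n\<^sub>1\<^sup>2) (n\<^sub>2\<^sup>2) (n\<^sup>2) symm r \<epsilon> \<and> helmholtz_on {-R..R} \<kappa> \<epsilon> y z \<and>
      y (- R) = 1 \<and> z (- R) = - c \<and> z R = c * y R \<and> (\<forall>\<sigma>\<in>S. \<forall>s\<in>{-R..R}. y (- s) = \<sigma> * y s)"
  proof (rule outgoing_limit)
    show "n\<^sub>1\<^sup>2 \<le> n\<^sub>2\<^sup>2" using n by simp
    fix \<delta> :: real assume \<delta>: "0 < \<delta>"
    obtain \<epsilon> where P: "?P \<epsilon>" and lt: "LL n \<epsilon> < Inf V + min \<delta> 1"
      using cInf_lessD[OF V, of "Inf V + min \<delta> 1"] \<delta> by (auto simp: V_def)
    have "LL n \<epsilon> / 2 \<le> R" "LL n \<epsilon> / 2 \<le> r + \<delta>" using lt \<delta> by (simp_all add: R_def r_def)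
    with admissible_centred[OF P S n \<kappa>, of R]
    show "\<exists>\<epsilon> y z. profile (n\<^sub>1\<^sup>2) (n\<^sub>2\<^sup>2) (n\<^sup>2) symm (r + \<delta>) \<epsilon> \<and> helmholtz_on {-R..R} \<kappa> \<epsilon> y z \<and>
      y (- R) = 1 \<and> z (- R) = - c \<and> z R = c * y R \<and> (\<forall>\<sigma>\<in>S. \<forall>s\<in>{-R..R}. y (- s) = \<sigma> * y s)"
      unfolding c_def by (meson profile_mono)
  qed (use n r in \<open>auto simp: R_def\<close>)
  then obtain \<epsilon> y z where p: "profile (n\<^sub>1\<^sup>2) (n\<^sub>2\<^sup>2) (n\<^sup>2) symm r \<epsilon>" and h: "helmholtz_on {-R..R} \<kappa> \<epsilon> y z"
    and bc: "y (- R) = 1" "z (- R) = - c" "z R = c * y R"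
    and par: "\<forall>\<sigma>\<in>S. \<forall>s\<in>{-R..R}. y (- s) = \<sigma> * y s"
    by (elim exE conjE) blast
  have bc': "z (- R) = - (\<i> * \<kappa> * of_real n) * y (- R)" "z R = \<i> * \<kappa> * of_real n * y R"
    using bc by (simp_all add: c_def)
  have R: "0 < R" "r \<le> R" "- R \<in> {-R..R}" "y (- R) \<noteq> 0" using r bc(1) by (simp_all add: R_def)
  have adm: "?P \<epsilon>" "LL n \<epsilon> \<le> 2 * r"
    using admissibleI[OF p h bc' R(3,4) _ n(1) \<kappa> r R(2,1), of S] par by blast+
  then have "is_arg_min (LL n) ?P \<epsilon>"
    using Inf_le unfolding is_arg_min_def by (meson not_less order_trans)
  then show ?thesis by blast
qed

text \<open>The admissible class is nonempty by the three-layer structures; the second index \<open>n'\<close> may be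
  whichever of \<open>n\<^sub>1\<close>, \<open>n\<^sub>2\<close> differs from \<open>n_inf\<close>.\<close>

theorem corollary4p1:
  fixes n\<^sub>1 n\<^sub>2 n_inf :: real and \<kappa> :: complex
  assumes "0 < n\<^sub>1" and "n\<^sub>1 < n\<^sub>2" and "0 < n_inf"
    and "Im \<kappa> < 0" and "Re \<kappa> \<noteq> 0"
    and "n\<^sub>1 \<le> n_inf" and "n_inf \<le> n\<^sub>2"
  shows "{\<epsilon>. is_arg_min (LL n_inf) (\<lambda>\<epsilon>. \<epsilon> \<in> FF n\<^sub>1 n\<^sub>2 n_inf \<and> \<kappa> \<in> resonances n_inf \<epsilon>) \<epsilon>} \<noteq> {}
    \<and> {\<epsilon>. is_arg_min (LL n_inf) (\<lambda>\<epsilon>. \<epsilon> \<in> FF_sym n\<^sub>1 n\<^sub>2 n_inf \<and> \<kappa> \<in> resonances n_inf \<epsilon>) \<epsilon>} \<noteq> {}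
    \<and> {\<epsilon>. is_arg_min (LL n_inf) (\<lambda>\<epsilon>. \<epsilon> \<in> FF_sym n\<^sub>1 n\<^sub>2 n_inf \<and> \<kappa> \<in> odd_resonances n_inf \<epsilon>) \<epsilon>} \<noteq> {}
    \<and> {\<epsilon>. is_arg_min (LL n_inf) (\<lambda>\<epsilon>. \<epsilon> \<in> FF_sym n\<^sub>1 n\<^sub>2 n_inf \<and> \<kappa> \<in> even_resonances n_inf \<epsilon>) \<epsilon>} \<noteq> {}"
proof -
  let ?adm = "admissible n\<^sub>1 n\<^sub>2 n_inf \<kappa>"
  have \<kappa>: "\<kappa> \<noteq> 0" using assms(4) by auto
  have sq: "n\<^sub>1\<^sup>2 \<le> n_inf\<^sup>2" "n_inf\<^sup>2 \<le> n\<^sub>2\<^sup>2"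
    using assms by (simp_all add: power_mono)
  define n' where "n' = (if n_inf = n\<^sub>1 then n\<^sub>2 else n\<^sub>1)"
  have n': "0 < n'" "n' \<noteq> n_inf" "n\<^sub>1\<^sup>2 \<le> n'\<^sup>2" "n'\<^sup>2 \<le> n\<^sub>2\<^sup>2"
    using assms by (auto simp: n'_def power_mono)
  have parity: "\<exists>\<epsilon>. ?adm True {\<sigma>} \<epsilon>" if \<sigma>: "\<sigma>\<^sup>2 = 1" for \<sigma>
  proof (rule symmetric_resonator_exists[OF assms(3) n'(1,2) assms(4,5) \<sigma> sq(1) n'(3) sq(2) n'(4)])
    fix R \<epsilon> y z s0
    assume R: "0 < R" and p: "profile (n\<^sub>1\<^sup>2) (n\<^sub>2\<^sup>2) (n_inf\<^sup>2) True R \<epsilon>"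
      and h: "helmholtz_on {-R..R} \<kappa> \<epsilon> y z"
      and bc: "z (- R) = - (\<i> * \<kappa> * of_real n_inf) * y (- R)" "z R = (\<i> * \<kappa> * of_real n_inf) * y R"
      and s0: "s0 \<in> {-R..R}" "y s0 \<noteq> 0" and par: "\<And>s. s \<in> {-R..R} \<Longrightarrow> y (- s) = \<sigma> * y s"
    have "?adm True {\<sigma>} \<epsilon>"
      by (rule admissibleI(1)[OF p h bc s0 _ assms(1) \<kappa> _ order_refl R]) (use par R in auto)
    then show ?thesis by blast
  qed
  obtain \<epsilon>1 where 1: "?adm True {1} \<epsilon>1" using parity[of 1] by auto
  obtain \<epsilon>2 where 2: "?adm True {-1} \<epsilon>2" using parity[of "-1"] by auto
  have 3: "?adm True {} \<epsilon>1" "?adm False {} \<epsilon>1"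
    using 1 unfolding admissible_def by blast+
  have eqs: "(\<lambda>\<epsilon>. \<epsilon> \<in> FF n\<^sub>1 n\<^sub>2 n_inf \<and> \<kappa> \<in> resonances n_inf \<epsilon>) = ?adm False {}"
    "(\<lambda>\<epsilon>. \<epsilon> \<in> FF_sym n\<^sub>1 n\<^sub>2 n_inf \<and> \<kappa> \<in> resonances n_inf \<epsilon>) = ?adm True {}"
    "(\<lambda>\<epsilon>. \<epsilon> \<in> FF_sym n\<^sub>1 n\<^sub>2 n_inf \<and> \<kappa> \<in> odd_resonances n_inf \<epsilon>) = ?adm True {-1}"
    "(\<lambda>\<epsilon>. \<epsilon> \<in> FF_sym n\<^sub>1 n\<^sub>2 n_inf \<and> \<kappa> \<in> even_resonances n_inf \<epsilon>) = ?adm True {1}"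
    unfolding fun_eq_iff admissible_def FF_sym_def odd_resonances_def even_resonances_def resonances_def
    using \<kappa> by (simp_all only: mem_Collect_eq ball_simps simp_thms mult_minus1 mult_1_left) blast+
  have min: "{\<epsilon>. is_arg_min (LL n_inf) (?adm symm S) \<epsilon>} \<noteq> {}"
    if adm: "?adm symm S \<epsilon>0" and S: "S \<noteq> {} \<longrightarrow> symm" for symm S \<epsilon>0
  proof -
    have "\<exists>\<epsilon>. is_arg_min (LL n_inf) (?adm symm S) \<epsilon>"
      by (rule minimizer_exists[OF adm _ assms(1) sq \<kappa>]) (rule S[rule_format])
    then show ?thesis by blast
  qed
  show ?thesis
    unfolding eqs by (intro conjI min[OF 3(2)] min[OF 3(1)] min[OF 2] min[OF 1]) simp_all
qed

end
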